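(* Let $(M_1,J,g_1)$ be a Kählerian manifold of dimension $2n$ ($n\ge 1$) with fundamental 2-form $\Phi_1$, carrying a 1-form $\omega$ with $d\omega=\Phi_1$. Let $\beta:I\to\mathbb{E}^m$ be an open curve with unit tangent vector field $T$, let $\alpha$ be a real constant, and let $M=M_1\times\beta(I)$. Equip $M$ with the structure $$\bar\phi(X_1,hT)=\bigl(JX_1,\,-\alpha\,\omega(JX_1)\,T\bigr),\qquad \bar\eta(X_1,hT)=\alpha\,\omega(X_1)+h,\qquad \bar\xi=(0,T),$$ $$g\bigl((X_1,h_1T),(Y_1,h_2T)\bigr)=g_1(X_1,Y_1)+\bar\eta(X_1,h_1T)\,\bar\eta(Y_1,h_2T).$$ Then $(M,\bar\phi,\bar\xi,\bar\eta,g)$ is a Sasakian manifold if and only if $\alpha=1$.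
   Context: An open curve $\beta:I\to\mathbb{E}^m$ ($I$ an open interval) is a smooth curve in Euclidean space whose image $\beta(I)$ is a one-dimensional embedded manifold. Vector fields on $M=M_1\times\beta(I)$ are written $(X_1,hT)$ with $X_1\in\chi(M_1)$ and $h:I\to\mathbb{R}$ a function; tensor fields given on such fields are extended $C^\infty(M)$-linearly. A Kählerian manifold is an almost Hermitian manifold $(M_1,J,g_1)$ (so $J^2=-\mathrm{id}$ and $g_1(JX,JY)=g_1(X,Y)$) such that $J$ is parallel for the Levi-Civita connection of $g_1$. Its fundamental 2-form is $\Phi_1(X,Y)=g_1(X,JY)$. The exterior derivative of a 1-form is normalized by $2\,d\omega(X,Y)=X\omega(Y)-Y\omega(X)-\omega([X,Y])$. An almost contact metric manifold $(M,\phi,\xi,\eta,g)$ is an odd-dimensional manifold with a $(1,1)$-tensor field $\phi$, a vector field $\xi$, a 1-form $\eta$ and a metric $g$ satisfying $\phi^2X=-X+\eta(X)\xi$, $\eta(\xi)=1$ and $g(\phi X,\phi Y)=g(X,Y)-\eta(X)\eta(Y)$. It is Sasakian if $(\nabla_X\phi)Y=g(X,Y)\xi-\eta(Y)X$ for all $X,Y\in\chi(M)$, where $\nabla$ is the Levi-Civita connection of $g$. *)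

theory Defs
  imports "HOL-Analysis.Analysis"
begin

section \<open>Smooth manifolds\<close>

text \<open>Smoothness between Euclidean spaces; only meaningful for open \<open>S\<close>.\<close>

primrec Ck_on ::
  "nat \<Rightarrow> 'a::real_normed_vector set \<Rightarrow> ('a \<Rightarrow> 'b::real_normed_vector) \<Rightarrow> bool" where
  "Ck_on 0 S f \<longleftrightarrow> continuous_on S f"
| "Ck_on (Suc k) S f \<longleftrightarrow>
     (\<forall>x\<in>S. f differentiable (at x)) \<and> (\<forall>v. Ck_on k S (\<lambda>x. frechet_derivative f (at x) v))"

definition smooth_on ::
  "'a::euclidean_space set \<Rightarrow> ('a \<Rightarrow> 'b::euclidean_space) \<Rightarrow> bool" where
  "smooth_on S f \<longleftrightarrow> (\<forall>k. Ck_on k S f)"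

text \<open>A chart is a pair of its domain \<open>U\<close> and a map \<open>c\<close>, of which only the values on \<open>U\<close> matter.
  The atlas is not required to be maximal. The dimension is that of the model space \<open>'b\<close>.\<close>

record ('a, 'b) manifold =
  mtop :: "'a topology"
  atlas :: "('a set \<times> ('a \<Rightarrow> 'b)) set"

abbreviation points :: "('a, 'b) manifold \<Rightarrow> 'a set" where
  "points M \<equiv> topspace (mtop M)"

definition is_chart :: "'a topology \<Rightarrow> 'a set \<Rightarrow> ('a \<Rightarrow> 'b::euclidean_space) \<Rightarrow> bool" where
  "is_chart X U c \<longleftrightarrow> openin X U \<and> open (c ` U) \<and>
     homeomorphic_map (subtopology X U) (top_of_set (c ` U)) c"

definition smooth_manifold :: "('a, 'b::euclidean_space) manifold \<Rightarrow> bool" where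
  "smooth_manifold M \<longleftrightarrow>
     points M \<noteq> {} \<and> Hausdorff_space (mtop M) \<and> second_countable (mtop M) \<and>
     (\<forall>(U, c)\<in>atlas M. is_chart (mtop M) U c) \<and>
     (\<Union>(U, c)\<in>atlas M. U) = points M \<and>
     (\<forall>(U, c)\<in>atlas M. \<forall>(V, d)\<in>atlas M. smooth_on (c ` (U \<inter> V)) (d \<circ> inv_into U c))"

definition msmooth_on :: "('a, 'b::euclidean_space) manifold \<Rightarrow> 'a set \<Rightarrow> ('a \<Rightarrow> real) \<Rightarrow> bool" where
  "msmooth_on M W f \<longleftrightarrow> (\<forall>(U, c)\<in>atlas M. smooth_on (c ` (U \<inter> W)) (f \<circ> inv_into U c))"

text \<open>Functions that are smooth in some neighbourhood of \<open>p\<close>.\<close>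

definition smooth_near :: "('a, 'b::euclidean_space) manifold \<Rightarrow> 'a \<Rightarrow> ('a \<Rightarrow> real) set" where
  "smooth_near M p = {f. \<exists>W. openin (mtop M) W \<and> p \<in> W \<and> msmooth_on M W f}"

definition prod_manifold ::
  "('a, 'b::euclidean_space) manifold \<Rightarrow> ('c, 'd::euclidean_space) manifold \<Rightarrow>
     ('a \<times> 'c, 'b \<times> 'd) manifold" where
  "prod_manifold M N =
     \<lparr> mtop = prod_topology (mtop M) (mtop N),
       atlas = {(U \<times> V, map_prod c d) | U c V d. (U, c) \<in> atlas M \<and> (V, d) \<in> atlas N} \<rparr>"

text \<open>The structure that a subset \<open>S\<close> of a Euclidean space inherits from it: a chart is a
  diffeomorphism from a relatively open subset of \<open>S\<close> onto an open set of the model space, where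
  a map defined on a subset of a Euclidean space is smooth if it extends smoothly near each point.
  \<open>S\<close> is an embedded submanifold of dimension \<open>DIM('b)\<close> iff these charts cover it, i.e. iff
  \<open>smooth_manifold (submanifold_of S)\<close> (for nonempty \<open>S\<close>).\<close>

definition submanifold_of :: "'e::euclidean_space set \<Rightarrow> ('e, 'b::euclidean_space) manifold" where
  "submanifold_of S =
     \<lparr> mtop = top_of_set S,
       atlas = {(V, c). openin (top_of_set S) V \<and> open (c ` V) \<and> inj_on c V \<and>
                  smooth_on (c ` V) (inv_into V c) \<and>
                  (\<forall>q\<in>V. \<exists>W e. open W \<and> q \<in> W \<and> smooth_on W e \<and> (\<forall>x\<in>V \<inter> W. e x = c x))} \<rparr>"


section \<open>Tangent vectors and vector fields\<close>

text \<open>A tangent vector at \<open>p\<close> is the directional derivative operator on functions that are smooth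
  near \<open>p\<close>. The value \<open>0\<close> on all other functions makes the operator determined by the vector;
  likewise, vector fields vanish off the manifold, so that equality of vector fields is equality
  of functions.\<close>

type_synonym 'a tvec = "('a \<Rightarrow> real) \<Rightarrow> real"

definition coord_vec ::
  "('a, 'b::euclidean_space) manifold \<Rightarrow> 'a set \<times> ('a \<Rightarrow> 'b) \<Rightarrow> 'a \<Rightarrow> 'b \<Rightarrow> 'a tvec" where
  "coord_vec M \<kappa> p w = (\<lambda>f. if f \<in> smooth_near M p
     then frechet_derivative (f \<circ> inv_into (fst \<kappa>) (snd \<kappa>)) (at (snd \<kappa> p)) w else 0)"

definition tangent_space :: "('a, 'b::euclidean_space) manifold \<Rightarrow> 'a \<Rightarrow> 'a tvec set" where
  "tangent_space M p = {coord_vec M \<kappa> p w | \<kappa> w. \<kappa> \<in> atlas M \<and> p \<in> fst \<kappa>}"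

definition vector_fields :: "('a, 'b::euclidean_space) manifold \<Rightarrow> ('a \<Rightarrow> 'a tvec) set" where
  "vector_fields M = {X.
     (\<forall>p\<in>points M. X p \<in> tangent_space M p) \<and> (\<forall>p. p \<notin> points M \<longrightarrow> X p = (\<lambda>f. 0)) \<and>
     (\<forall>\<kappa>\<in>atlas M. \<forall>w. msmooth_on M (fst \<kappa>) (\<lambda>p. X p (\<lambda>q. snd \<kappa> q \<bullet> w)))}"

definition lie_bracket ::
  "('a, 'b::euclidean_space) manifold \<Rightarrow> ('a \<Rightarrow> 'a tvec) \<Rightarrow> ('a \<Rightarrow> 'a tvec) \<Rightarrow> 'a \<Rightarrow> 'a tvec" where
  "lie_bracket M X Y = (\<lambda>p f. if p \<in> points M \<and> f \<in> smooth_near M p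
     then X p (\<lambda>q. Y q f) - Y p (\<lambda>q. X q f) else 0)"


section \<open>Tensor fields\<close>

text \<open>Tensor fields are given pointwise on tangent spaces and are smooth if their components in
  every chart are. Their values at arguments that are not tangent vectors are irrelevant.\<close>

definition linear_at :: "('a, 'b::euclidean_space) manifold \<Rightarrow> 'a \<Rightarrow> ('a tvec \<Rightarrow> real) \<Rightarrow> bool" where
  "linear_at M p L \<longleftrightarrow> (\<forall>u\<in>tangent_space M p. \<forall>v\<in>tangent_space M p. \<forall>a b.
     L (\<lambda>f. a * u f + b * v f) = a * L u + b * L v)"

definition one_form :: "('a, 'b::euclidean_space) manifold \<Rightarrow> ('a \<Rightarrow> 'a tvec \<Rightarrow> real) \<Rightarrow> bool" where
  "one_form M \<omega> \<longleftrightarrow> (\<forall>p\<in>points M. linear_at M p (\<omega> p)) \<and>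
     (\<forall>\<kappa>\<in>atlas M. \<forall>w. msmooth_on M (fst \<kappa>) (\<lambda>p. \<omega> p (coord_vec M \<kappa> p w)))"

definition endo_field ::
  "('a, 'b::euclidean_space) manifold \<Rightarrow> ('a \<Rightarrow> 'a tvec \<Rightarrow> 'a tvec) \<Rightarrow> bool" where
  "endo_field M J \<longleftrightarrow>
     (\<forall>p\<in>points M. (\<forall>u\<in>tangent_space M p. J p u \<in> tangent_space M p) \<and>
        (\<forall>f. linear_at M p (\<lambda>u. J p u f))) \<and>
     (\<forall>\<kappa>\<in>atlas M. \<forall>w w'.
        msmooth_on M (fst \<kappa>) (\<lambda>p. J p (coord_vec M \<kappa> p w) (\<lambda>q. snd \<kappa> q \<bullet> w')))"

definition riemannian_metric ::
  "('a, 'b::euclidean_space) manifold \<Rightarrow> ('a \<Rightarrow> 'a tvec \<Rightarrow> 'a tvec \<Rightarrow> real) \<Rightarrow> bool" where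
  "riemannian_metric M g \<longleftrightarrow>
     (\<forall>p\<in>points M. \<forall>u\<in>tangent_space M p.
        linear_at M p (g p u) \<and> (\<forall>v\<in>tangent_space M p. g p u v = g p v u) \<and>
        (u \<noteq> (\<lambda>f. 0) \<longrightarrow> g p u u > 0)) \<and>
     (\<forall>\<kappa>\<in>atlas M. \<forall>w w'.
        msmooth_on M (fst \<kappa>) (\<lambda>p. g p (coord_vec M \<kappa> p w) (coord_vec M \<kappa> p w')))"

definition apply_endo ::
  "('a, 'b::euclidean_space) manifold \<Rightarrow> ('a \<Rightarrow> 'a tvec \<Rightarrow> 'a tvec) \<Rightarrow> ('a \<Rightarrow> 'a tvec) \<Rightarrow>
     'a \<Rightarrow> 'a tvec" where
  "apply_endo M J X = (\<lambda>p. if p \<in> points M then J p (X p) else (\<lambda>f. 0))"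

definition ext_deriv ::
  "('a, 'b::euclidean_space) manifold \<Rightarrow> ('a \<Rightarrow> 'a tvec \<Rightarrow> real) \<Rightarrow>
     ('a \<Rightarrow> 'a tvec) \<Rightarrow> ('a \<Rightarrow> 'a tvec) \<Rightarrow> 'a \<Rightarrow> real" where
  "ext_deriv M \<omega> X Y = (\<lambda>p.
     (X p (\<lambda>q. \<omega> q (Y q)) - Y p (\<lambda>q. \<omega> q (X q)) - \<omega> p (lie_bracket M X Y p)) / 2)"


section \<open>The Levi-Civita connection\<close>

definition affine_connection ::
  "('a, 'b::euclidean_space) manifold \<Rightarrow>
     (('a \<Rightarrow> 'a tvec) \<Rightarrow> ('a \<Rightarrow> 'a tvec) \<Rightarrow> 'a \<Rightarrow> 'a tvec) \<Rightarrow> bool" where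
  "affine_connection M D \<longleftrightarrow>
     (\<forall>X\<in>vector_fields M. \<forall>Y\<in>vector_fields M. D X Y \<in> vector_fields M) \<and>
     (\<forall>X\<in>vector_fields M. \<forall>Y\<in>vector_fields M. \<forall>Z\<in>vector_fields M.
        D (\<lambda>p f. X p f + Y p f) Z = (\<lambda>p f. D X Z p f + D Y Z p f) \<and>
        D X (\<lambda>p f. Y p f + Z p f) = (\<lambda>p f. D X Y p f + D X Z p f)) \<and>
     (\<forall>X\<in>vector_fields M. \<forall>Y\<in>vector_fields M. \<forall>h. msmooth_on M (points M) h \<longrightarrow>
        D (\<lambda>p f. h p * X p f) Y = (\<lambda>p f. h p * D X Y p f) \<and>
        D X (\<lambda>p f. h p * Y p f) = (\<lambda>p f. X p h * Y p f + h p * D X Y p f))"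

definition levi_civita ::
  "('a, 'b::euclidean_space) manifold \<Rightarrow> ('a \<Rightarrow> 'a tvec \<Rightarrow> 'a tvec \<Rightarrow> real) \<Rightarrow>
     (('a \<Rightarrow> 'a tvec) \<Rightarrow> ('a \<Rightarrow> 'a tvec) \<Rightarrow> 'a \<Rightarrow> 'a tvec) \<Rightarrow> bool" where
  "levi_civita M g D \<longleftrightarrow> affine_connection M D \<and>
     (\<forall>X\<in>vector_fields M. \<forall>Y\<in>vector_fields M.
        (\<lambda>p f. D X Y p f - D Y X p f) = lie_bracket M X Y) \<and>
     (\<forall>X\<in>vector_fields M. \<forall>Y\<in>vector_fields M. \<forall>Z\<in>vector_fields M. \<forall>p\<in>points M.
        X p (\<lambda>q. g q (Y q) (Z q)) = g p (D X Y p) (Z p) + g p (Y p) (D X Z p))"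

definition cov_deriv_endo ::
  "('a, 'b::euclidean_space) manifold \<Rightarrow>
     (('a \<Rightarrow> 'a tvec) \<Rightarrow> ('a \<Rightarrow> 'a tvec) \<Rightarrow> 'a \<Rightarrow> 'a tvec) \<Rightarrow> ('a \<Rightarrow> 'a tvec \<Rightarrow> 'a tvec) \<Rightarrow>
     ('a \<Rightarrow> 'a tvec) \<Rightarrow> ('a \<Rightarrow> 'a tvec) \<Rightarrow> 'a \<Rightarrow> 'a tvec" where
  "cov_deriv_endo M D J X Y = (\<lambda>p f. D X (apply_endo M J Y) p f - J p (D X Y p) f)"


section \<open>Kaehlerian and Sasakian manifolds\<close>

definition almost_hermitian ::
  "('a, 'b::euclidean_space) manifold \<Rightarrow> ('a \<Rightarrow> 'a tvec \<Rightarrow> 'a tvec) \<Rightarrow>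
     ('a \<Rightarrow> 'a tvec \<Rightarrow> 'a tvec \<Rightarrow> real) \<Rightarrow> bool" where
  "almost_hermitian M J g \<longleftrightarrow> smooth_manifold M \<and> endo_field M J \<and> riemannian_metric M g \<and>
     (\<forall>p\<in>points M. \<forall>u\<in>tangent_space M p. J p (J p u) = (\<lambda>f. - u f)) \<and>
     (\<forall>p\<in>points M. \<forall>u\<in>tangent_space M p. \<forall>v\<in>tangent_space M p.
        g p (J p u) (J p v) = g p u v)"

text \<open>The Levi-Civita connection exists and is unique, so quantifying it existentially is the
  same as referring to it.\<close>

definition kaehler_manifold ::
  "('a, 'b::euclidean_space) manifold \<Rightarrow> ('a \<Rightarrow> 'a tvec \<Rightarrow> 'a tvec) \<Rightarrow>
     ('a \<Rightarrow> 'a tvec \<Rightarrow> 'a tvec \<Rightarrow> real) \<Rightarrow> bool" where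
  "kaehler_manifold M J g \<longleftrightarrow> almost_hermitian M J g \<and>
     (\<exists>D. levi_civita M g D \<and>
       (\<forall>X\<in>vector_fields M. \<forall>Y\<in>vector_fields M. \<forall>p\<in>points M.
          cov_deriv_endo M D J X Y p = (\<lambda>f. 0)))"

definition fundamental_form ::
  "('a \<Rightarrow> 'a tvec \<Rightarrow> 'a tvec) \<Rightarrow> ('a \<Rightarrow> 'a tvec \<Rightarrow> 'a tvec \<Rightarrow> real) \<Rightarrow>
     ('a \<Rightarrow> 'a tvec) \<Rightarrow> ('a \<Rightarrow> 'a tvec) \<Rightarrow> 'a \<Rightarrow> real" where
  "fundamental_form J g X Y = (\<lambda>p. g p (X p) (J p (Y p)))"

definition almost_contact_metric ::
  "('a, 'b::euclidean_space) manifold \<Rightarrow> ('a \<Rightarrow> 'a tvec \<Rightarrow> 'a tvec) \<Rightarrow> ('a \<Rightarrow> 'a tvec) \<Rightarrow>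
     ('a \<Rightarrow> 'a tvec \<Rightarrow> real) \<Rightarrow> ('a \<Rightarrow> 'a tvec \<Rightarrow> 'a tvec \<Rightarrow> real) \<Rightarrow> bool" where
  "almost_contact_metric (M :: ('a, 'b) manifold) \<phi> \<xi> \<eta> g \<longleftrightarrow>
     smooth_manifold M \<and> odd DIM('b) \<and>
     endo_field M \<phi> \<and> \<xi> \<in> vector_fields M \<and> one_form M \<eta> \<and> riemannian_metric M g \<and>
     (\<forall>p\<in>points M. \<forall>u\<in>tangent_space M p. \<phi> p (\<phi> p u) = (\<lambda>f. - u f + \<eta> p u * \<xi> p f)) \<and>
     (\<forall>p\<in>points M. \<eta> p (\<xi> p) = 1) \<and>
     (\<forall>p\<in>points M. \<forall>u\<in>tangent_space M p. \<forall>v\<in>tangent_space M p.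
        g p (\<phi> p u) (\<phi> p v) = g p u v - \<eta> p u * \<eta> p v)"

definition sasakian_manifold ::
  "('a, 'b::euclidean_space) manifold \<Rightarrow> ('a \<Rightarrow> 'a tvec \<Rightarrow> 'a tvec) \<Rightarrow> ('a \<Rightarrow> 'a tvec) \<Rightarrow>
     ('a \<Rightarrow> 'a tvec \<Rightarrow> real) \<Rightarrow> ('a \<Rightarrow> 'a tvec \<Rightarrow> 'a tvec \<Rightarrow> real) \<Rightarrow> bool" where
  "sasakian_manifold M \<phi> \<xi> \<eta> g \<longleftrightarrow> almost_contact_metric M \<phi> \<xi> \<eta> g \<and>
     (\<exists>D. levi_civita M g D \<and>
       (\<forall>X\<in>vector_fields M. \<forall>Y\<in>vector_fields M. \<forall>p\<in>points M.
          cov_deriv_endo M D \<phi> X Y p = (\<lambda>f. g p (X p) (Y p) * \<xi> p f - \<eta> p (Y p) * X p f)))"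


section \<open>Open curves\<close>

definition open_curve :: "real set \<Rightarrow> (real \<Rightarrow> 'e::euclidean_space) \<Rightarrow> bool" where
  "open_curve I \<beta> \<longleftrightarrow> open I \<and> is_interval I \<and> smooth_on I \<beta> \<and>
     smooth_manifold (submanifold_of (\<beta> ` I) :: ('e, real) manifold)"

text \<open>The image of a tangent vector of a submanifold under the differential of the inclusion.\<close>

definition ambient_vec :: "'e::euclidean_space tvec \<Rightarrow> 'e" where
  "ambient_vec v = (\<Sum>b\<in>Basis. v (\<lambda>x. x \<bullet> b) *\<^sub>R b)"

text \<open>The second condition orients \<open>T\<close> along \<open>\<beta>\<close>; where \<open>\<beta>' \<noteq> 0\<close> it says \<open>T = \<beta>' / |\<beta>'|\<close>.\<close>

definition unit_tangent_field ::
  "real set \<Rightarrow> (real \<Rightarrow> 'e::euclidean_space) \<Rightarrow> ('e \<Rightarrow> 'e tvec) \<Rightarrow> bool" where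
  "unit_tangent_field I \<beta> T \<longleftrightarrow>
     T \<in> vector_fields (submanifold_of (\<beta> ` I) :: ('e, real) manifold) \<and>
     (\<forall>s\<in>I. norm (ambient_vec (T (\<beta> s))) = 1 \<and>
        vector_derivative \<beta> (at s) =
          norm (vector_derivative \<beta> (at s)) *\<^sub>R ambient_vec (T (\<beta> s)))"


section \<open>The structure on the product with a curve\<close>

text \<open>The tangent space of \<open>M \<times> N\<close> at \<open>(p, q)\<close> consists of the pairs of a tangent vector of \<open>M\<close> at
  \<open>p\<close> and a tangent vector of \<open>N\<close> at \<open>q\<close>; \<open>tan_fst\<close> and \<open>tan_snd\<close>, the differentials of the
  projections, take such a pair apart.\<close>

definition tan_pair ::
  "('a, 'b::euclidean_space) manifold \<Rightarrow> ('c, 'd::euclidean_space) manifold \<Rightarrow>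
     'a \<times> 'c \<Rightarrow> 'a tvec \<Rightarrow> 'c tvec \<Rightarrow> ('a \<times> 'c) tvec" where
  "tan_pair M N z u v = (\<lambda>f. if f \<in> smooth_near (prod_manifold M N) z
     then u (\<lambda>x. f (x, snd z)) + v (\<lambda>y. f (fst z, y)) else 0)"

definition tan_fst :: "('a \<times> 'c) tvec \<Rightarrow> 'a tvec" where
  "tan_fst w = (\<lambda>f. w (f \<circ> fst))"

definition tan_snd :: "('a \<times> 'c) tvec \<Rightarrow> 'c tvec" where
  "tan_snd w = (\<lambda>f. w (f \<circ> snd))"

text \<open>The number \<open>h\<close> for which \<open>w\<close> has the form \<open>(u, hT)\<close>. It exists and is unique, as \<open>T\<close> spans
  the tangent spaces of the curve. Hence the pointwise definitions below are the
  \<open>C\<^sup>\<infinity>(M)\<close>-linear extensions of the formulas on vector fields of the form \<open>(X, hT)\<close>.\<close>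

definition curve_coeff :: "('e \<Rightarrow> 'e tvec) \<Rightarrow> 'a \<times> 'e \<Rightarrow> ('a \<times> 'e) tvec \<Rightarrow> real" where
  "curve_coeff T z w = (THE h. tan_snd w = (\<lambda>f. h * T (snd z) f))"

definition bar_phi ::
  "('a, 'b::euclidean_space) manifold \<Rightarrow> ('e, 'd::euclidean_space) manifold \<Rightarrow>
     ('a \<Rightarrow> 'a tvec \<Rightarrow> 'a tvec) \<Rightarrow> ('a \<Rightarrow> 'a tvec \<Rightarrow> real) \<Rightarrow> ('e \<Rightarrow> 'e tvec) \<Rightarrow> real \<Rightarrow>
     'a \<times> 'e \<Rightarrow> ('a \<times> 'e) tvec \<Rightarrow> ('a \<times> 'e) tvec" where
  "bar_phi M N J \<omega> T \<alpha> z w =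
     tan_pair M N z (J (fst z) (tan_fst w))
       (\<lambda>f. - \<alpha> * \<omega> (fst z) (J (fst z) (tan_fst w)) * T (snd z) f)"

definition bar_eta ::
  "('a \<Rightarrow> 'a tvec \<Rightarrow> real) \<Rightarrow> ('e \<Rightarrow> 'e tvec) \<Rightarrow> real \<Rightarrow> 'a \<times> 'e \<Rightarrow> ('a \<times> 'e) tvec \<Rightarrow> real" where
  "bar_eta \<omega> T \<alpha> z w = \<alpha> * \<omega> (fst z) (tan_fst w) + curve_coeff T z w"

definition bar_xi ::
  "('a, 'b::euclidean_space) manifold \<Rightarrow> ('e, 'd::euclidean_space) manifold \<Rightarrow>
     ('e \<Rightarrow> 'e tvec) \<Rightarrow> 'a \<times> 'e \<Rightarrow> ('a \<times> 'e) tvec" where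
  "bar_xi M N T z =
     (if z \<in> points (prod_manifold M N) then tan_pair M N z (\<lambda>f. 0) (T (snd z)) else (\<lambda>f. 0))"

definition bar_g ::
  "('a \<Rightarrow> 'a tvec \<Rightarrow> 'a tvec \<Rightarrow> real) \<Rightarrow> ('a \<Rightarrow> 'a tvec \<Rightarrow> real) \<Rightarrow> ('e \<Rightarrow> 'e tvec) \<Rightarrow> real \<Rightarrow>
     'a \<times> 'e \<Rightarrow> ('a \<times> 'e) tvec \<Rightarrow> ('a \<times> 'e) tvec \<Rightarrow> real" where
  "bar_g g\<^sub>1 \<omega> T \<alpha> z w w' =
     g\<^sub>1 (fst z) (tan_fst w) (tan_fst w') + bar_eta \<omega> T \<alpha> z w * bar_eta \<omega> T \<alpha> z w'"

end

theory Submission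
  imports Defs
begin

text \<open>The projection \<open>M \<rightarrow> M\<^sub>1\<close> is a Riemannian submersion whose fibres are the integral curves of the
  unit field \<open>\<xi>\<close>, and \<open>\<eta>\<close> has exterior derivative \<open>\<alpha> \<Phi>\<^sub>1\<close>, pulled back, because the component of
  \<open>\<eta>\<close> along the curve is closed. On a Sasakian manifold the defining equation, applied to \<open>\<xi>\<close>,
  gives \<open>\<nabla>\<^sub>X \<xi> = - \<phi> X\<close>, and torsion-freeness turns this into \<open>d\<eta>(X, Y) = g(X, \<phi> Y) = \<Phi>\<^sub>1(X\<^sub>1, Y\<^sub>1)\<close>.
  Since \<open>\<Phi>\<^sub>1 \<noteq> 0\<close> this forces \<open>\<alpha> = 1\<close>. Conversely, for \<open>\<alpha> = 1\<close> the Levi-Civita connection of \<open>M\<close> is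
  written down explicitly in terms of that of \<open>M\<^sub>1\<close>: the horizontal part of \<open>\<nabla>\<^sub>X Y\<close> is
  \<open>\<nabla>\<^sup>1\<^sub>X Y\<^sub>1 - \<eta>(X) J Y\<^sub>1 - \<eta>(Y) J X\<^sub>1\<close> and \<open>\<eta>(\<nabla>\<^sub>X Y) = X(\<eta>(Y)) + g\<^sub>1(Y\<^sub>1, J X\<^sub>1)\<close>, where \<open>\<nabla>\<^sup>1\<close> is applied to
  the restrictions of the fields to the slices \<open>M\<^sub>1 \<times> {q}\<close> and completed by differentiation along the
  curve. With \<open>J\<close> parallel the Sasakian equation is then an algebraic identity.\<close>

section \<open>Calculus of smooth maps\<close>

text \<open>Both components of a vector field on the product vary over the whole product, so it is
  not a pair of fields on the factors. It is handled through its slices over fixed points of the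
  curve and through \<open>dT\<close>, the derivative of its base component along the curve at a
  fixed base point. There all values lie in one vector space, so this derivative involves no
  connection. The main obstacle is smoothness. A connection acts on global fields of the base only,
  and applying it slice by slice says nothing about dependence on the curve point. This forces the
  coordinate formula \<open>connection_local\<close>, and with it bump functions. The symmetry of
  second derivatives is needed because tangent vectors are operators: a bracket must be shown to be
  of first order. A tangent vector of the product is described by its projection and its value under
  \<eta>, not by its coefficient along \<open>T\<close>. In these coordinates \<phi>, \<xi> and the
  metric become \<open>(u, r)\<close> to \<open>(J u, 0)\<close>, the vector \<open>(0, 1)\<close>,
  and the sum of the base metric and the product of the second entries. The form \<omega> and the
  constant \<alpha> come back only through \<eta> of a bracket, which is why \<alpha> = 1 is decided
  by torsion.\<close>

lemma Ck_on_subset: "Ck_on k S f \<Longrightarrow> T \<subseteq> S \<Longrightarrow> Ck_on k T f"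
  by (induction k arbitrary: f) (auto intro: continuous_on_subset)

lemma Ck_on_SucD: "Ck_on (Suc k) S f \<Longrightarrow> Ck_on k S f"
proof (induction k arbitrary: f)
  case 0
  then show ?case
    by (auto intro!: continuous_at_imp_continuous_on differentiable_imp_continuous_within)
next
  case (Suc k)
  then show ?case
    by (metis Ck_on.simps(2))
qed

text \<open>Derivatives are taken along the full filter \<open>at x\<close>, so agreement of
  \<open>f\<close> and \<open>g\<close> passes to them because \<open>S\<close> is a neighbourhood
  of each of its points. The later inductions use this to replace a formal derivative by the formula
  that a differentiation rule gives for it.\<close>

lemma Ck_on_cong:
  assumes "open S" "\<And>x. x \<in> S \<Longrightarrow> f x = g x" "Ck_on k S f"
  shows "Ck_on k S g"
  using assms(2,3)
proof (induction k arbitrary: f g)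
  case 0
  then show ?case by (metis Ck_on.simps(1) continuous_on_cong)
next
  case (Suc k)
  have *: "(g has_derivative frechet_derivative f (at x)) (at x)" if "x \<in> S" for x
  proof (rule has_derivative_transform_within_open[OF _ assms(1) that])
    show "(f has_derivative frechet_derivative f (at x)) (at x)"
      using Suc.prems that by (simp add: frechet_derivative_works[symmetric])
  qed (use Suc.prems in auto)
  show ?case
  proof -
    have "Ck_on k S (\<lambda>x. frechet_derivative g (at x) v)" for v
      by (rule Suc.IH[of "\<lambda>x. frechet_derivative f (at x) v"])
        (use Suc.prems frechet_derivative_at[OF *] in auto)
    then show ?thesis using * by (auto simp: differentiable_def)
  qed
qed

lemma Ck_on_const: "Ck_on k S (\<lambda>x. c)"
  by (induction k arbitrary: c) (auto simp: frechet_derivative_const)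

lemma bounded_linear_frechet_derivative:
  "bounded_linear f \<Longrightarrow> frechet_derivative f (at x) = f"
  by (metis frechet_derivative_at bounded_linear_imp_has_derivative)

lemma Ck_on_bounded_linear: "bounded_linear f \<Longrightarrow> Ck_on k S f"
  by (cases k) (auto simp: bounded_linear_frechet_derivative Ck_on_const
      bounded_linear_imp_differentiable linear_continuous_on)

lemma Ck_on_add:
  assumes "open S" "Ck_on k S f" "Ck_on k S g"
  shows "Ck_on k S (\<lambda>x. f x + g x)"
  using assms(2,3)
proof (induction k arbitrary: f g)
  case 0
  then show ?case by (auto intro: continuous_intros)
next
  case (Suc k)
  have *: "frechet_derivative f (at x) v + frechet_derivative g (at x) v
      = frechet_derivative (\<lambda>x. f x + g x) (at x) v" if "x \<in> S" for x v
  proof -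
    have "((\<lambda>x. f x + g x) has_derivative
        (\<lambda>v. frechet_derivative f (at x) v + frechet_derivative g (at x) v)) (at x)"
      using Suc.prems that by (intro has_derivative_add) (auto simp: frechet_derivative_works[symmetric])
    from frechet_derivative_at[OF this] show ?thesis by metis
  qed
  show ?case
    unfolding Ck_on.simps
  proof safe
    fix x assume "x \<in> S" then show "(\<lambda>x. f x + g x) differentiable (at x)"
      using Suc.prems by (auto intro: differentiable_add)
  next
    fix v show "Ck_on k S (\<lambda>x. frechet_derivative (\<lambda>x. f x + g x) (at x) v)"
      using Suc by (intro Ck_on_cong[OF assms(1) *] Suc.IH) auto
  qed
qed

lemma Ck_on_sum:
  assumes "open S" "finite A" "\<And>i. i \<in> A \<Longrightarrow> Ck_on k S (f i)"
  shows "Ck_on k S (\<lambda>x. \<Sum>i\<in>A. f i x)"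
  using assms(2,3) by (induction) (auto intro: Ck_on_const Ck_on_add[OF assms(1)])

text \<open>This covers products, scalar multiples and inner products at once. Each summand of the
  derivative is again a value of \<open>h\<close>, with one argument differentiated and the other
  needed only to order \<open>k\<close>, so the induction closes with \<open>f\<close> and
  \<open>g\<close> generalized.\<close>

lemma Ck_on_bilinear:
  assumes "open S" "bounded_bilinear h" "Ck_on k S f" "Ck_on k S g"
  shows "Ck_on k S (\<lambda>x. h (f x) (g x))"
  using assms(3,4)
proof (induction k arbitrary: f g)
  case 0
  then show ?case using assms(2) by (auto intro: bounded_bilinear.continuous_on)
next
  case (Suc k)
  have D: "((\<lambda>x. h (f x) (g x)) has_derivative
      (\<lambda>v. h (f x) (frechet_derivative g (at x) v) + h (frechet_derivative f (at x) v) (g x))) (at x)"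
    if "x \<in> S" for x
    using Suc.prems that assms(2)
    by (auto intro!: bounded_bilinear.FDERIV simp: frechet_derivative_works[symmetric])
  then have *: "h (f x) (frechet_derivative g (at x) v) + h (frechet_derivative f (at x) v) (g x)
      = frechet_derivative (\<lambda>x. h (f x) (g x)) (at x) v" if "x \<in> S" for x v
    using frechet_derivative_at[OF D[OF that]] by metis
  show ?case
    unfolding Ck_on.simps
  proof safe
    fix x assume "x \<in> S" then show "(\<lambda>x. h (f x) (g x)) differentiable (at x)"
      using D by (auto simp: differentiable_def)
  next
    fix v show "Ck_on k S (\<lambda>x. frechet_derivative (\<lambda>x. h (f x) (g x)) (at x) v)"
      using Suc.prems
      by (intro Ck_on_cong[OF assms(1) *] Ck_on_add assms Suc.IH) (auto intro: Ck_on_SucD)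
  qed
qed

lemma linear_euclidean_expand:
  assumes "linear L"
  shows "L v = (\<Sum>b\<in>Basis. (v \<bullet> b) *\<^sub>R L b)"
proof -
  have "L v = L (\<Sum>b\<in>Basis. (v \<bullet> b) *\<^sub>R b)"
    by (simp only: euclidean_representation)
  also have "\<dots> = (\<Sum>b\<in>Basis. (v \<bullet> b) *\<^sub>R L b)"
    using assms by (simp add: linear_sum linear_scale)
  finally show ?thesis .
qed

text \<open>The chain rule evaluates the derivative of \<open>g\<close> at the moving vector
  \<open>?F x v\<close>, whereas \<open>Ck_on\<close> controls derivatives in fixed directions only.
  Expanding that vector in the basis gives a sum of products of its coordinates with fixed partial
  derivatives of \<open>g\<close> composed with \<open>f\<close>, to which the induction hypothesis
  applies.\<close>

lemma Ck_on_compose: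
  fixes f :: "'a::euclidean_space \<Rightarrow> 'b::euclidean_space" and g :: "'b \<Rightarrow> 'c::euclidean_space"
  assumes "open S" "open T" "f ` S \<subseteq> T" "Ck_on k S f" "Ck_on k T g"
  shows "Ck_on k S (g \<circ> f)"
  using assms(4,5)
proof (induction k arbitrary: g)
  case 0
  then show ?case using assms(3)
    unfolding Ck_on.simps by (meson continuous_on_compose continuous_on_subset)
next
  case (Suc k)
  let ?F = "\<lambda>x. frechet_derivative f (at x)" and ?G = "\<lambda>x. frechet_derivative g (at x)"
  have D: "((g \<circ> f) has_derivative (?G (f x) \<circ> ?F x)) (at x)" if "x \<in> S" for x
    using Suc.prems that assms(3)
    by (auto intro!: diff_chain_at simp: frechet_derivative_works[symmetric])
  have *: "(\<Sum>b\<in>Basis. (?F x v \<bullet> b) *\<^sub>R (((\<lambda>y. ?G y b) \<circ> f) x)) = frechet_derivative (g \<circ> f) (at x) v"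
    if "x \<in> S" for x v
  proof -
    have "linear (?G (f x))"
      using Suc.prems that assms(3) by (auto intro!: linear_frechet_derivative)
    then have "?G (f x) (?F x v) = (\<Sum>b\<in>Basis. (?F x v \<bullet> b) *\<^sub>R ?G (f x) b)"
      by (rule linear_euclidean_expand)
    then show ?thesis
      by (simp flip: frechet_derivative_at[OF D[OF that]])
  qed
  show ?case
    unfolding Ck_on.simps
  proof safe
    fix x assume "x \<in> S" then show "(g \<circ> f) differentiable (at x)"
      using D by (auto simp: differentiable_def)
  next
    fix v
    have "Ck_on k S (\<lambda>x. ?F x v \<bullet> b)" for b
      using Suc.prems assms(1) by (intro Ck_on_bilinear[OF _ bounded_bilinear_inner]) (auto simp: Ck_on_const)
    moreover have "Ck_on k S ((\<lambda>y. ?G y b) \<circ> f)" for b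
      using Suc.prems by (intro Suc.IH) (auto intro: Ck_on_SucD)
    ultimately show "Ck_on k S (\<lambda>x. frechet_derivative (g \<circ> f) (at x) v)"
      by (intro Ck_on_cong[OF assms(1) *] Ck_on_sum Ck_on_bilinear[OF _ bounded_bilinear_scaleR] assms)
        (auto simp: o_def)
  qed
qed

text \<open>The derivative of \<open>inverse\<close> is a polynomial in \<open>inverse\<close>
  itself, so the product rule for \<open>Ck_on\<close> closes the induction.\<close>

lemma Ck_on_inverse: "Ck_on k (- {0}) (inverse :: real \<Rightarrow> real)"
proof (induction k)
  case 0
  then show ?case by (auto intro!: continuous_intros)
next
  case (Suc k)
  have D: "(inverse has_derivative (\<lambda>v. - (inverse x * v * inverse x))) (at x)" if "x \<noteq> 0" for x :: real
    using that by (auto intro!: derivative_eq_intros simp: field_simps)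
  then have *: "- (inverse x * v * inverse x) = frechet_derivative inverse (at x) v"
    if "x \<in> - {0}" for x v :: real
    using that frechet_derivative_at[OF D] by (metis ComplD singletonI)
  show ?case
    unfolding Ck_on.simps
  proof (intro conjI ballI allI)
    fix x :: real assume "x \<in> - {0}" then show "inverse differentiable (at x)"
      using D differentiableI by fastforce
  next
    fix v :: real
    have "Ck_on k (- {0::real}) (\<lambda>x. (inverse x * v) * inverse x * (-1))"
      using Suc by (intro Ck_on_bilinear[OF _ bounded_bilinear_mult] Ck_on_const) auto
    then show "Ck_on k (- {0}) (\<lambda>x. frechet_derivative inverse (at x) v)"
      by (rule Ck_on_cong[rotated 2]) (use * in auto)
  qed
qed

text \<open>The family \<open>t\<^bsup>-n\<^esup> exp (-1/t)\<close> is closed under differentiation up to linear combinations, which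
  gives the smoothness of all its members at once.\<close>

definition flat_fun :: "nat \<Rightarrow> real \<Rightarrow> real" where
  "flat_fun n t = (if t > 0 then inverse t ^ n * exp (- inverse t) else 0)"

lemma flat_fun_has_derivative:
  "(flat_fun n has_real_derivative flat_fun (n + 2) t - n * flat_fun (n + 1) t) (at t)"
proof -
  consider "t > 0" | "t < 0" | "t = 0" by linarith
  then show ?thesis
  proof cases
    case 1
    have "((\<lambda>t. inverse t ^ n * exp (- inverse t)) has_real_derivative
        flat_fun (n + 2) t - n * flat_fun (n + 1) t) (at t)"
    proof -
      \<comment> \<open>The exponent \<open>n - 1\<close> is truncated at \<open>n = 0\<close>,
        where the factor \<open>n\<close> makes both sides vanish.\<close>
      have "real n * inverse t ^ (n - 1) * (inverse t * inverse t) = n * inverse t ^ (n + 1)"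
        by (cases n) auto
      then show ?thesis
        using 1 by (auto intro!: derivative_eq_intros simp: flat_fun_def power2_eq_square algebra_simps)
    qed
    then show ?thesis
      by (rule DERIV_cong_ev[THEN iffD1, rotated -1])
        (use 1 in \<open>auto simp: flat_fun_def eventually_nhds intro!: exI[of _ "{0<..}"]\<close>)
  next
    case 2
    have "((\<lambda>t. 0) has_real_derivative flat_fun (n + 2) t - n * flat_fun (n + 1) t) (at t)"
      using 2 by (auto simp: flat_fun_def)
    then show ?thesis
      by (rule DERIV_cong_ev[THEN iffD1, rotated -1])
        (use 2 in \<open>auto simp: flat_fun_def eventually_nhds intro!: exI[of _ "{..<0}"]\<close>)
  next
    case 3
    \<comment> \<open>With \<open>inverse t\<close> substituted for \<open>t\<close>, this
      expression becomes the difference quotient of \<open>flat_fun n\<close> at 0 from the right.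
      From the left the quotient is identically 0.\<close>
    have "((\<lambda>t. (t::real) ^ (n + 1) / exp t) \<longlongrightarrow> 0) at_top"
      by (rule tendsto_power_div_exp_0)
    then have "((\<lambda>t. inverse t ^ (n + 1) / exp (inverse t)) \<longlongrightarrow> (0::real)) (at_right 0)"
      by (rule filterlim_compose) (rule filterlim_inverse_at_top_right)
    moreover have "eventually (\<lambda>t. inverse t ^ (n + 1) / exp (inverse t) = (flat_fun n t - flat_fun n 0) / t)
        (at_right (0::real))"
      by (auto simp: eventually_at_right_field flat_fun_def exp_minus field_simps intro!: exI[of _ 1])
    ultimately have R: "((\<lambda>t. (flat_fun n t - flat_fun n 0) / t) \<longlongrightarrow> 0) (at_right (0::real))"
      by (rule Lim_transform_eventually)
    have L: "((\<lambda>t. (flat_fun n t - flat_fun n 0) / t) \<longlongrightarrow> 0) (at_left (0::real))"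
      by (rule tendsto_eventually) (auto simp: eventually_at_left_field flat_fun_def intro!: exI[of _ "-1"])
    have "((\<lambda>t. (flat_fun n t - flat_fun n 0) / (t - 0)) \<longlongrightarrow> 0) (at 0)"
      using L R by (simp add: filterlim_split_at_real)
    then have "(flat_fun n has_real_derivative 0) (at 0)"
      unfolding has_field_derivative_iff .
    then show ?thesis using 3 by (simp add: flat_fun_def)
  qed
qed

lemma Ck_on_flat_fun: "Ck_on k UNIV (flat_fun n)"
proof (induction k arbitrary: n)
  case 0
  show ?case
    using flat_fun_has_derivative by (auto intro!: continuous_at_imp_continuous_on DERIV_isCont)
next
  case (Suc k)
  have D: "(flat_fun n has_derivative (\<lambda>v. (flat_fun (n + 2) t - n * flat_fun (n + 1) t) * v)) (at t)" for t n
    using flat_fun_has_derivative has_field_derivative_def by blast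
  have *: "(flat_fun (n + 2) t + (- real n) * flat_fun (n + 1) t) * v = frechet_derivative (flat_fun n) (at t) v" for t v
    using frechet_derivative_at[OF D] by (metis add_uminus_conv_diff mult_minus_left)
  have "Ck_on k UNIV (\<lambda>t. (flat_fun (n + 2) t + (- real n) * flat_fun (n + 1) t) * v)" for v
    by (intro Ck_on_bilinear[OF _ bounded_bilinear_mult] Ck_on_add Ck_on_const Suc) auto
  then show ?case
    unfolding * using D by (auto simp: differentiable_def)
qed

section \<open>Smoothness on open sets and at a point\<close>

lemma smooth_on_subset: "smooth_on S f \<Longrightarrow> T \<subseteq> S \<Longrightarrow> smooth_on T f"
  by (auto simp: smooth_on_def intro: Ck_on_subset)

lemma smooth_on_cong:
  "open S \<Longrightarrow> (\<And>x. x \<in> S \<Longrightarrow> f x = g x) \<Longrightarrow> smooth_on S f \<Longrightarrow> smooth_on S g"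
  by (meson Ck_on_cong smooth_on_def)

lemma smooth_on_compose:
  "open S \<Longrightarrow> open T \<Longrightarrow> f ` S \<subseteq> T \<Longrightarrow> smooth_on S f \<Longrightarrow> smooth_on T g \<Longrightarrow> smooth_on S (g \<circ> f)"
  by (auto simp: smooth_on_def intro: Ck_on_compose)

lemma Ck_on_local:
  assumes "\<And>x. x \<in> S \<Longrightarrow> \<exists>T. open T \<and> x \<in> T \<and> Ck_on k T f"
  shows "Ck_on k S f"
  using assms
proof (induction k arbitrary: f)
  case 0
  then show ?case
    by (metis Ck_on.simps(1) at_within_open continuous_at_imp_continuous_on continuous_on_eq_continuous_within)
next
  case (Suc k)
  then show ?case unfolding Ck_on.simps by metis
qed

text \<open>A property of the germ at \<open>x\<close>: chart representatives can then be compared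
  by eventual equality, without tracking the sets on which they agree.\<close>

definition smooth_at :: "'a::euclidean_space \<Rightarrow> ('a \<Rightarrow> 'b::euclidean_space) \<Rightarrow> bool" where
  "smooth_at x f \<longleftrightarrow> (\<exists>S. open S \<and> x \<in> S \<and> smooth_on S f)"

lemma smooth_on_iff_smooth_at: "open S \<Longrightarrow> smooth_on S f \<longleftrightarrow> (\<forall>x\<in>S. smooth_at x f)"
  unfolding smooth_at_def smooth_on_def by (metis Ck_on_local)

lemma smooth_at_eventually: "smooth_at x f \<Longrightarrow> eventually (\<lambda>y. smooth_at y f) (nhds x)"
  unfolding smooth_at_def eventually_nhds by blast

lemma smooth_at_cong:
  assumes "eventually (\<lambda>y. f y = g y) (nhds x)" "smooth_at x f"
  shows "smooth_at x g"
proof -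
  obtain S where S: "open S" "x \<in> S" "\<And>y. y \<in> S \<Longrightarrow> f y = g y"
    using assms(1) unfolding eventually_nhds by blast
  obtain T where T: "open T" "x \<in> T" "smooth_on T f"
    using assms(2) unfolding smooth_at_def by blast
  have "smooth_on (S \<inter> T) g"
    by (rule smooth_on_cong[of _ f]) (use S T in \<open>auto intro: smooth_on_subset\<close>)
  then show ?thesis
    unfolding smooth_at_def using S T by blast
qed

lemma smooth_at_differentiable: "smooth_at x f \<Longrightarrow> f differentiable (at x)"
  unfolding smooth_at_def smooth_on_def by (metis Ck_on.simps(2))

lemma smooth_at_isCont: "smooth_at x f \<Longrightarrow> isCont f x"
  by (simp add: differentiable_imp_continuous_within smooth_at_differentiable)

lemma smooth_at_derivative:
  "smooth_at x f \<Longrightarrow> smooth_at x (\<lambda>y. frechet_derivative f (at y) v)"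
  unfolding smooth_at_def smooth_on_def by (metis Ck_on.simps(2))

lemma smooth_at_const: "smooth_at x (\<lambda>_. c)"
  by (auto simp: smooth_at_def smooth_on_def Ck_on_const)

lemma smooth_at_bounded_linear: "bounded_linear f \<Longrightarrow> smooth_at x f"
  by (auto simp: smooth_at_def smooth_on_def Ck_on_bounded_linear)

lemma smooth_at_common:
  assumes "smooth_at x f" "smooth_at x g"
  obtains S where "open S" "x \<in> S" "smooth_on S f" "smooth_on S g"
proof -
  obtain A B where "open A" "x \<in> A" "smooth_on A f" "open B" "x \<in> B" "smooth_on B g"
    using assms unfolding smooth_at_def by blast
  then show thesis
    by (intro that[of "A \<inter> B"]) (auto intro: smooth_on_subset)
qed

lemma smooth_at_add:
  assumes "smooth_at x f" "smooth_at x g"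
  shows "smooth_at x (\<lambda>y. f y + g y)"
  by (rule smooth_at_common[OF assms]) (auto simp: smooth_at_def smooth_on_def intro: Ck_on_add)

lemma smooth_at_bilinear:
  assumes "smooth_at x f" "smooth_at x g" "bounded_bilinear h"
  shows "smooth_at x (\<lambda>y. h (f y) (g y))"
  by (rule smooth_at_common[OF assms(1,2)])
    (use assms(3) in \<open>auto simp: smooth_at_def smooth_on_def intro: Ck_on_bilinear\<close>)

lemma smooth_at_compose:
  assumes "smooth_at x f" "smooth_at (f x) g"
  shows "smooth_at x (g \<circ> f)"
proof -
  obtain S where S: "open S" "x \<in> S" "smooth_on S f" using assms(1) smooth_at_def by blast
  obtain T where T: "open T" "f x \<in> T" "smooth_on T g" using assms(2) smooth_at_def by blast
  have "continuous_on S f"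
    using S(3) unfolding smooth_on_def by (metis Ck_on.simps(1))
  then have "open (f -` T \<inter> S)"
    using S(1) T(1) by (simp add: continuous_on_open_vimage)
  moreover have "smooth_on (f -` T \<inter> S) (g \<circ> f)"
    using S T calculation by (intro smooth_on_compose) (auto intro: smooth_on_subset)
  ultimately show ?thesis unfolding smooth_at_def using S T by blast
qed

lemma smooth_at_inverse:
  fixes f :: "'a::euclidean_space \<Rightarrow> real"
  assumes "smooth_at x f" "f x \<noteq> 0"
  shows "smooth_at x (\<lambda>y. inverse (f y))"
proof -
  have "smooth_at (f x) inverse"
    unfolding smooth_at_def smooth_on_def using assms(2) Ck_on_inverse
    by (intro exI[of _ "- {0}"]) auto
  from smooth_at_compose[OF assms(1) this] show ?thesis by (simp add: o_def)
qed

lemma smooth_at_Pair: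
  assumes "smooth_at x f" "smooth_at x g"
  shows "smooth_at x (\<lambda>y. (f y, g y))"
proof -
  have "smooth_at x ((\<lambda>u. (u, 0)) \<circ> f)" "smooth_at x ((\<lambda>v. (0, v)) \<circ> g)"
    by (intro smooth_at_compose assms smooth_at_bounded_linear bounded_linear_Pair
        bounded_linear_ident bounded_linear_zero)+
  from smooth_at_add[OF this] show ?thesis by simp
qed

lemma euclidean_expand_frechet:
  assumes "f differentiable (at x)"
  shows "frechet_derivative f (at x) v = (\<Sum>b\<in>Basis. (v \<bullet> b) *\<^sub>R frechet_derivative f (at x) b)"
  by (rule linear_euclidean_expand[OF linear_frechet_derivative[OF assms]])

text \<open>Both mixed derivatives are limits of the same second difference quotient; the mean value
  theorem is applied to it in the two possible orders.\<close>

lemma mixed_derivative_mvt: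
  fixes f :: "'a::euclidean_space \<Rightarrow> real"
  assumes f: "\<And>y. y \<in> ball x r \<Longrightarrow> f differentiable (at y)"
    and fu: "\<And>y. y \<in> ball x r \<Longrightarrow> (\<lambda>z. frechet_derivative f (at z) u) differentiable (at y)"
    and h: "h > 0" "h * (norm u + norm v) < r"
  obtains y where "dist x y < r" "dist x y \<le> h * (norm u + norm v)"
    "f (x + h *\<^sub>R u + h *\<^sub>R v) - f (x + h *\<^sub>R u) - f (x + h *\<^sub>R v) + f x
      = h * h * frechet_derivative (\<lambda>z. frechet_derivative f (at z) u) (at y) v"
proof -
  let ?fu = "\<lambda>z. frechet_derivative f (at z) u"
  have ball: "x + s *\<^sub>R u + t *\<^sub>R v \<in> ball x r"
    "dist x (x + s *\<^sub>R u + t *\<^sub>R v) \<le> h * (norm u + norm v)" if "0 \<le> s" "s \<le> h" "0 \<le> t" "t \<le> h" for s t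
  proof -
    have "norm (s *\<^sub>R u + t *\<^sub>R v) \<le> h * (norm u + norm v)"
      using that norm_triangle_ineq[of "s *\<^sub>R u" "t *\<^sub>R v"] mult_right_mono[of s h "norm u"] mult_right_mono[of t h "norm v"]
      by (auto simp: algebra_simps)
    then show "dist x (x + s *\<^sub>R u + t *\<^sub>R v) \<le> h * (norm u + norm v)"
      unfolding dist_norm by (subst norm_minus_commute) (simp add: add.assoc)
    then show "x + s *\<^sub>R u + t *\<^sub>R v \<in> ball x r" using h by simp
  qed
  have D1: "((\<lambda>s. f (x + s *\<^sub>R u + t *\<^sub>R v)) has_real_derivative ?fu (x + s *\<^sub>R u + t *\<^sub>R v)) (at s)"
    if "0 \<le> s" "s \<le> h" "0 \<le> t" "t \<le> h" for s t
  proof -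
    let ?y = "x + s *\<^sub>R u + t *\<^sub>R v"
    have 1: "(f has_derivative frechet_derivative f (at ?y)) (at ?y)"
      using f ball[OF that] by (simp add: frechet_derivative_works[symmetric])
    have "((\<lambda>s. x + s *\<^sub>R u + t *\<^sub>R v) has_derivative (\<lambda>c. c *\<^sub>R u)) (at s)"
      by (auto intro!: derivative_eq_intros)
    from diff_chain_at[OF this 1]
    have "((\<lambda>s. f (x + s *\<^sub>R u + t *\<^sub>R v)) has_derivative (\<lambda>c. frechet_derivative f (at ?y) (c *\<^sub>R u))) (at s)"
      by (simp add: o_def)
    moreover have "frechet_derivative f (at ?y) (c *\<^sub>R u) = ?fu ?y * c" for c
      using linear_scale[OF has_derivative_linear[OF 1]] by simp
    ultimately show ?thesis by (simp add: has_field_derivative_def)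
  qed
  have D2: "((\<lambda>t. ?fu (x + s *\<^sub>R u + t *\<^sub>R v)) has_real_derivative
      frechet_derivative ?fu (at (x + s *\<^sub>R u + t *\<^sub>R v)) v) (at t)"
    if "0 \<le> s" "s \<le> h" "0 \<le> t" "t \<le> h" for s t
  proof -
    let ?y = "x + s *\<^sub>R u + t *\<^sub>R v"
    have 1: "(?fu has_derivative frechet_derivative ?fu (at ?y)) (at ?y)"
      using fu ball[OF that] by (simp add: frechet_derivative_works[symmetric])
    have "((\<lambda>t. x + s *\<^sub>R u + t *\<^sub>R v) has_derivative (\<lambda>c. c *\<^sub>R v)) (at t)"
      by (auto intro!: derivative_eq_intros)
    from diff_chain_at[OF this 1]
    have "((\<lambda>t. ?fu (x + s *\<^sub>R u + t *\<^sub>R v)) has_derivative (\<lambda>c. frechet_derivative ?fu (at ?y) (c *\<^sub>R v))) (at t)"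
      by (simp add: o_def)
    moreover have "frechet_derivative ?fu (at ?y) (c *\<^sub>R v) = frechet_derivative ?fu (at ?y) v * c" for c
      using linear_scale[OF has_derivative_linear[OF 1]] by simp
    ultimately show ?thesis by (simp add: has_field_derivative_def)
  qed
  \<comment> \<open>The second difference of \<open>f\<close> is the increment of
    \<open>?\<psi>\<close> over \<open>[0, h]\<close>. The mean value theorem in \<open>s\<close>
    turns it into a difference of \<open>?fu\<close> in direction \<open>v\<close>, to which the
    mean value theorem in \<open>t\<close> applies.\<close>
  let ?\<psi> = "\<lambda>s. f (x + s *\<^sub>R u + h *\<^sub>R v) - f (x + s *\<^sub>R u + 0 *\<^sub>R v)"
  have "\<exists>s>0. s < h \<and> ?\<psi> h - ?\<psi> 0 = (h - 0) * (?fu (x + s *\<^sub>R u + h *\<^sub>R v) - ?fu (x + s *\<^sub>R u + 0 *\<^sub>R v))"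
    by (rule MVT2[OF h(1)]) (use h(1) in \<open>auto intro!: DERIV_diff D1[of _ h] D1[of _ 0, simplified]\<close>)
  then obtain s where s: "0 < s" "s < h"
    "?\<psi> h - ?\<psi> 0 = h * (?fu (x + s *\<^sub>R u + h *\<^sub>R v) - ?fu (x + s *\<^sub>R u + 0 *\<^sub>R v))" by auto
  have "\<exists>t>0. t < h \<and> ?fu (x + s *\<^sub>R u + h *\<^sub>R v) - ?fu (x + s *\<^sub>R u + 0 *\<^sub>R v)
      = (h - 0) * frechet_derivative ?fu (at (x + s *\<^sub>R u + t *\<^sub>R v)) v"
    by (rule MVT2[OF h(1)]) (use s in \<open>auto intro!: D2\<close>)
  then obtain t where t: "0 < t" "t < h"
    "?fu (x + s *\<^sub>R u + h *\<^sub>R v) - ?fu (x + s *\<^sub>R u + 0 *\<^sub>R v)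
      = h * frechet_derivative ?fu (at (x + s *\<^sub>R u + t *\<^sub>R v)) v" by auto
  show thesis
    by (rule that[of "x + s *\<^sub>R u + t *\<^sub>R v"]) (use ball[of s t] s t in \<open>auto simp: algebra_simps\<close>)
qed

lemma mixed_derivatives_commute:
  fixes f :: "'a::euclidean_space \<Rightarrow> real"
  assumes "smooth_at x f"
  shows "frechet_derivative (\<lambda>y. frechet_derivative f (at y) u) (at x) v
       = frechet_derivative (\<lambda>y. frechet_derivative f (at y) v) (at x) u"
proof (rule ccontr)
  define a where "a u v y = frechet_derivative (\<lambda>y. frechet_derivative f (at y) u) (at y) v" for u v y
  assume "\<not> ?thesis"
  then have ne: "a u v x \<noteq> a v u x" by (simp add: a_def)
  \<comment> \<open>Half of the gap: two values within \<open>e\<close> of the two different limits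
    cannot coincide.\<close>
  define e where "e = \<bar>a u v x - a v u x\<bar> / 2"
  have e: "e > 0" using ne by (simp add: e_def)
  have "isCont (a u v) x" for u v
    unfolding a_def[abs_def] using assms by (intro smooth_at_isCont smooth_at_derivative)
  then have cont: "(a u v \<longlongrightarrow> a u v x) (nhds x)" for u v
    unfolding isCont_def tendsto_at_iff_tendsto_nhds by blast
  have "eventually (\<lambda>y. smooth_at y f \<and> \<bar>a u v y - a u v x\<bar> < e \<and> \<bar>a v u y - a v u x\<bar> < e) (nhds x)"
    using cont[of u v] cont[of v u] e smooth_at_eventually[OF assms]
    unfolding tendsto_iff dist_real_def
    by (simp add: eventually_conj_iff)
  then obtain r where r: "r > 0"
    "\<And>y. dist x y < r \<Longrightarrow> smooth_at y f \<and> \<bar>a u v y - a u v x\<bar> < e \<and> \<bar>a v u y - a v u x\<bar> < e"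
    unfolding eventually_nhds_metric by (metis dist_commute)
  \<comment> \<open>The summand 1 keeps the denominator positive even if \<open>u\<close> and
    \<open>v\<close> both vanish.\<close>
  define h where "h = r / (norm u + norm v + 1) / 2"
  have "norm u + norm v + 1 > 0" by (meson add_nonneg_pos add_nonneg_nonneg norm_ge_zero zero_less_one)
  then have h: "h > 0" "h * (norm u + norm v) < r" "h * (norm v + norm u) < r"
    using r(1) by (auto simp: h_def field_simps)
      (smt (verit, best) mult_nonneg_nonneg norm_ge_zero)+
  have d: "f differentiable at y" "(\<lambda>z. frechet_derivative f (at z) w) differentiable at y"
    if "y \<in> ball x r" for y w
    using r(2)[of y] that by (auto intro: smooth_at_differentiable smooth_at_derivative)
  obtain y where y: "dist x y < r" "f (x + h *\<^sub>R u + h *\<^sub>R v) - f (x + h *\<^sub>R u) - f (x + h *\<^sub>R v) + f x = h * h * a u v y"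
    using mixed_derivative_mvt[OF d(1) d(2)[of _ u] h(1,2)] unfolding a_def by blast
  obtain z where z: "dist x z < r" "f (x + h *\<^sub>R v + h *\<^sub>R u) - f (x + h *\<^sub>R v) - f (x + h *\<^sub>R u) + f x = h * h * a v u z"
    using mixed_derivative_mvt[OF d(1) d(2)[of _ v] h(1,3)] unfolding a_def by blast
  have "h * h * a u v y = h * h * a v u z"
    using y(2) z(2) by (simp add: algebra_simps)
  then have "a u v y = a v u z" using h(1) by simp
  then have "\<bar>a u v x - a v u x\<bar> < 2 * e"
    using r(2)[OF y(1)] r(2)[OF z(1)] by linarith
  then show False by (simp add: e_def)
qed

section \<open>Functions and tangent vectors on a manifold\<close>

lemma eventually_nhdsin_self: "eventually P (nhdsin X p) \<Longrightarrow> p \<in> topspace X \<Longrightarrow> P p"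
  by (auto simp: eventually_nhdsin)

lemma eventually_nhdsin_openin: "openin X U \<Longrightarrow> p \<in> U \<Longrightarrow> eventually (\<lambda>q. q \<in> U) (nhdsin X p)"
  by (auto simp: eventually_nhdsin)

text \<open>\<open>frechet_derivative\<close> is a choice among the maps satisfying
  \<open>has_derivative\<close>, and which maps these are depends on the germ only. Equal germs
  therefore give equal values even where no derivative exists.\<close>

lemma frechet_derivative_cong_ev:
  assumes "eventually (\<lambda>y. f y = g y) (nhds x)"
  shows "frechet_derivative f (at x) = frechet_derivative g (at x)"
proof -
  have "(f has_derivative f') (at x) \<longleftrightarrow> (g has_derivative f') (at x)" for f'
    using assms eventually_nhds_x_imp_x[OF assms]
    by (auto simp: eventually_at_filter eq_commute intro: has_derivative_transform_eventually
        elim!: eventually_mono)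
  then show ?thesis by (simp add: frechet_derivative_def)
qed

lemma linear_at_lincomb:
  "linear_at M p L \<Longrightarrow> u \<in> tangent_space M p \<Longrightarrow> v \<in> tangent_space M p \<Longrightarrow>
    L (\<lambda>f. a * u f + b * v f) = a * L u + b * L v"
  by (auto simp: linear_at_def)

locale mfd =
  fixes M :: "('a, 'b::euclidean_space) manifold"
  assumes smooth_mfd: "smooth_manifold M"
begin

lemma chart_open: "(U, c) \<in> atlas M \<Longrightarrow> openin (mtop M) U"
  and chart_homeo: "(U, c) \<in> atlas M \<Longrightarrow> homeomorphic_map (subtopology (mtop M) U) (top_of_set (c ` U)) c"
  and chart_image_open: "(U, c) \<in> atlas M \<Longrightarrow> open (c ` U)"
  and chart_transition: "(U, c) \<in> atlas M \<Longrightarrow> (V, d) \<in> atlas M \<Longrightarrow>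
    smooth_on (c ` (U \<inter> V)) (d \<circ> inv_into U c)"
  using smooth_mfd unfolding smooth_manifold_def is_chart_def by blast+

lemma chart_subset: "(U, c) \<in> atlas M \<Longrightarrow> U \<subseteq> points M"
  using chart_open openin_subset by blast

lemma chart_inj: "(U, c) \<in> atlas M \<Longrightarrow> inj_on c U"
  using chart_homeo[of U c] chart_subset[of U c]
  by (auto simp: homeomorphic_map_def topspace_subtopology dest!: homeomorphic_imp_injective_map intro: inj_on_subset)

lemma chart_at:
  assumes "p \<in> points M"
  obtains U c where "(U, c) \<in> atlas M" "p \<in> U"
  using smooth_mfd assms unfolding smooth_manifold_def by blast

lemma chart_image_openin:
  assumes "(U, c) \<in> atlas M" "openin (mtop M) W"
  shows "open (c ` (U \<inter> W))"
proof -
  have "open_map (subtopology (mtop M) U) (top_of_set (c ` U)) c"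
    using chart_homeo assms(1) homeomorphic_imp_open_map by blast
  moreover have "openin (subtopology (mtop M) U) (U \<inter> W)"
    using assms(2) by (auto simp: openin_subtopology)
  ultimately have "openin (top_of_set (c ` U)) (c ` (U \<inter> W))"
    unfolding open_map_def by blast
  then show ?thesis
    using chart_image_open[OF assms(1)] openin_open_trans by blast
qed

lemma chart_preimage_open:
  assumes "(U, c) \<in> atlas M" "open O'"
  shows "openin (mtop M) {p \<in> U. c p \<in> O'}"
proof -
  have "continuous_map (subtopology (mtop M) U) (top_of_set (c ` U)) c"
    using chart_homeo assms(1) homeomorphic_imp_continuous_map by blast
  then have "openin (subtopology (mtop M) U) {p \<in> topspace (subtopology (mtop M) U). c p \<in> c ` U \<inter> O'}"
    using assms(2) by (intro openin_continuous_map_preimage) auto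
  moreover have "{p \<in> topspace (subtopology (mtop M) U). c p \<in> c ` U \<inter> O'} = {p \<in> U. c p \<in> O'}"
    using chart_subset[OF assms(1)] by (auto simp: topspace_subtopology)
  ultimately show ?thesis
    using chart_open[OF assms(1)] openin_trans_full by metis
qed

lemma eventually_chart: "(U, c) \<in> atlas M \<Longrightarrow> p \<in> U \<Longrightarrow> eventually (\<lambda>q. q \<in> U) (nhdsin (mtop M) p)"
  by (intro eventually_nhdsin_openin chart_open)

text \<open>Off the manifold \<open>nhdsin\<close> is the trivial filter, for which everything holds
  eventually.\<close>

lemma eventually_points: "eventually (\<lambda>q. q \<in> points M) (nhdsin (mtop M) p)"
  by (cases "p \<in> points M") (auto intro: eventually_nhdsin_openin simp: eventually_nhdsin)

text \<open>A chart is a homeomorphism onto an open set, so neighbourhoods correspond. This moves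
  eventual statements into the model space, where the calculus takes place.\<close>

lemma eventually_nhdsin_chart:
  assumes "(U, c) \<in> atlas M" "p \<in> U"
  shows "eventually P (nhdsin (mtop M) p) \<longleftrightarrow> eventually (\<lambda>x. P (inv_into U c x)) (nhds (c p))"
proof
  assume "eventually P (nhdsin (mtop M) p)"
  then obtain W where W: "openin (mtop M) W" "p \<in> W" "\<And>q. q \<in> W \<Longrightarrow> P q"
    using assms chart_subset by (auto simp: eventually_nhdsin)
  then show "eventually (\<lambda>x. P (inv_into U c x)) (nhds (c p))"
    unfolding eventually_nhds
    using assms chart_image_openin[OF assms(1) W(1)] chart_inj[OF assms(1)]
    by (intro exI[of _ "c ` (U \<inter> W)"]) auto
next
  assume "eventually (\<lambda>x. P (inv_into U c x)) (nhds (c p))"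
  then obtain S where S: "open S" "c p \<in> S" "\<And>x. x \<in> S \<Longrightarrow> P (inv_into U c x)"
    by (auto simp: eventually_nhds)
  have "P q" if "q \<in> U" "c q \<in> S" for q
    using S(3)[OF that(2)] chart_inj[OF assms(1)] that(1) by simp
  then show "eventually P (nhdsin (mtop M) p)"
    unfolding eventually_nhdsin
    using assms chart_preimage_open[OF assms(1) S(1)] S(2)
    by (intro disjI2 exI[of _ "{q \<in> U. c q \<in> S}"]) auto
qed

section \<open>Germs of smooth functions on a manifold\<close>

lemma smooth_near_empty: "p \<notin> points M \<Longrightarrow> smooth_near M p = {}"
  unfolding smooth_near_def using openin_subset by blast

text \<open>One chart is enough. The neighbourhood \<open>W\<close> is shrunk into \<open>U\<close>,
  so that the representative in any other chart factors through \<open>c\<close> by a smooth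
  transition map.\<close>

lemma smooth_near_iff:
  assumes "(U, c) \<in> atlas M" "p \<in> U"
  shows "f \<in> smooth_near M p \<longleftrightarrow> smooth_at (c p) (f \<circ> inv_into U c)"
proof
  assume "f \<in> smooth_near M p"
  then obtain W where "openin (mtop M) W" "p \<in> W" "msmooth_on M W f"
    unfolding smooth_near_def by blast
  then show "smooth_at (c p) (f \<circ> inv_into U c)"
    using assms chart_image_openin[of U c W] unfolding smooth_at_def msmooth_on_def by blast
next
  assume "smooth_at (c p) (f \<circ> inv_into U c)"
  then obtain S where S: "open S" "c p \<in> S" "smooth_on S (f \<circ> inv_into U c)"
    unfolding smooth_at_def by blast
  define W where "W = {q \<in> U. c q \<in> S}"
  have W: "openin (mtop M) W" "p \<in> W"
    using chart_preimage_open[OF assms(1) S(1)] S assms by (auto simp: W_def)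
  have "smooth_on (d ` (V \<inter> W)) (f \<circ> inv_into V d)" if Vd: "(V, d) \<in> atlas M" for V d
  proof (rule smooth_on_cong)
    show op: "open (d ` (V \<inter> W))"
      by (rule chart_image_openin[OF Vd W(1)])
    have "smooth_on (d ` (V \<inter> W)) (c \<circ> inv_into V d)"
      using chart_transition[OF Vd assms(1)] by (rule smooth_on_subset) (auto simp: W_def)
    then show "smooth_on (d ` (V \<inter> W)) ((f \<circ> inv_into U c) \<circ> (c \<circ> inv_into V d))"
      using op S chart_inj[OF Vd] by (intro smooth_on_compose) (auto simp: W_def)
    show "((f \<circ> inv_into U c) \<circ> (c \<circ> inv_into V d)) x = (f \<circ> inv_into V d) x" if "x \<in> d ` (V \<inter> W)" for x
      using that chart_inj[OF Vd] chart_inj[OF assms(1)] by (auto simp: W_def)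
  qed
  then show "f \<in> smooth_near M p"
    unfolding smooth_near_def msmooth_on_def using W by blast
qed

lemma smooth_near_points: "f \<in> smooth_near M p \<Longrightarrow> p \<in> points M"
  using smooth_near_empty by blast

lemma eventually_smooth_near:
  assumes "f \<in> smooth_near M p"
  shows "eventually (\<lambda>q. f \<in> smooth_near M q) (nhdsin (mtop M) p)"
proof -
  obtain W where "openin (mtop M) W" "p \<in> W" "msmooth_on M W f"
    using assms unfolding smooth_near_def by blast
  then show ?thesis
    unfolding eventually_nhdsin smooth_near_def by blast
qed

lemma msmooth_on_iff:
  assumes "openin (mtop M) W"
  shows "msmooth_on M W f \<longleftrightarrow> (\<forall>p\<in>W. f \<in> smooth_near M p)"
proof
  show "msmooth_on M W f \<Longrightarrow> \<forall>p\<in>W. f \<in> smooth_near M p"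
    using assms unfolding smooth_near_def by blast
  assume R: "\<forall>p\<in>W. f \<in> smooth_near M p"
  show "msmooth_on M W f"
    unfolding msmooth_on_def
  proof safe
    fix U c assume "(U, c) \<in> atlas M"
    then show "smooth_on (c ` (U \<inter> W)) (f \<circ> inv_into U c)"
      using R smooth_near_iff by (subst smooth_on_iff_smooth_at) (auto intro: chart_image_openin assms)
  qed
qed

lemma smooth_near_cong:
  assumes "eventually (\<lambda>q. f q = g q) (nhdsin (mtop M) p)" "f \<in> smooth_near M p"
  shows "g \<in> smooth_near M p"
proof -
  obtain U c where Uc: "(U, c) \<in> atlas M" "p \<in> U"
    using smooth_near_points[OF assms(2)] chart_at by blast
  show ?thesis
    using assms unfolding smooth_near_iff[OF Uc] eventually_nhdsin_chart[OF Uc]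
    by (auto elim: smooth_at_cong[rotated])
qed

lemma smooth_near_const: "p \<in> points M \<Longrightarrow> (\<lambda>_. k) \<in> smooth_near M p"
  by (erule chart_at) (simp add: smooth_near_iff o_def smooth_at_const)

lemma smooth_near_add:
  assumes "f \<in> smooth_near M p" "g \<in> smooth_near M p"
  shows "(\<lambda>q. f q + g q) \<in> smooth_near M p"
proof -
  obtain U c where Uc: "(U, c) \<in> atlas M" "p \<in> U"
    using smooth_near_points[OF assms(1)] chart_at by blast
  show ?thesis
    using assms smooth_at_add unfolding smooth_near_iff[OF Uc] o_def by blast
qed

lemma smooth_near_mult:
  assumes "f \<in> smooth_near M p" "g \<in> smooth_near M p"
  shows "(\<lambda>q. f q * g q) \<in> smooth_near M p"
proof -
  obtain U c where Uc: "(U, c) \<in> atlas M" "p \<in> U"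
    using smooth_near_points[OF assms(1)] chart_at by blast
  show ?thesis
    using assms smooth_at_bilinear[OF _ _ bounded_bilinear_mult]
    unfolding smooth_near_iff[OF Uc] o_def by blast
qed

lemma smooth_near_cmult: "f \<in> smooth_near M p \<Longrightarrow> (\<lambda>q. k * f q) \<in> smooth_near M p"
  by (intro smooth_near_mult smooth_near_const smooth_near_points)

lemma smooth_near_minus: "f \<in> smooth_near M p \<Longrightarrow> (\<lambda>q. - f q) \<in> smooth_near M p"
  using smooth_near_cmult[of f p "-1"] by simp

lemma smooth_near_diff:
  "f \<in> smooth_near M p \<Longrightarrow> g \<in> smooth_near M p \<Longrightarrow> (\<lambda>q. f q - g q) \<in> smooth_near M p"
  using smooth_near_add[OF _ smooth_near_minus] by simp

lemma smooth_near_sum: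
  assumes "p \<in> points M"
  shows "(\<And>i. i \<in> A \<Longrightarrow> f i \<in> smooth_near M p) \<Longrightarrow> (\<lambda>q. \<Sum>i\<in>A. f i q) \<in> smooth_near M p"
  by (induction A rule: infinite_finite_induct) (auto intro: smooth_near_const assms smooth_near_add)

lemma smooth_near_inverse:
  assumes "f \<in> smooth_near M p" "f p \<noteq> 0"
  shows "(\<lambda>q. inverse (f q)) \<in> smooth_near M p"
proof -
  obtain U c where Uc: "(U, c) \<in> atlas M" "p \<in> U"
    using smooth_near_points[OF assms(1)] chart_at by blast
  show ?thesis
    using assms smooth_at_inverse[of "c p" "f \<circ> inv_into U c"] chart_inj[OF Uc(1)] Uc(2)
    unfolding smooth_near_iff[OF Uc] by (simp add: o_def)
qed

lemma eventually_nonzero: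
  assumes "f \<in> smooth_near M p" "f p \<noteq> 0"
  shows "eventually (\<lambda>q. f q \<noteq> 0) (nhdsin (mtop M) p)"
proof -
  obtain U c where Uc: "(U, c) \<in> atlas M" "p \<in> U"
    using smooth_near_points[OF assms(1)] chart_at by blast
  have "isCont (f \<circ> inv_into U c) (c p)"
    using assms(1) unfolding smooth_near_iff[OF Uc] by (rule smooth_at_isCont)
  then have "((f \<circ> inv_into U c) \<longlongrightarrow> (f \<circ> inv_into U c) (c p)) (nhds (c p))"
    unfolding isCont_def tendsto_at_iff_tendsto_nhds .
  moreover have "(f \<circ> inv_into U c) (c p) \<noteq> 0"
    using assms(2) chart_inj[OF Uc(1)] Uc(2) by simp
  ultimately have "eventually (\<lambda>x. (f \<circ> inv_into U c) x \<noteq> 0) (nhds (c p))"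
    by (rule tendsto_imp_eventually_ne)
  then show ?thesis unfolding eventually_nhdsin_chart[OF Uc] by simp
qed

lemma smooth_near_coord:
  assumes "(U, c) \<in> atlas M" "p \<in> U"
  shows "(\<lambda>q. c q \<bullet> w) \<in> smooth_near M p"
proof -
  have "smooth_at (c p) (\<lambda>x. x \<bullet> w)"
    by (intro smooth_at_bounded_linear bounded_linear_inner_left)
  moreover have "eventually (\<lambda>x. x \<in> c ` U) (nhds (c p))"
    using chart_image_open[OF assms(1)] assms(2) by (intro eventually_nhds_in_open) auto
  then have "eventually (\<lambda>x. x \<bullet> w = ((\<lambda>q. c q \<bullet> w) \<circ> inv_into U c) x) (nhds (c p))"
    by eventually_elim (auto simp: f_inv_into_f)
  ultimately show ?thesis
    unfolding smooth_near_iff[OF assms] by (metis (mono_tags) smooth_at_cong)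
qed

section \<open>Tangent vectors: chart representation, derivation rules, linear structure\<close>

lemma coord_vec_apply:
  "f \<in> smooth_near M p \<Longrightarrow> coord_vec M (U, c) p w f = frechet_derivative (f \<circ> inv_into U c) (at (c p)) w"
  by (simp add: coord_vec_def)

lemma coord_vec_not_smooth: "f \<notin> smooth_near M p \<Longrightarrow> coord_vec M \<kappa> p w f = 0"
  by (simp add: coord_vec_def)

lemma coord_vec_tangent: "(U, c) \<in> atlas M \<Longrightarrow> p \<in> U \<Longrightarrow> coord_vec M (U, c) p w \<in> tangent_space M p"
  unfolding tangent_space_def by force

lemma coord_vec_coord:
  assumes "(U, c) \<in> atlas M" "p \<in> U"
  shows "coord_vec M (U, c) p v (\<lambda>q. c q \<bullet> w) = v \<bullet> w"
proof -
  have "eventually (\<lambda>x. x \<in> c ` U) (nhds (c p))"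
    using chart_image_open[OF assms(1)] assms(2) by (intro eventually_nhds_in_open) auto
  then have "eventually (\<lambda>x. ((\<lambda>q. c q \<bullet> w) \<circ> inv_into U c) x = x \<bullet> w) (nhds (c p))"
    by eventually_elim (auto simp: f_inv_into_f)
  then have "coord_vec M (U, c) p v (\<lambda>q. c q \<bullet> w) = frechet_derivative (\<lambda>x. x \<bullet> w) (at (c p)) v"
    by (simp add: coord_vec_apply smooth_near_coord[OF assms] frechet_derivative_cong_ev)
  then show ?thesis
    by (simp add: bounded_linear_frechet_derivative bounded_linear_inner_left)
qed

text \<open>The chain rule for the transition map. It makes the tangent space the range of
  \<open>coord_vec\<close> for any single chart, which is what gives it a linear structure.\<close>

lemma coord_vec_change:
  assumes Uc: "(U, c) \<in> atlas M" "p \<in> U" and Vd: "(V, d) \<in> atlas M" "p \<in> V"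
  shows "coord_vec M (V, d) p w =
    coord_vec M (U, c) p (frechet_derivative (c \<circ> inv_into V d) (at (d p)) w)"
proof
  fix f
  let ?t = "c \<circ> inv_into V d"
  show "coord_vec M (V, d) p w f = coord_vec M (U, c) p (frechet_derivative ?t (at (d p)) w) f"
  proof (cases "f \<in> smooth_near M p")
    case True
    have dV: "open (d ` (V \<inter> U))" using chart_image_openin[OF Vd(1) chart_open[OF Uc(1)]] .
    have "smooth_at (d p) ?t"
      unfolding smooth_at_def using dV chart_transition[OF Vd(1) Uc(1)] Uc Vd by blast
    then have "(?t has_derivative frechet_derivative ?t (at (d p))) (at (d p))"
      using smooth_at_differentiable frechet_derivative_works by blast
    moreover have tp: "?t (d p) = c p" using chart_inj[OF Vd(1)] Vd(2) by simp
    moreover have "((f \<circ> inv_into U c) has_derivative frechet_derivative (f \<circ> inv_into U c) (at (c p))) (at (c p))"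
      using True smooth_at_differentiable frechet_derivative_works unfolding smooth_near_iff[OF Uc] by blast
    ultimately have "((f \<circ> inv_into U c) \<circ> ?t has_derivative
        frechet_derivative (f \<circ> inv_into U c) (at (c p)) \<circ> frechet_derivative ?t (at (d p))) (at (d p))"
      using diff_chain_at by metis
    from frechet_derivative_at[OF this]
    have 1: "frechet_derivative ((f \<circ> inv_into U c) \<circ> ?t) (at (d p)) w =
       frechet_derivative (f \<circ> inv_into U c) (at (c p)) (frechet_derivative ?t (at (d p)) w)"
      by (metis comp_apply)
    have "eventually (\<lambda>x. x \<in> d ` (V \<inter> U)) (nhds (d p))"
      using dV Uc Vd by (intro eventually_nhds_in_open) auto
    then have "eventually (\<lambda>x. (f \<circ> inv_into V d) x = ((f \<circ> inv_into U c) \<circ> ?t) x) (nhds (d p))"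
      by eventually_elim (use chart_inj[OF Vd(1)] chart_inj[OF Uc(1)] in auto)
    from frechet_derivative_cong_ev[OF this] show ?thesis
      using 1 True by (simp add: coord_vec_apply o_def)
  qed (simp add: coord_vec_not_smooth)
qed

lemma tangent_space_chart:
  assumes "(U, c) \<in> atlas M" "p \<in> U"
  shows "tangent_space M p = range (coord_vec M (U, c) p)"
  using coord_vec_change[OF assms] coord_vec_tangent[OF assms] unfolding tangent_space_def by fastforce

lemma tangentE:
  assumes "u \<in> tangent_space M p" "(U, c) \<in> atlas M" "p \<in> U"
  obtains w where "u = coord_vec M (U, c) p w"
  using assms tangent_space_chart by blast

lemma tangent_points: "u \<in> tangent_space M p \<Longrightarrow> p \<in> points M"
  unfolding tangent_space_def using chart_subset by force

lemma tangent_chart: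
  assumes "u \<in> tangent_space M p"
  obtains U c w where "(U, c) \<in> atlas M" "p \<in> U" "u = coord_vec M (U, c) p w"
  using assms unfolding tangent_space_def by force

lemma tangent_not_smooth: "u \<in> tangent_space M p \<Longrightarrow> f \<notin> smooth_near M p \<Longrightarrow> u f = 0"
  by (elim tangent_chart) (simp add: coord_vec_not_smooth)

text \<open>Either both functions are smooth near \<open>p\<close>, and the representatives have the
  same germ, or neither is, and both values are 0 by convention.\<close>

lemma tangent_cong:
  assumes "u \<in> tangent_space M p" "eventually (\<lambda>q. f q = g q) (nhdsin (mtop M) p)"
  shows "u f = u g"
proof -
  have iff: "f \<in> smooth_near M p \<longleftrightarrow> g \<in> smooth_near M p"
    using smooth_near_cong[OF assms(2)] smooth_near_cong[of g f p] assms(2) by (auto simp: eq_commute)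
  obtain U c w where Uc: "(U, c) \<in> atlas M" "p \<in> U" and u: "u = coord_vec M (U, c) p w"
    using assms(1) by (rule tangent_chart)
  show ?thesis
    using assms(2) iff frechet_derivative_cong_ev[of "f \<circ> inv_into U c" "g \<circ> inv_into U c" "c p"]
    unfolding u coord_vec_def eventually_nhdsin_chart[OF Uc] by simp
qed

lemma tangent_add:
  assumes "u \<in> tangent_space M p" "f \<in> smooth_near M p" "g \<in> smooth_near M p"
  shows "u (\<lambda>q. f q + g q) = u f + u g"
proof -
  obtain U c w where Uc: "(U, c) \<in> atlas M" "p \<in> U" and u: "u = coord_vec M (U, c) p w"
    using assms(1) by (rule tangent_chart)
  have "((\<lambda>x. (f \<circ> inv_into U c) x + (g \<circ> inv_into U c) x) has_derivative
     (\<lambda>v. frechet_derivative (f \<circ> inv_into U c) (at (c p)) v + frechet_derivative (g \<circ> inv_into U c) (at (c p)) v)) (at (c p))"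
    using assms(2,3) smooth_at_differentiable frechet_derivative_works unfolding smooth_near_iff[OF Uc]
    by (intro has_derivative_add) blast+
  from frechet_derivative_at[OF this, symmetric] show ?thesis
    using assms smooth_near_add by (simp add: u coord_vec_apply o_def)
qed

lemma tangent_mult:
  assumes "u \<in> tangent_space M p" "f \<in> smooth_near M p" "g \<in> smooth_near M p"
  shows "u (\<lambda>q. f q * g q) = u f * g p + f p * u g"
proof -
  obtain U c w where Uc: "(U, c) \<in> atlas M" "p \<in> U" and u: "u = coord_vec M (U, c) p w"
    using assms(1) by (rule tangent_chart)
  let ?f = "f \<circ> inv_into U c" and ?g = "g \<circ> inv_into U c"
  have "((\<lambda>x. ?f x * ?g x) has_derivative
     (\<lambda>v. ?f (c p) * frechet_derivative ?g (at (c p)) v + frechet_derivative ?f (at (c p)) v * ?g (c p))) (at (c p))"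
    using assms(2,3) smooth_at_differentiable frechet_derivative_works unfolding smooth_near_iff[OF Uc]
    by (intro has_derivative_mult) blast+
  from frechet_derivative_at[OF this, symmetric]
  have "frechet_derivative (\<lambda>x. ?f x * ?g x) (at (c p)) w
     = f p * frechet_derivative ?g (at (c p)) w + frechet_derivative ?f (at (c p)) w * g p"
    using chart_inj[OF Uc(1)] Uc(2) by simp
  moreover have "(\<lambda>q. f q * g q) \<circ> inv_into U c = (\<lambda>x. ?f x * ?g x)" by auto
  ultimately show ?thesis
    using assms smooth_near_mult by (simp add: u coord_vec_apply)
qed

lemma tangent_const: "u \<in> tangent_space M p \<Longrightarrow> u (\<lambda>_. k) = 0"
proof -
  assume u: "u \<in> tangent_space M p"
  obtain U c w where "(U, c) \<in> atlas M" "p \<in> U" and "u = coord_vec M (U, c) p w"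
    using u by (rule tangent_chart)
  then show ?thesis
    by (simp add: coord_vec_def o_def)
qed

lemma tangent_cmult: "u \<in> tangent_space M p \<Longrightarrow> f \<in> smooth_near M p \<Longrightarrow> u (\<lambda>q. k * f q) = k * u f"
  using tangent_mult[of u p "\<lambda>_. k" f] tangent_points tangent_const smooth_near_const by fastforce

lemma tangent_sum:
  assumes "u \<in> tangent_space M p"
  shows "(\<And>i. i \<in> A \<Longrightarrow> f i \<in> smooth_near M p) \<Longrightarrow> u (\<lambda>q. \<Sum>i\<in>A. f i q) = (\<Sum>i\<in>A. u (f i))"
  by (induction A rule: infinite_finite_induct)
    (auto simp: tangent_const[OF assms] tangent_add[OF assms] tangent_points[OF assms] smooth_near_sum)

lemma coord_vec_expand:
  assumes "(U, c) \<in> atlas M" "p \<in> U"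
  shows "coord_vec M (U, c) p w f = (\<Sum>b\<in>Basis. (w \<bullet> b) * coord_vec M (U, c) p b f)"
proof (cases "f \<in> smooth_near M p")
  case True
  then have "(f \<circ> inv_into U c) differentiable (at (c p))"
    using smooth_at_differentiable unfolding smooth_near_iff[OF assms] by blast
  from euclidean_expand_frechet[OF this, of w] show ?thesis
    by (simp add: coord_vec_apply[OF True])
qed (simp add: coord_vec_not_smooth)

text \<open>By \<open>coord_vec_coord\<close> the components of \<open>u\<close> in the coordinate
  basis are its values on the coordinate functions.\<close>

lemma tangent_expand:
  assumes "u \<in> tangent_space M p" "(U, c) \<in> atlas M" "p \<in> U"
  shows "u f = (\<Sum>b\<in>Basis. u (\<lambda>q. c q \<bullet> b) * coord_vec M (U, c) p b f)"
proof -
  obtain w where w: "u = coord_vec M (U, c) p w" using assms by (rule tangentE)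
  show ?thesis
    unfolding w coord_vec_coord[OF assms(2,3)] by (rule coord_vec_expand[OF assms(2,3)])
qed

lemma tangent_lincomb:
  assumes "u \<in> tangent_space M p" "v \<in> tangent_space M p"
  shows "(\<lambda>f. a * u f + b * v f) \<in> tangent_space M p"
proof -
  obtain U c w where Uc: "(U, c) \<in> atlas M" "p \<in> U" and u: "u = coord_vec M (U, c) p w"
    using assms(1) by (rule tangent_chart)
  obtain w' where v: "v = coord_vec M (U, c) p w'" using assms(2) Uc by (rule tangentE)
  have "(\<lambda>f. a * u f + b * v f) = coord_vec M (U, c) p (a *\<^sub>R w + b *\<^sub>R w')"
  proof
    fix f
    let ?s = "\<lambda>w. \<Sum>b\<in>Basis. (w \<bullet> b) * coord_vec M (U, c) p b f"
    have "a * ?s w + b * ?s w' = ?s (a *\<^sub>R w + b *\<^sub>R w')"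
      by (simp add: inner_add_left distrib_right sum.distrib sum_distrib_left mult.assoc)
    then show "a * u f + b * v f = coord_vec M (U, c) p (a *\<^sub>R w + b *\<^sub>R w') f"
      unfolding u v by (simp only: coord_vec_expand[OF Uc, symmetric])
  qed
  then show ?thesis using coord_vec_tangent[OF Uc] by simp
qed

lemma tangent_zero:
  assumes "p \<in> points M"
  shows "(\<lambda>f. 0) \<in> tangent_space M p"
proof -
  obtain U c where Uc: "(U, c) \<in> atlas M" "p \<in> U" using assms by (rule chart_at)
  from tangent_lincomb[OF coord_vec_tangent[OF this] coord_vec_tangent[OF this], of 0 _ 0] show ?thesis
    by simp
qed

lemma tangent_scale: "u \<in> tangent_space M p \<Longrightarrow> (\<lambda>f. a * u f) \<in> tangent_space M p"
  using tangent_lincomb[of u p u a 0] by simp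

lemma tangent_plus: "u \<in> tangent_space M p \<Longrightarrow> v \<in> tangent_space M p \<Longrightarrow> (\<lambda>f. u f + v f) \<in> tangent_space M p"
  using tangent_lincomb[of u p v 1 1] by simp

lemma tangent_sub: "u \<in> tangent_space M p \<Longrightarrow> v \<in> tangent_space M p \<Longrightarrow> (\<lambda>f. u f - v f) \<in> tangent_space M p"
  using tangent_lincomb[of u p v 1 "-1"] by simp

lemma linear_at_zero: "linear_at M p L \<Longrightarrow> p \<in> points M \<Longrightarrow> L (\<lambda>f. 0) = 0"
  using linear_at_lincomb[of M p L "\<lambda>f. 0" "\<lambda>f. 0" 0 0] tangent_zero by auto

lemma linear_at_scale: "linear_at M p L \<Longrightarrow> u \<in> tangent_space M p \<Longrightarrow> L (\<lambda>f. a * u f) = a * L u"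
  using linear_at_lincomb[of M p L u u a 0] by auto

lemma linear_at_add: "linear_at M p L \<Longrightarrow> u \<in> tangent_space M p \<Longrightarrow> v \<in> tangent_space M p \<Longrightarrow>
    L (\<lambda>f. u f + v f) = L u + L v"
  using linear_at_lincomb[of M p L u v 1 1] by auto

lemma linear_at_sub: "linear_at M p L \<Longrightarrow> u \<in> tangent_space M p \<Longrightarrow> v \<in> tangent_space M p \<Longrightarrow>
    L (\<lambda>f. u f - v f) = L u - L v"
  using linear_at_lincomb[of M p L u v 1 "-1"] by auto

lemma linear_at_uminus: "linear_at M p L \<Longrightarrow> u \<in> tangent_space M p \<Longrightarrow> L (\<lambda>f. - u f) = - L u"
  using linear_at_scale[of p L u "-1"] by auto

lemma tangent_lin_sum:
  assumes "p \<in> points M" "finite A" "\<And>i. i \<in> A \<Longrightarrow> u i \<in> tangent_space M p"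
  shows "(\<lambda>f. \<Sum>i\<in>A. a i * u i f) \<in> tangent_space M p"
    and "linear_at M p L \<Longrightarrow> L (\<lambda>f. \<Sum>i\<in>A. a i * u i f) = (\<Sum>i\<in>A. a i * L (u i))"
proof -
  have "(\<lambda>f. \<Sum>i\<in>A. a i * u i f) \<in> tangent_space M p \<and>
      (linear_at M p L \<longrightarrow> L (\<lambda>f. \<Sum>i\<in>A. a i * u i f) = (\<Sum>i\<in>A. a i * L (u i)))"
    using assms(2,3)
  proof induction
    case empty
    then show ?case using tangent_zero linear_at_zero assms(1) by simp
  next
    case (insert x F)
    then have "(\<lambda>f. a x * u x f + 1 * (\<Sum>i\<in>F. a i * u i f)) \<in> tangent_space M p"
      by (intro tangent_lincomb) auto
    then show ?case
      using insert linear_at_lincomb[of M p L "u x" "\<lambda>f. \<Sum>i\<in>F. a i * u i f" "a x" 1] by auto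
  qed
  then show "(\<lambda>f. \<Sum>i\<in>A. a i * u i f) \<in> tangent_space M p"
    and "linear_at M p L \<Longrightarrow> L (\<lambda>f. \<Sum>i\<in>A. a i * u i f) = (\<Sum>i\<in>A. a i * L (u i))"
    by auto
qed

lemma linear_at_expand:
  assumes "linear_at M p L" "u \<in> tangent_space M p" "(U, c) \<in> atlas M" "p \<in> U"
  shows "L u = (\<Sum>b\<in>Basis. u (\<lambda>q. c q \<bullet> b) * L (coord_vec M (U, c) p b))"
proof -
  have "L u = L (\<lambda>f. \<Sum>b\<in>Basis. u (\<lambda>q. c q \<bullet> b) * coord_vec M (U, c) p b f)"
    using tangent_expand[OF assms(2-4)] by (intro arg_cong[of _ _ L] ext)
  also have "\<dots> = (\<Sum>b\<in>Basis. u (\<lambda>q. c q \<bullet> b) * L (coord_vec M (U, c) p b))"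
    using assms tangent_points by (intro tangent_lin_sum) (auto intro: coord_vec_tangent)
  finally show ?thesis .
qed

end

section \<open>Smooth fields along maps\<close>

text \<open>Phrased by pull-back of germs instead of charts, so that the identity and the
  projections can be checked directly. The filter condition is continuity at \<open>z\<close>; it
  transports eventual statements from \<open>M\<close> to \<open>P\<close>.\<close>

definition smooth_map_at ::
  "('a, 'b::euclidean_space) manifold \<Rightarrow> ('c, 'd::euclidean_space) manifold \<Rightarrow> ('a \<Rightarrow> 'c) \<Rightarrow> 'a \<Rightarrow> bool" where
  "smooth_map_at P M \<pi> z \<longleftrightarrow> filterlim \<pi> (nhdsin (mtop M) (\<pi> z)) (nhdsin (mtop P) z) \<and>
     (\<forall>f\<in>smooth_near M (\<pi> z). (\<lambda>x. f (\<pi> x)) \<in> smooth_near P z)"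

text \<open>With \<open>\<pi>\<close> the identity these are the local vector fields; with \<open>\<pi>\<close> the projection of a product
  they are the components of vector fields on the product.\<close>

definition smooth_along ::
  "('a, 'b::euclidean_space) manifold \<Rightarrow> ('c, 'd::euclidean_space) manifold \<Rightarrow> ('a \<Rightarrow> 'c) \<Rightarrow> 'a \<Rightarrow>
     ('a \<Rightarrow> 'c tvec) \<Rightarrow> bool" where
  "smooth_along P M \<pi> z X \<longleftrightarrow>
     eventually (\<lambda>x. X x \<in> tangent_space M (\<pi> x)) (nhdsin (mtop P) z) \<and>
     (\<forall>f\<in>smooth_near M (\<pi> z). (\<lambda>x. X x f) \<in> smooth_near P z)"

abbreviation smooth_field :: "('a, 'b::euclidean_space) manifold \<Rightarrow> 'a \<Rightarrow> ('a \<Rightarrow> 'a tvec) \<Rightarrow> bool" where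
  "smooth_field M \<equiv> smooth_along M M (\<lambda>x. x)"

lemma smooth_map_at_id: "smooth_map_at M M (\<lambda>x. x) p"
  by (simp add: smooth_map_at_def filterlim_ident)

lemma smooth_alongD: "smooth_along P M \<pi> z X \<Longrightarrow> f \<in> smooth_near M (\<pi> z) \<Longrightarrow> (\<lambda>x. X x f) \<in> smooth_near P z"
  by (simp add: smooth_along_def)

context mfd
begin

lemma coord_vec_smooth:
  assumes "(U, c) \<in> atlas M" "p \<in> U" "f \<in> smooth_near M p"
  shows "(\<lambda>q. coord_vec M (U, c) q w f) \<in> smooth_near M p"
    and "eventually (\<lambda>x. coord_vec M (U, c) (inv_into U c x) w f = frechet_derivative (f \<circ> inv_into U c) (at x) w)
      (nhds (c p))"
proof -
  have "eventually (\<lambda>q. q \<in> U \<and> f \<in> smooth_near M q) (nhdsin (mtop M) p)"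
    using eventually_chart[OF assms(1,2)] eventually_smooth_near[OF assms(3)] by eventually_elim simp
  then have "eventually (\<lambda>x. inv_into U c x \<in> U \<and> f \<in> smooth_near M (inv_into U c x)) (nhds (c p))"
    unfolding eventually_nhdsin_chart[OF assms(1,2)] .
  moreover have "eventually (\<lambda>x. x \<in> c ` U) (nhds (c p))"
    using chart_image_open[OF assms(1)] assms(2) by (intro eventually_nhds_in_open) auto
  ultimately show *: "eventually (\<lambda>x. coord_vec M (U, c) (inv_into U c x) w f = frechet_derivative (f \<circ> inv_into U c) (at x) w)
      (nhds (c p))"
    by eventually_elim (simp add: coord_vec_apply f_inv_into_f)
  have "smooth_at (c p) (\<lambda>x. frechet_derivative (f \<circ> inv_into U c) (at x) w)"
    using assms(3) unfolding smooth_near_iff[OF assms(1,2)] by (rule smooth_at_derivative)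
  then show "(\<lambda>q. coord_vec M (U, c) q w f) \<in> smooth_near M p"
    unfolding smooth_near_iff[OF assms(1,2)]
    by (rule smooth_at_cong[rotated]) (use * in \<open>auto elim: eventually_mono\<close>)
qed

lemma coord_vec_field:
  assumes "(U, c) \<in> atlas M" "p \<in> U"
  shows "smooth_field M p (\<lambda>q. coord_vec M (U, c) q w)"
  unfolding smooth_along_def using coord_vec_smooth(1)[OF assms] eventually_chart[OF assms]
  by (auto elim!: eventually_mono intro: coord_vec_tangent assms)

text \<open>Applying two coordinate fields in succession gives a second partial derivative of the
  chart representative.\<close>

lemma coord_vec_commute:
  assumes "(U, c) \<in> atlas M" "p \<in> U" "f \<in> smooth_near M p"
  shows "coord_vec M (U, c) p v (\<lambda>q. coord_vec M (U, c) q w f) = coord_vec M (U, c) p w (\<lambda>q. coord_vec M (U, c) q v f)"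
proof -
  have *: "coord_vec M (U, c) p v (\<lambda>q. coord_vec M (U, c) q w f) =
      frechet_derivative (\<lambda>x. frechet_derivative (f \<circ> inv_into U c) (at x) w) (at (c p)) v" for v w
    using frechet_derivative_cong_ev[OF coord_vec_smooth(2)[OF assms, of w]]
    by (simp add: coord_vec_apply[OF coord_vec_smooth(1)[OF assms]] o_def)
  show ?thesis
    unfolding * using assms(3) unfolding smooth_near_iff[OF assms(1,2)]
    by (rule mixed_derivatives_commute)
qed

end

locale mfd2 = P: mfd P + M: mfd M
  for P :: "('p, 'q::euclidean_space) manifold" and M :: "('a, 'b::euclidean_space) manifold"
begin

lemma eventually_along:
  assumes "smooth_map_at P M \<pi> z" "eventually Q (nhdsin (mtop M) (\<pi> z))"
  shows "eventually (\<lambda>x. Q (\<pi> x)) (nhdsin (mtop P) z)"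
  using assms unfolding smooth_map_at_def filterlim_iff by blast

lemma smooth_near_along:
  "smooth_map_at P M \<pi> z \<Longrightarrow> f \<in> smooth_near M (\<pi> z) \<Longrightarrow> (\<lambda>x. f (\<pi> x)) \<in> smooth_near P z"
  unfolding smooth_map_at_def by blast

text \<open>Every tangent vector is a combination of coordinate vectors with its values on the
  coordinate functions as coefficients. Testing these functions in one chart therefore controls the
  action on all smooth germs.\<close>

lemma smooth_alongI:
  assumes \<pi>: "smooth_map_at P M \<pi> z" and z: "z \<in> points P" and Uc: "(U, c) \<in> atlas M" "\<pi> z \<in> U"
    and T: "eventually (\<lambda>x. X x \<in> tangent_space M (\<pi> x)) (nhdsin (mtop P) z)"
    and S: "\<And>b. b \<in> Basis \<Longrightarrow> (\<lambda>x. X x (\<lambda>q. c q \<bullet> b)) \<in> smooth_near P z"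
  shows "smooth_along P M \<pi> z X"
  unfolding smooth_along_def
proof (intro conjI T ballI)
  fix f assume f: "f \<in> smooth_near M (\<pi> z)"
  have "(\<lambda>x. \<Sum>b\<in>Basis. X x (\<lambda>q. c q \<bullet> b) * coord_vec M (U, c) (\<pi> x) b f) \<in> smooth_near P z"
    by (intro P.smooth_near_sum P.smooth_near_mult S z smooth_near_along[OF \<pi> M.coord_vec_smooth(1)[OF Uc f]])
  moreover have "eventually (\<lambda>x. \<pi> x \<in> U) (nhdsin (mtop P) z)"
    using M.eventually_chart[OF Uc] by (rule eventually_along[OF \<pi>])
  then have "eventually (\<lambda>x. (\<Sum>b\<in>Basis. X x (\<lambda>q. c q \<bullet> b) * coord_vec M (U, c) (\<pi> x) b f) = X x f)
      (nhdsin (mtop P) z)"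
    using T by eventually_elim (rule M.tangent_expand[OF _ Uc(1), symmetric])
  ultimately show "(\<lambda>x. X x f) \<in> smooth_near P z"
    by (rule P.smooth_near_cong[rotated])
qed

text \<open>The common reduction for tensor fields: a linear form applied to a field is a sum of
  components times the form on coordinate vectors. The form may depend on the point of
  \<open>P\<close> and not only on its image in \<open>M\<close>.\<close>

lemma linear_along:
  assumes \<pi>: "smooth_map_at P M \<pi> z" and z: "z \<in> points P" and Uc: "(U, c) \<in> atlas M" "\<pi> z \<in> U"
    and X: "smooth_along P M \<pi> z X"
    and L: "\<And>x. x \<in> points P \<Longrightarrow> \<pi> x \<in> points M \<Longrightarrow> linear_at M (\<pi> x) (L x)"
    and S: "\<And>b. b \<in> Basis \<Longrightarrow> (\<lambda>x. L x (coord_vec M (U, c) (\<pi> x) b)) \<in> smooth_near P z"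
  shows "(\<lambda>x. L x (X x)) \<in> smooth_near P z"
proof -
  have "(\<lambda>x. \<Sum>b\<in>Basis. X x (\<lambda>q. c q \<bullet> b) * L x (coord_vec M (U, c) (\<pi> x) b)) \<in> smooth_near P z"
    by (intro P.smooth_near_sum P.smooth_near_mult S z smooth_alongD[OF X] M.smooth_near_coord[OF Uc]) auto
  moreover have "eventually (\<lambda>x. \<pi> x \<in> U) (nhdsin (mtop P) z)"
    using M.eventually_chart[OF Uc] by (rule eventually_along[OF \<pi>])
  then have "eventually (\<lambda>x. (\<Sum>b\<in>Basis. X x (\<lambda>q. c q \<bullet> b) * L x (coord_vec M (U, c) (\<pi> x) b)) = L x (X x))
      (nhdsin (mtop P) z)"
    using X[unfolded smooth_along_def, THEN conjunct1] P.eventually_points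
  proof eventually_elim
    case (elim x)
    then have "linear_at M (\<pi> x) (L x)" using L M.tangent_points by blast
    from M.linear_at_expand[OF this elim(2) Uc(1) elim(1)] show ?case by (rule sym)
  qed
  ultimately show ?thesis
    by (rule P.smooth_near_cong[rotated])
qed

lemma one_form_along:
  assumes "one_form M \<omega>" "smooth_map_at P M \<pi> z" "z \<in> points P" "\<pi> z \<in> points M" "smooth_along P M \<pi> z X"
  shows "(\<lambda>x. \<omega> (\<pi> x) (X x)) \<in> smooth_near P z"
proof -
  obtain U c where Uc: "(U, c) \<in> atlas M" "\<pi> z \<in> U" using assms(4) by (rule M.chart_at)
  show ?thesis
  proof (rule linear_along[OF assms(2,3) Uc assms(5)])
    fix b :: 'b
    have "msmooth_on M U (\<lambda>p. \<omega> p (coord_vec M (U, c) p b))"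
      using assms(1) Uc(1) unfolding one_form_def by fastforce
    then show "(\<lambda>x. \<omega> (\<pi> x) (coord_vec M (U, c) (\<pi> x) b)) \<in> smooth_near P z"
      using Uc by (intro smooth_near_along[OF assms(2)]) (simp add: M.msmooth_on_iff M.chart_open)
  qed (use assms(1) in \<open>auto simp: one_form_def\<close>)
qed

lemma endo_field_along:
  assumes "endo_field M J" "smooth_map_at P M \<pi> z" "z \<in> points P" "\<pi> z \<in> points M" "smooth_along P M \<pi> z X"
  shows "smooth_along P M \<pi> z (\<lambda>x. J (\<pi> x) (X x))"
proof -
  obtain U c where Uc: "(U, c) \<in> atlas M" "\<pi> z \<in> U" using assms(4) by (rule M.chart_at)
  show ?thesis
  proof (rule smooth_alongI[OF assms(2,3) Uc])
    show "eventually (\<lambda>x. J (\<pi> x) (X x) \<in> tangent_space M (\<pi> x)) (nhdsin (mtop P) z)"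
      using assms(5)[unfolded smooth_along_def, THEN conjunct1]
      by eventually_elim (use assms(1) M.tangent_points in \<open>auto simp: endo_field_def\<close>)
    fix b' :: 'b
    show "(\<lambda>x. J (\<pi> x) (X x) (\<lambda>q. c q \<bullet> b')) \<in> smooth_near P z"
    proof (rule linear_along[OF assms(2,3) Uc assms(5)])
      fix b :: 'b
      have "msmooth_on M U (\<lambda>p. J p (coord_vec M (U, c) p b) (\<lambda>q. c q \<bullet> b'))"
        using assms(1) Uc(1) unfolding endo_field_def by fastforce
      then show "(\<lambda>x. J (\<pi> x) (coord_vec M (U, c) (\<pi> x) b) (\<lambda>q. c q \<bullet> b')) \<in> smooth_near P z"
        using Uc by (intro smooth_near_along[OF assms(2)]) (simp add: M.msmooth_on_iff M.chart_open)
    qed (use assms(1) in \<open>auto simp: endo_field_def\<close>)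
  qed
qed

text \<open>Linearity is available in the second slot, and symmetry carries it to the first.
  Expanding \<open>Y\<close> and then \<open>X\<close> in the coordinate basis leaves only the chart
  coefficients of the metric.\<close>

lemma riemannian_metric_along:
  assumes g: "riemannian_metric M g" and \<pi>: "smooth_map_at P M \<pi> z" "z \<in> points P" "\<pi> z \<in> points M"
    and X: "smooth_along P M \<pi> z X" and Y: "smooth_along P M \<pi> z Y"
  shows "(\<lambda>x. g (\<pi> x) (X x) (Y x)) \<in> smooth_near P z"
proof -
  obtain U c where Uc: "(U, c) \<in> atlas M" "\<pi> z \<in> U" using \<pi>(3) by (rule M.chart_at)
  have lin: "linear_at M p (g p u)" and sym: "v \<in> tangent_space M p \<Longrightarrow> g p u v = g p v u"
    if "p \<in> points M" "u \<in> tangent_space M p" for p u v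
    using g that unfolding riemannian_metric_def by blast+
  have evU: "eventually (\<lambda>x. \<pi> x \<in> U) (nhdsin (mtop P) z)"
    using M.eventually_chart[OF Uc] by (rule eventually_along[OF \<pi>(1)])
  have 1: "(\<lambda>x. g (\<pi> x) (coord_vec M (U, c) (\<pi> x) b) (Y x)) \<in> smooth_near P z" for b
  proof -
    have "(\<lambda>x. \<Sum>b'\<in>Basis. Y x (\<lambda>q. c q \<bullet> b') * g (\<pi> x) (coord_vec M (U, c) (\<pi> x) b) (coord_vec M (U, c) (\<pi> x) b')) \<in> smooth_near P z"
    proof (intro P.smooth_near_sum P.smooth_near_mult \<pi> smooth_alongD[OF Y] M.smooth_near_coord[OF Uc])
      fix b' :: 'b
      have "msmooth_on M U (\<lambda>p. g p (coord_vec M (U, c) p b) (coord_vec M (U, c) p b'))"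
        using g Uc(1) unfolding riemannian_metric_def by fastforce
      then show "(\<lambda>x. g (\<pi> x) (coord_vec M (U, c) (\<pi> x) b) (coord_vec M (U, c) (\<pi> x) b')) \<in> smooth_near P z"
        using Uc by (intro smooth_near_along[OF \<pi>(1)]) (simp add: M.msmooth_on_iff M.chart_open)
    qed
    moreover have "eventually (\<lambda>x. (\<Sum>b'\<in>Basis. Y x (\<lambda>q. c q \<bullet> b') * g (\<pi> x) (coord_vec M (U, c) (\<pi> x) b) (coord_vec M (U, c) (\<pi> x) b')) =
        g (\<pi> x) (coord_vec M (U, c) (\<pi> x) b) (Y x)) (nhdsin (mtop P) z)"
      using evU Y[unfolded smooth_along_def, THEN conjunct1]
    proof eventually_elim
      case (elim x)
      then have "linear_at M (\<pi> x) (g (\<pi> x) (coord_vec M (U, c) (\<pi> x) b))"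
        using lin M.tangent_points M.coord_vec_tangent[OF Uc(1)] by blast
      from M.linear_at_expand[OF this elim(2) Uc(1) elim(1)] show ?case by (rule HOL.sym)
    qed
    ultimately show ?thesis by (rule P.smooth_near_cong[rotated])
  qed
  have "(\<lambda>x. \<Sum>b\<in>Basis. X x (\<lambda>q. c q \<bullet> b) * g (\<pi> x) (coord_vec M (U, c) (\<pi> x) b) (Y x)) \<in> smooth_near P z"
    by (intro P.smooth_near_sum P.smooth_near_mult \<pi> smooth_alongD[OF X] M.smooth_near_coord[OF Uc] 1)
  moreover have "eventually (\<lambda>x. (\<Sum>b\<in>Basis. X x (\<lambda>q. c q \<bullet> b) * g (\<pi> x) (coord_vec M (U, c) (\<pi> x) b) (Y x)) = g (\<pi> x) (X x) (Y x)) (nhdsin (mtop P) z)"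
    using evU X[unfolded smooth_along_def, THEN conjunct1] Y[unfolded smooth_along_def, THEN conjunct1]
  proof eventually_elim
    case (elim x)
    then have p: "\<pi> x \<in> points M" using M.tangent_points by blast
    have "g (\<pi> x) (X x) (Y x) = g (\<pi> x) (Y x) (X x)"
      using sym[OF p] elim by blast
    also have "\<dots> = (\<Sum>b\<in>Basis. X x (\<lambda>q. c q \<bullet> b) * g (\<pi> x) (Y x) (coord_vec M (U, c) (\<pi> x) b))"
      using M.linear_at_expand[OF lin[OF p elim(3)] elim(2) Uc(1) elim(1)] .
    also have "\<dots> = (\<Sum>b\<in>Basis. X x (\<lambda>q. c q \<bullet> b) * g (\<pi> x) (coord_vec M (U, c) (\<pi> x) b) (Y x))"
      using sym[OF p elim(3)] M.coord_vec_tangent[OF Uc(1) elim(1)] by simp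
    finally show ?case by simp
  qed
  ultimately show ?thesis by (rule P.smooth_near_cong[rotated])
qed

lemma smooth_along_cong:
  assumes "eventually (\<lambda>x. X x = Y x) (nhdsin (mtop P) z)" "smooth_along P M \<pi> z X"
  shows "smooth_along P M \<pi> z Y"
  unfolding smooth_along_def
proof
  show "eventually (\<lambda>x. Y x \<in> tangent_space M (\<pi> x)) (nhdsin (mtop P) z)"
    using assms(1) assms(2)[unfolded smooth_along_def, THEN conjunct1] by eventually_elim simp
  show "\<forall>f\<in>smooth_near M (\<pi> z). (\<lambda>x. Y x f) \<in> smooth_near P z"
  proof
    fix f assume "f \<in> smooth_near M (\<pi> z)"
    then have "(\<lambda>x. X x f) \<in> smooth_near P z" by (rule smooth_alongD[OF assms(2)])
    then show "(\<lambda>x. Y x f) \<in> smooth_near P z"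
      by (rule P.smooth_near_cong[rotated]) (use assms(1) in \<open>auto elim: eventually_mono\<close>)
  qed
qed

lemma smooth_along_plus:
  assumes "smooth_along P M \<pi> z X" "smooth_along P M \<pi> z Y"
  shows "smooth_along P M \<pi> z (\<lambda>x f. X x f + Y x f)"
proof -
  have "eventually (\<lambda>x. X x \<in> tangent_space M (\<pi> x)) (nhdsin (mtop P) z)"
    "eventually (\<lambda>x. Y x \<in> tangent_space M (\<pi> x)) (nhdsin (mtop P) z)"
    using assms by (auto simp: smooth_along_def)
  then have "eventually (\<lambda>x. (\<lambda>f. X x f + Y x f) \<in> tangent_space M (\<pi> x)) (nhdsin (mtop P) z)"
    by eventually_elim (rule M.tangent_plus)
  then show ?thesis
    using assms by (auto simp: smooth_along_def intro: P.smooth_near_add)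
qed

lemma smooth_along_scale:
  assumes "h \<in> smooth_near P z" "smooth_along P M \<pi> z X"
  shows "smooth_along P M \<pi> z (\<lambda>x f. h x * X x f)"
proof -
  have "eventually (\<lambda>x. X x \<in> tangent_space M (\<pi> x)) (nhdsin (mtop P) z)"
    using assms by (auto simp: smooth_along_def)
  then have "eventually (\<lambda>x. (\<lambda>f. h x * X x f) \<in> tangent_space M (\<pi> x)) (nhdsin (mtop P) z)"
    by eventually_elim (rule M.tangent_scale)
  then show ?thesis
    using assms by (auto simp: smooth_along_def intro: P.smooth_near_mult)
qed

lemma smooth_along_diff:
  assumes "smooth_along P M \<pi> z X" "smooth_along P M \<pi> z Y" "z \<in> points P"
  shows "smooth_along P M \<pi> z (\<lambda>x f. X x f - Y x f)"
  using smooth_along_plus[OF assms(1) smooth_along_scale[OF P.smooth_near_const[OF assms(3), of "-1"] assms(2)]]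
  by simp

text \<open>All vectors \<open>V x\<close> lie in the single vector space at \<open>p\<close>.
  Differentiating their components is therefore an operation with values in that space, and it
  commutes with linear forms. It is used for a field of the product restricted to the curve over one
  base point.\<close>

lemma derivative_at_fixed_point:
  assumes t: "t \<in> tangent_space P y"
    and V: "smooth_along P M (\<lambda>_. p) y V"
  shows "(\<lambda>f. t (\<lambda>x. V x f)) \<in> tangent_space M p"
    and "linear_at M p L \<Longrightarrow> (\<lambda>x. L (V x)) \<in> smooth_near P y \<and> t (\<lambda>x. L (V x)) = L (\<lambda>f. t (\<lambda>x. V x f))"
proof -
  have y: "y \<in> points P" using t by (rule P.tangent_points)
  have evT: "eventually (\<lambda>x. V x \<in> tangent_space M p) (nhdsin (mtop P) y)"
    using V by (simp add: smooth_along_def)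
  then have "V y \<in> tangent_space M p" using y by (rule eventually_nhdsin_self)
  then have p: "p \<in> points M" by (rule M.tangent_points)
  then obtain U c where Uc: "(U, c) \<in> atlas M" "p \<in> U" by (rule M.chart_at)
  have S: "(\<lambda>x. V x (\<lambda>q. c q \<bullet> b)) \<in> smooth_near P y" for b
    by (intro smooth_alongD[OF V] M.smooth_near_coord[OF Uc])
  have E: "t (\<lambda>x. L (V x)) = (\<Sum>b\<in>Basis. t (\<lambda>x. V x (\<lambda>q. c q \<bullet> b)) * L (coord_vec M (U, c) p b))"
    "(\<lambda>x. L (V x)) \<in> smooth_near P y"
    if L: "linear_at M p L" for L
  proof -
    have ev: "eventually (\<lambda>x. (\<Sum>b\<in>Basis. L (coord_vec M (U, c) p b) * V x (\<lambda>q. c q \<bullet> b)) = L (V x)) (nhdsin (mtop P) y)"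
      using evT by eventually_elim (simp add: M.linear_at_expand[OF L _ Uc] mult.commute)
    have sm: "(\<lambda>x. \<Sum>b\<in>Basis. L (coord_vec M (U, c) p b) * V x (\<lambda>q. c q \<bullet> b)) \<in> smooth_near P y"
      by (intro P.smooth_near_sum P.smooth_near_cmult S y)
    show "(\<lambda>x. L (V x)) \<in> smooth_near P y"
      by (rule P.smooth_near_cong[OF ev sm])
    have "t (\<lambda>x. L (V x)) = t (\<lambda>x. \<Sum>b\<in>Basis. L (coord_vec M (U, c) p b) * V x (\<lambda>q. c q \<bullet> b))"
      using P.tangent_cong[OF t ev] by simp
    also have "\<dots> = (\<Sum>b\<in>Basis. L (coord_vec M (U, c) p b) * t (\<lambda>x. V x (\<lambda>q. c q \<bullet> b)))"
      by (simp add: P.tangent_sum[OF t] P.tangent_cmult[OF t] P.smooth_near_cmult S y)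
    also have "\<dots> = (\<Sum>b\<in>Basis. t (\<lambda>x. V x (\<lambda>q. c q \<bullet> b)) * L (coord_vec M (U, c) p b))"
      by (simp add: mult.commute)
    finally show "t (\<lambda>x. L (V x)) = (\<Sum>b\<in>Basis. t (\<lambda>x. V x (\<lambda>q. c q \<bullet> b)) * L (coord_vec M (U, c) p b))" .
  qed
  \<comment> \<open>Evaluation at \<open>f\<close> is itself a linear form, so the formula
    \<open>E\<close> computes the derivative vector.\<close>
  have "linear_at M p (\<lambda>u. u f)" for f
    by (simp add: linear_at_def)
  from E(1)[OF this]
  have R: "(\<lambda>f. t (\<lambda>x. V x f)) = (\<lambda>f. \<Sum>b\<in>Basis. t (\<lambda>x. V x (\<lambda>q. c q \<bullet> b)) * coord_vec M (U, c) p b f)"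
    by blast
  show "(\<lambda>f. t (\<lambda>x. V x f)) \<in> tangent_space M p"
    unfolding R by (intro M.tangent_lin_sum p) (auto intro: M.coord_vec_tangent Uc)
  show "(\<lambda>x. L (V x)) \<in> smooth_near P y \<and> t (\<lambda>x. L (V x)) = L (\<lambda>f. t (\<lambda>x. V x f))" if L: "linear_at M p L"
    unfolding R E(1)[OF L] using E(2)[OF L]
    by (subst M.tangent_lin_sum(2)[OF p _ _ L]) (auto intro: M.coord_vec_tangent Uc)
qed

end

context mfd
begin

sublocale self: mfd2 M M by unfold_locales

lemma chart_point: "(U, c) \<in> atlas M \<Longrightarrow> p \<in> U \<Longrightarrow> p \<in> points M"
  using chart_subset by blast

section \<open>Global vector fields and tensor fields tested on local fields\<close>

lemma vector_fieldsI:
  assumes "\<And>p. p \<notin> points M \<Longrightarrow> X p = (\<lambda>f. 0)" "\<And>p. p \<in> points M \<Longrightarrow> smooth_field M p X"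
  shows "X \<in> vector_fields M"
proof -
  have "X p \<in> tangent_space M p" if "p \<in> points M" for p
    using eventually_nhdsin_self[OF assms(2)[OF that, unfolded smooth_along_def, THEN conjunct1] that] .
  moreover have "msmooth_on M U (\<lambda>p. X p (\<lambda>q. c q \<bullet> w))" if "(U, c) \<in> atlas M" for U c w
    unfolding msmooth_on_iff[OF chart_open[OF that]] using chart_subset[OF that]
    by (auto intro!: smooth_alongD[OF assms(2)] smooth_near_coord[OF that])
  ultimately show ?thesis
    using assms(1) unfolding vector_fields_def by auto
qed

lemma vector_fields_tangent: "X \<in> vector_fields M \<Longrightarrow> p \<in> points M \<Longrightarrow> X p \<in> tangent_space M p"
  by (simp add: vector_fields_def)

lemma vector_fields_outside: "X \<in> vector_fields M \<Longrightarrow> p \<notin> points M \<Longrightarrow> X p = (\<lambda>f. 0)"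
  by (simp add: vector_fields_def)

lemma vector_fields_smooth:
  assumes "X \<in> vector_fields M" "p \<in> points M"
  shows "smooth_field M p X"
proof -
  obtain U c where Uc: "(U, c) \<in> atlas M" "p \<in> U" using assms(2) by (rule chart_at)
  show ?thesis
  proof (rule self.smooth_alongI[OF smooth_map_at_id assms(2) Uc])
    show "eventually (\<lambda>x. X x \<in> tangent_space M x) (nhdsin (mtop M) p)"
      using eventually_points by eventually_elim (rule vector_fields_tangent[OF assms(1)])
    fix b
    have "msmooth_on M U (\<lambda>p. X p (\<lambda>q. c q \<bullet> b))"
      using assms(1) Uc unfolding vector_fields_def by fastforce
    then show "(\<lambda>p. X p (\<lambda>q. c q \<bullet> b)) \<in> smooth_near M p"
      using Uc by (simp add: msmooth_on_iff chart_open)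
  qed
qed

lemma vector_fields_apply_smooth:
  "X \<in> vector_fields M \<Longrightarrow> f \<in> smooth_near M p \<Longrightarrow> (\<lambda>q. X q f) \<in> smooth_near M p"
  by (rule smooth_alongD[OF vector_fields_smooth]) (auto intro: smooth_near_points)

lemma vector_fields_plus:
  "X \<in> vector_fields M \<Longrightarrow> Y \<in> vector_fields M \<Longrightarrow> (\<lambda>p f. X p f + Y p f) \<in> vector_fields M"
  by (rule vector_fieldsI; (rule self.smooth_along_plus; rule vector_fields_smooth)?)
    (simp_all add: vector_fields_outside)

lemma vector_fields_scale:
  "X \<in> vector_fields M \<Longrightarrow> msmooth_on M (points M) h \<Longrightarrow> (\<lambda>p f. h p * X p f) \<in> vector_fields M"
  by (rule vector_fieldsI; (rule self.smooth_along_scale, simp add: msmooth_on_iff, rule vector_fields_smooth)?)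
    (simp_all add: vector_fields_outside)

lemma vector_fields_zero: "(\<lambda>p f. 0) \<in> vector_fields M"
proof (rule vector_fieldsI)
  fix p assume p: "p \<in> points M"
  have "eventually (\<lambda>q. (\<lambda>f. 0) \<in> tangent_space M q) (nhdsin (mtop M) p)"
    using eventually_points by eventually_elim (rule tangent_zero)
  then show "smooth_field M p (\<lambda>p f. 0)"
    using p by (simp add: smooth_along_def smooth_near_const)
qed simp

lemma vector_fields_sum:
  "finite A \<Longrightarrow> (\<And>i. i \<in> A \<Longrightarrow> X i \<in> vector_fields M) \<Longrightarrow> (\<lambda>p f. \<Sum>i\<in>A. X i p f) \<in> vector_fields M"
  by (induction rule: finite_induct) (auto intro: vector_fields_zero vector_fields_plus)

text \<open>The definition tests coordinate fields only, and these are smooth local fields. The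
  rules for endomorphism fields and metrics work in the same way.\<close>

lemma one_formI:
  assumes "\<And>p. p \<in> points M \<Longrightarrow> linear_at M p (\<omega> p)"
    and "\<And>p X. p \<in> points M \<Longrightarrow> smooth_field M p X \<Longrightarrow> (\<lambda>q. \<omega> q (X q)) \<in> smooth_near M p"
  shows "one_form M \<omega>"
  unfolding one_form_def using assms(1)
  by (auto simp: msmooth_on_iff chart_open intro!: assms(2) coord_vec_field intro: chart_point)

lemma endo_fieldI:
  assumes "\<And>p u. p \<in> points M \<Longrightarrow> u \<in> tangent_space M p \<Longrightarrow> J p u \<in> tangent_space M p"
    and "\<And>p f. p \<in> points M \<Longrightarrow> linear_at M p (\<lambda>u. J p u f)"
    and "\<And>p X. p \<in> points M \<Longrightarrow> smooth_field M p X \<Longrightarrow> smooth_field M p (\<lambda>q. J q (X q))"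
  shows "endo_field M J"
  unfolding endo_field_def using assms(1,2)
  by (auto simp: msmooth_on_iff chart_open
      intro!: smooth_alongD[of M M "\<lambda>x. x" _ "\<lambda>q. J q (coord_vec M _ q _)"] assms(3) coord_vec_field smooth_near_coord
      intro: chart_point)

lemma riemannian_metricI:
  assumes "\<And>p u. p \<in> points M \<Longrightarrow> u \<in> tangent_space M p \<Longrightarrow> linear_at M p (g p u)"
    and "\<And>p u v. p \<in> points M \<Longrightarrow> u \<in> tangent_space M p \<Longrightarrow> v \<in> tangent_space M p \<Longrightarrow> g p u v = g p v u"
    and "\<And>p u. p \<in> points M \<Longrightarrow> u \<in> tangent_space M p \<Longrightarrow> u \<noteq> (\<lambda>f. 0) \<Longrightarrow> g p u u > 0"
    and "\<And>p X Y. p \<in> points M \<Longrightarrow> smooth_field M p X \<Longrightarrow> smooth_field M p Y \<Longrightarrow>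
      (\<lambda>q. g q (X q) (Y q)) \<in> smooth_near M p"
  shows "riemannian_metric M g"
  unfolding riemannian_metric_def using assms(1-3)
  by (auto simp: msmooth_on_iff chart_open intro!: assms(4) coord_vec_field intro: chart_point)

lemma apply_endo_vector_fields:
  assumes "endo_field M J" "X \<in> vector_fields M"
  shows "apply_endo M J X \<in> vector_fields M"
proof (rule vector_fieldsI)
  fix p assume p: "p \<in> points M"
  have "smooth_field M p (\<lambda>q. J q (X q))"
    using self.endo_field_along[OF assms(1) smooth_map_at_id p p vector_fields_smooth[OF assms(2) p]] .
  moreover have "eventually (\<lambda>q. J q (X q) = apply_endo M J X q) (nhdsin (mtop M) p)"
    using eventually_points by eventually_elim (simp add: apply_endo_def)
  ultimately show "smooth_field M p (apply_endo M J X)"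
    by (rule self.smooth_along_cong[rotated])
qed (simp add: apply_endo_def)

text \<open>In a chart, \<open>E\<close> splits each iterated derivative into a first-order and a
  second-order sum. The second-order sums of \<open>X Y\<close> and \<open>Y X\<close> agree by
  \<open>coord_vec_commute\<close>, and what is left is the usual coordinate formula of the
  bracket.\<close>

lemma lie_bracket_tangent:
  assumes X: "X \<in> vector_fields M" and Y: "Y \<in> vector_fields M" and p: "p \<in> points M"
  shows "lie_bracket M X Y p \<in> tangent_space M p"
proof -
  obtain U c where Uc: "(U, c) \<in> atlas M" "p \<in> U" using p by (rule chart_at)
  let ?D = "\<lambda>q b. coord_vec M (U, c) q b"
  define co where "co Z b q = Z q (\<lambda>q. c q \<bullet> b)" for Z :: "'a \<Rightarrow> 'a tvec" and b q
  have co: "co Z b \<in> smooth_near M p" if "Z \<in> vector_fields M" for Z b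
    unfolding co_def[abs_def] by (rule vector_fields_apply_smooth[OF that smooth_near_coord[OF Uc]])
  have E: "Z p (\<lambda>q. W q f) = (\<Sum>b\<in>Basis. Z p (co W b) * ?D p b f)
      + (\<Sum>b\<in>Basis. \<Sum>b'\<in>Basis. co W b p * co Z b' p * ?D p b' (\<lambda>q. ?D q b f))"
    if Z: "Z \<in> vector_fields M" and W: "W \<in> vector_fields M" and f: "f \<in> smooth_near M p" for Z W f
  proof -
    note Zp = vector_fields_tangent[OF Z p]
    have df: "(\<lambda>q. ?D q b f) \<in> smooth_near M p" for b
      by (rule coord_vec_smooth[OF Uc f])
    have "eventually (\<lambda>q. W q f = (\<Sum>b\<in>Basis. co W b q * ?D q b f)) (nhdsin (mtop M) p)"
      using eventually_chart[OF Uc]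
      by eventually_elim (use chart_subset[OF Uc(1)] in
        \<open>auto simp: co_def intro!: tangent_expand[OF vector_fields_tangent[OF W] Uc(1)]\<close>)
    then have "Z p (\<lambda>q. W q f) = Z p (\<lambda>q. \<Sum>b\<in>Basis. co W b q * ?D q b f)"
      by (rule tangent_cong[OF Zp])
    also have "\<dots> = (\<Sum>b\<in>Basis. Z p (co W b) * ?D p b f + co W b p * Z p (\<lambda>q. ?D q b f))"
      by (simp add: tangent_sum[OF Zp] tangent_mult[OF Zp] co[OF W] df smooth_near_mult)
    also have "\<dots> = (\<Sum>b\<in>Basis. Z p (co W b) * ?D p b f)
       + (\<Sum>b\<in>Basis. co W b p * (\<Sum>b'\<in>Basis. co Z b' p * ?D p b' (\<lambda>q. ?D q b f)))"
      unfolding co_def[of Z] by (simp only: sum.distrib tangent_expand[OF Zp Uc, symmetric])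
    finally show ?thesis by (simp add: sum_distrib_left mult.assoc)
  qed
  have "lie_bracket M X Y p f = (\<Sum>b\<in>Basis. (X p (co Y b) - Y p (co X b)) * ?D p b f)" for f
  proof (cases "f \<in> smooth_near M p")
    case True
    have "(\<Sum>b\<in>Basis. \<Sum>b'\<in>Basis. co X b p * co Y b' p * ?D p b' (\<lambda>q. ?D q b f))
       = (\<Sum>b\<in>Basis. \<Sum>b'\<in>Basis. co Y b p * co X b' p * ?D p b' (\<lambda>q. ?D q b f))"
      by (subst sum.swap) (simp add: coord_vec_commute[OF Uc True] mult.commute)
    then show ?thesis
      using True p by (simp add: lie_bracket_def E X Y sum_subtractf left_diff_distrib)
  qed (simp add: lie_bracket_def coord_vec_not_smooth)
  then have "lie_bracket M X Y p = (\<lambda>f. \<Sum>b\<in>Basis. (X p (co Y b) - Y p (co X b)) * ?D p b f)"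
    by blast
  then show ?thesis
    by (simp only:) (rule tangent_lin_sum(1)[OF p finite_Basis coord_vec_tangent[OF Uc]])
qed

end

section \<open>Bump functions and the local form of a connection\<close>

text \<open>Smoothness is demanded on \<open>U\<close> only. At every other point of the manifold
  the function vanishes nearby, because \<open>K\<close> is closed and contained in
  \<open>U\<close>.\<close>

definition bump_on :: "('a, 'b::euclidean_space) manifold \<Rightarrow> 'a set \<Rightarrow> ('a \<Rightarrow> real) \<Rightarrow> bool" where
  "bump_on M U \<rho> \<longleftrightarrow> (\<exists>K. closedin (mtop M) K \<and> K \<subseteq> U \<and> (\<forall>q. q \<notin> K \<longrightarrow> \<rho> q = 0)) \<and>
     (\<forall>q\<in>U. \<rho> \<in> smooth_near M q)"

lemma bump_on_outside: "bump_on M U \<rho> \<Longrightarrow> q \<notin> U \<Longrightarrow> \<rho> q = 0"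
  unfolding bump_on_def by blast

context mfd
begin

lemma bump_exists:
  assumes Uc: "(U, c) \<in> atlas M" "p \<in> U"
  obtains \<rho> where "bump_on M U \<rho>" "\<rho> p > 0"
proof -
  have "c p \<in> c ` U" using Uc(2) by blast
  then obtain r where r: "r > 0" "cball (c p) r \<subseteq> c ` U"
    using chart_image_open[OF Uc(1)] open_contains_cball by blast
  obtain g where g: "homeomorphic_maps (subtopology (mtop M) U) (top_of_set (c ` U)) c g"
    using chart_homeo[OF Uc(1)] homeomorphic_map_maps by blast
  have gc: "g (c q) = q" if "q \<in> U" for q
    using g that chart_subset[OF Uc(1)] unfolding homeomorphic_maps_def by auto
  define K where "K = g ` cball (c p) r"
  have "compactin (top_of_set (c ` U)) (cball (c p) r)"
    using r(2) by (simp add: compactin_subtopology)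
  then have "compactin (subtopology (mtop M) U) K"
    unfolding K_def using g image_compactin unfolding homeomorphic_maps_def by blast
  then have "compactin (mtop M) K" and KU: "K \<subseteq> U"
    by (auto simp: compactin_subtopology)
  \<comment> \<open>The Hausdorff property enters here: the preimage of a closed ball is compact,
    hence closed in the whole manifold and not merely in \<open>U\<close>.\<close>
  then have closed: "closedin (mtop M) K"
    using smooth_mfd compactin_imp_closedin unfolding smooth_manifold_def by blast
  have K: "q \<in> K \<longleftrightarrow> q \<in> U \<and> dist (c p) (c q) \<le> r" for q
  proof
    assume "q \<in> K"
    then obtain x where "x \<in> cball (c p) r" "q = g x" unfolding K_def by blast
    then show "q \<in> U \<and> dist (c p) (c q) \<le> r"
      using r(2) gc by (metis (no_types, lifting) imageE mem_cball subsetD)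
  next
    assume "q \<in> U \<and> dist (c p) (c q) \<le> r"
    then show "q \<in> K" unfolding K_def using gc by (metis image_eqI mem_cball)
  qed
  \<comment> \<open>Positive exactly on the open ball of radius \<open>r\<close> about
    \<open>c p\<close>, so composing with \<open>flat_fun 0\<close> cuts off smoothly at its
    boundary.\<close>
  define s where "s x = r * r - (x - c p) \<bullet> (x - c p)" for x
  define \<rho> where "\<rho> q = (if q \<in> U then flat_fun 0 (s (c q)) else 0)" for q
  have "smooth_at x s" for x
  proof -
    have "smooth_at x (\<lambda>x. x + - c p)"
      by (intro smooth_at_add smooth_at_const smooth_at_bounded_linear bounded_linear_ident)
    from smooth_at_bilinear[OF this this bounded_bilinear_inner]
    have "smooth_at x (\<lambda>x. (-1) * ((x + - c p) \<bullet> (x + - c p)))"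
      by (intro smooth_at_bilinear[OF smooth_at_const _ bounded_bilinear_mult])
    from smooth_at_add[OF smooth_at_const[of _ "r * r"] this] show ?thesis
      by (simp add: s_def[abs_def])
  qed
  then have smooth: "smooth_at x (flat_fun 0 \<circ> s)" for x
    by (intro smooth_at_compose) (auto simp: smooth_at_def smooth_on_def Ck_on_flat_fun intro!: exI[of _ UNIV])
  have "\<rho> \<in> smooth_near M q" if q: "q \<in> U" for q
    unfolding smooth_near_iff[OF Uc(1) q]
  proof (rule smooth_at_cong[OF _ smooth])
    have "eventually (\<lambda>x. x \<in> c ` U) (nhds (c q))"
      using chart_image_open[OF Uc(1)] q by (intro eventually_nhds_in_open) auto
    then show "eventually (\<lambda>x. (flat_fun 0 \<circ> s) x = (\<rho> \<circ> inv_into U c) x) (nhds (c q))"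
      by eventually_elim (simp add: \<rho>_def inv_into_into f_inv_into_f)
  qed
  moreover have "\<rho> q = 0" if "q \<notin> K" for q
  proof (cases "q \<in> U")
    case True
    then have "r < dist (c p) (c q)" using that K by auto
    then have "r * r < norm (c q - c p) * norm (c q - c p)"
      using r(1) by (intro mult_strict_mono) (auto simp: dist_norm norm_minus_commute)
    then show ?thesis
      by (simp add: \<rho>_def flat_fun_def s_def dot_square_norm power2_eq_square)
  qed (simp add: \<rho>_def)
  ultimately have "bump_on M U \<rho>"
    unfolding bump_on_def using closed KU by blast
  moreover have "\<rho> p > 0"
    using Uc(2) r(1) by (simp add: \<rho>_def s_def flat_fun_def)
  ultimately show thesis by (rule that)
qed

lemma eventually_bump_zero:
  assumes "bump_on M U \<rho>" "p \<in> points M" "p \<notin> U"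
  shows "eventually (\<lambda>q. \<rho> q = 0) (nhdsin (mtop M) p)"
proof -
  obtain K where K: "closedin (mtop M) K" "K \<subseteq> U" "\<And>q. q \<notin> K \<Longrightarrow> \<rho> q = 0"
    using assms(1) unfolding bump_on_def by blast
  have "eventually (\<lambda>q. q \<in> points M - K) (nhdsin (mtop M) p)"
    using K assms by (intro eventually_nhdsin_openin) auto
  then show ?thesis by eventually_elim (simp add: K)
qed

text \<open>The bump function extends a function that is smooth on \<open>U\<close> alone by 0 to
  the whole manifold. Values of \<open>F\<close> off \<open>U\<close> are multiplied by 0.\<close>

lemma bump_mult:
  assumes "bump_on M U \<rho>" "\<And>q. q \<in> U \<Longrightarrow> F \<in> smooth_near M q"
  shows "msmooth_on M (points M) (\<lambda>q. \<rho> q * F q)"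
  unfolding msmooth_on_iff[OF openin_topspace]
proof
  fix p assume p: "p \<in> points M"
  show "(\<lambda>q. \<rho> q * F q) \<in> smooth_near M p"
  proof (cases "p \<in> U")
    case True
    then show ?thesis using assms by (intro smooth_near_mult) (auto simp: bump_on_def)
  next
    case False
    have "eventually (\<lambda>q. 0 = \<rho> q * F q) (nhdsin (mtop M) p)"
      using eventually_bump_zero[OF assms(1) p False] by eventually_elim simp
    then show ?thesis by (rule smooth_near_cong) (rule smooth_near_const[OF p])
  qed
qed

lemma bump_field:
  assumes "bump_on M U \<rho>" "U \<subseteq> points M" "\<And>q. q \<in> U \<Longrightarrow> smooth_field M q V"
  shows "(\<lambda>q f. \<rho> q * V q f) \<in> vector_fields M"
proof (rule vector_fieldsI)
  show "(\<lambda>f. \<rho> p * V p f) = (\<lambda>f. 0)" if "p \<notin> points M" for p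
  proof -
    have "\<rho> p = 0" using bump_on_outside[OF assms(1), of p] assms(2) that by blast
    then show ?thesis by simp
  qed
  fix p assume p: "p \<in> points M"
  show "smooth_field M p (\<lambda>q f. \<rho> q * V q f)"
  proof (cases "p \<in> U")
    case True
    then show ?thesis using assms by (intro self.smooth_along_scale) (auto simp: bump_on_def)
  next
    case False
    have "eventually (\<lambda>q. (\<lambda>f. 0) = (\<lambda>f. \<rho> q * V q f)) (nhdsin (mtop M) p)"
      using eventually_bump_zero[OF assms(1) p False] by eventually_elim simp
    then show ?thesis by (rule self.smooth_along_cong) (rule vector_fields_smooth[OF vector_fields_zero p])
  qed
qed

lemma bump_coord_field:
  assumes "bump_on M U \<rho>" "(U, c) \<in> atlas M"
  shows "(\<lambda>q f. \<rho> q * coord_vec M (U, c) q w f) \<in> vector_fields M"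
  by (intro bump_field[OF assms(1)] chart_subset[OF assms(2)] coord_vec_field assms(2))

section \<open>Algebraic rules for affine connections\<close>

lemma connection_vector_fields:
  "affine_connection M D \<Longrightarrow> X \<in> vector_fields M \<Longrightarrow> Y \<in> vector_fields M \<Longrightarrow> D X Y \<in> vector_fields M"
  unfolding affine_connection_def by blast

lemma connection_plus:
  assumes "affine_connection M D" "X \<in> vector_fields M" "Y \<in> vector_fields M" "Z \<in> vector_fields M"
  shows "D (\<lambda>p f. X p f + Y p f) Z = (\<lambda>p f. D X Z p f + D Y Z p f)"
    "D X (\<lambda>p f. Y p f + Z p f) = (\<lambda>p f. D X Y p f + D X Z p f)"
  using assms unfolding affine_connection_def by blast+

lemma connection_scale:
  assumes "affine_connection M D" "X \<in> vector_fields M" "Y \<in> vector_fields M" "msmooth_on M (points M) h"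
  shows "D (\<lambda>p f. h p * X p f) Y = (\<lambda>p f. h p * D X Y p f)"
    "D X (\<lambda>p f. h p * Y p f) = (\<lambda>p f. X p h * Y p f + h p * D X Y p f)"
  using assms unfolding affine_connection_def by blast+

lemma connection_zero:
  assumes D: "affine_connection M D" and X: "X \<in> vector_fields M"
  shows "D (\<lambda>p f. 0) X = (\<lambda>p f. 0)" "D X (\<lambda>p f. 0) = (\<lambda>p f. 0)"
proof -
  have "D (\<lambda>p f. 0) X p f = D (\<lambda>p f. 0) X p f + D (\<lambda>p f. 0) X p f"
    "D X (\<lambda>p f. 0) p f = D X (\<lambda>p f. 0) p f + D X (\<lambda>p f. 0) p f" for p f
    using fun_cong[OF fun_cong[OF connection_plus(1)[OF D vector_fields_zero vector_fields_zero X]], of p f]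
      fun_cong[OF fun_cong[OF connection_plus(2)[OF D X vector_fields_zero vector_fields_zero]], of p f]
    by auto
  then show "D (\<lambda>p f. 0) X = (\<lambda>p f. 0)" "D X (\<lambda>p f. 0) = (\<lambda>p f. 0)"
    by (auto simp: fun_eq_iff)
qed

lemma connection_sum:
  assumes D: "affine_connection M D" and X: "X \<in> vector_fields M" and "finite A"
    and "\<And>i. i \<in> A \<Longrightarrow> E i \<in> vector_fields M" "\<And>i. i \<in> A \<Longrightarrow> msmooth_on M (points M) (h i)"
  shows "D (\<lambda>p f. \<Sum>i\<in>A. h i p * E i p f) X = (\<lambda>p f. \<Sum>i\<in>A. h i p * D (E i) X p f)"
    and "D X (\<lambda>p f. \<Sum>i\<in>A. h i p * E i p f) = (\<lambda>p f. \<Sum>i\<in>A. X p (h i) * E i p f + h i p * D X (E i) p f)"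
proof -
  have "D (\<lambda>p f. \<Sum>i\<in>A. h i p * E i p f) X = (\<lambda>p f. \<Sum>i\<in>A. h i p * D (E i) X p f) \<and>
    D X (\<lambda>p f. \<Sum>i\<in>A. h i p * E i p f) = (\<lambda>p f. \<Sum>i\<in>A. X p (h i) * E i p f + h i p * D X (E i) p f)"
    using assms(3-)
  proof (induction rule: finite_induct)
    case empty
    show ?case by (simp add: connection_zero[OF D X])
  next
    case (insert j A)
    have 1: "(\<lambda>p f. h j p * E j p f) \<in> vector_fields M" "(\<lambda>p f. \<Sum>i\<in>A. h i p * E i p f) \<in> vector_fields M"
      using insert by (auto intro!: vector_fields_scale vector_fields_sum)
    show ?case
      using insert by (simp add: connection_plus[OF D 1 X] connection_plus[OF D X 1] connection_scale[OF D] X)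
  qed
  then show "D (\<lambda>p f. \<Sum>i\<in>A. h i p * E i p f) X = (\<lambda>p f. \<Sum>i\<in>A. h i p * D (E i) X p f)"
    and "D X (\<lambda>p f. \<Sum>i\<in>A. h i p * E i p f) = (\<lambda>p f. \<Sum>i\<in>A. X p (h i) * E i p f + h i p * D X (E i) p f)"
    by blast+
qed

text \<open>The coordinate fields are only defined on the chart domain, where a connection cannot be
  applied to them. Multiplying them by a bump function \<open>\<rho>\<close> makes them global, at the price of the
  factors and of the logarithmic derivative of \<open>\<rho>\<close>.\<close>

lemma connection_local:
  assumes D: "affine_connection M D" and X: "X \<in> vector_fields M" and Y: "Y \<in> vector_fields M"
    and Uc: "(U, c) \<in> atlas M" "p \<in> U" and \<rho>: "bump_on M U \<rho>" "\<rho> p \<noteq> 0"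
  defines "E b \<equiv> \<lambda>q f. \<rho> q * coord_vec M (U, c) q b f"
  shows "D X Y p f = (\<Sum>b\<in>Basis. X p (\<lambda>q. Y q (\<lambda>q. c q \<bullet> b)) * coord_vec M (U, c) p b f)
     - X p \<rho> / \<rho> p * Y p f
     + (\<Sum>b\<in>Basis. \<Sum>b'\<in>Basis. X p (\<lambda>q. c q \<bullet> b') * Y p (\<lambda>q. c q \<bullet> b) / (\<rho> p * \<rho> p) * D (E b') (E b) p f)"
proof -
  define co where "co Z b q = Z q (\<lambda>q. c q \<bullet> b)" for Z :: "'a \<Rightarrow> 'a tvec" and b q
  have co: "co Z b \<in> smooth_near M q" if "Z \<in> vector_fields M" "q \<in> U" for Z b q
    unfolding co_def[abs_def] by (rule vector_fields_apply_smooth[OF that(1) smooth_near_coord[OF Uc(1) that(2)]])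
  define h where "h Z b q = \<rho> q * co Z b q" for Z b q
  have h: "msmooth_on M (points M) (h Z b)" if "Z \<in> vector_fields M" for Z b
    unfolding h_def[abs_def] by (rule bump_mult[OF \<rho>(1) co[OF that]])
  have \<rho>smooth: "\<rho> \<in> smooth_near M q" if "q \<in> U" for q
    using \<rho>(1) that unfolding bump_on_def by blast
  have \<rho>2: "msmooth_on M (points M) (\<lambda>q. \<rho> q * \<rho> q)"
    by (rule bump_mult[OF \<rho>(1) \<rho>smooth])
  have E: "E b \<in> vector_fields M" for b
    unfolding E_def by (rule bump_coord_field[OF \<rho>(1) Uc(1)])
  \<comment> \<open>The square appears because the components of \<open>Z\<close> and the coordinate
    fields each need a factor \<rho> of their own to become global. Off \<open>U\<close> both sides
    are 0.\<close>
  have expand: "(\<lambda>q f. (\<rho> q * \<rho> q) * Z q f) = (\<lambda>q f. \<Sum>b\<in>Basis. h Z b q * E b q f)" if Z: "Z \<in> vector_fields M" for Z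
  proof (intro ext)
    fix q f
    show "(\<rho> q * \<rho> q) * Z q f = (\<Sum>b\<in>Basis. h Z b q * E b q f)"
    proof (cases "q \<in> U")
      case True
      have "Z q f = (\<Sum>b\<in>Basis. co Z b q * coord_vec M (U, c) q b f)"
        unfolding co_def by (rule tangent_expand[OF vector_fields_tangent[OF Z chart_point[OF Uc(1) True]] Uc(1) True])
      then show ?thesis
        by (simp add: h_def E_def sum_distrib_left mult.assoc mult.left_commute)
    qed (simp add: bump_on_outside[OF \<rho>(1)] h_def)
  qed
  note p = chart_point[OF Uc]
  note Xp = vector_fields_tangent[OF X p]
  have DE: "D X (E b) p f = (\<Sum>b'\<in>Basis. co X b' p * D (E b') (E b) p f) / \<rho> p" for b
  proof -
    have "(\<lambda>q f. (\<rho> q * \<rho> q) * D X (E b) q f) = (\<lambda>q f. \<Sum>b'\<in>Basis. h X b' q * D (E b') (E b) q f)"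
      using connection_scale(1)[OF D X E[of b] \<rho>2]
        connection_sum(1)[of D "E b" Basis E "h X", OF D E finite_Basis E h[OF X]]
      unfolding expand[OF X] by (simp only:)
    then have "(\<rho> p * \<rho> p) * D X (E b) p f = (\<Sum>b'\<in>Basis. h X b' p * D (E b') (E b) p f)"
      by (rule fun_cong[OF fun_cong])
    also have "\<dots> = \<rho> p * (\<Sum>b'\<in>Basis. co X b' p * D (E b') (E b) p f)"
      by (simp add: h_def sum_distrib_left mult.assoc)
    finally show ?thesis using \<rho>(2) by (simp add: field_simps)
  qed
  have "(\<lambda>q f. X q (\<lambda>q. \<rho> q * \<rho> q) * Y q f + (\<rho> q * \<rho> q) * D X Y q f)
      = (\<lambda>q f. \<Sum>b\<in>Basis. X q (h Y b) * E b q f + h Y b q * D X (E b) q f)"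
    using connection_scale(2)[OF D X Y \<rho>2] connection_sum(2)[of D X Basis E "h Y", OF D X finite_Basis E h[OF Y]]
    unfolding expand[OF Y] by (simp only:)
  then have "X p (\<lambda>q. \<rho> q * \<rho> q) * Y p f + (\<rho> p * \<rho> p) * D X Y p f
      = (\<Sum>b\<in>Basis. X p (h Y b) * E b p f + h Y b p * D X (E b) p f)"
    by (rule fun_cong[OF fun_cong])
  moreover have "X p (\<lambda>q. \<rho> q * \<rho> q) = 2 * \<rho> p * X p \<rho>"
    using tangent_mult[OF Xp \<rho>smooth \<rho>smooth] Uc(2) by simp
  moreover have "X p (h Y b) = X p \<rho> * co Y b p + \<rho> p * X p (co Y b)" for b
    unfolding h_def[abs_def] using tangent_mult[OF Xp \<rho>smooth co[OF Y]] Uc(2) by simp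
  ultimately have "2 * \<rho> p * X p \<rho> * Y p f + (\<rho> p * \<rho> p) * D X Y p f
      = (\<Sum>b\<in>Basis. (X p \<rho> * co Y b p + \<rho> p * X p (co Y b)) * E b p f + h Y b p * D X (E b) p f)"
    by simp
  also have "\<dots> = \<rho> p * X p \<rho> * (\<Sum>b\<in>Basis. co Y b p * coord_vec M (U, c) p b f)
      + \<rho> p * \<rho> p * (\<Sum>b\<in>Basis. X p (co Y b) * coord_vec M (U, c) p b f)
      + \<rho> p * (\<Sum>b\<in>Basis. co Y b p * D X (E b) p f)"
    by (simp add: sum_distrib_left h_def E_def algebra_simps flip: sum.distrib)
  also have "(\<Sum>b\<in>Basis. co Y b p * coord_vec M (U, c) p b f) = Y p f"
    unfolding co_def by (rule tangent_expand[OF vector_fields_tangent[OF Y p] Uc, symmetric])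
  \<comment> \<open>Differentiating the square of \<rho> on the left gives two copies of
    \<open>X p \<rho>\<close>, and the coefficients \<open>h Y b\<close> on the right give one. The
    difference is the logarithmic derivative in the claim.\<close>
  finally have "\<rho> p * (\<rho> p * D X Y p f) = \<rho> p * (\<rho> p * (\<Sum>b\<in>Basis. X p (co Y b) * coord_vec M (U, c) p b f)
      - X p \<rho> * Y p f + (\<Sum>b\<in>Basis. co Y b p * D X (E b) p f))"
    by (simp add: algebra_simps)
  then have "\<rho> p * D X Y p f = \<rho> p * (\<Sum>b\<in>Basis. X p (co Y b) * coord_vec M (U, c) p b f)
      - X p \<rho> * Y p f + (\<Sum>b\<in>Basis. co Y b p * D X (E b) p f)"
    unfolding mult_cancel_left using \<rho>(2) by blast
  then have "D X Y p f = (\<Sum>b\<in>Basis. X p (co Y b) * coord_vec M (U, c) p b f)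
      - X p \<rho> / \<rho> p * Y p f + (\<Sum>b\<in>Basis. co Y b p * D X (E b) p f) / \<rho> p"
    using \<rho>(2) by (simp add: field_simps)
  also have "(\<Sum>b\<in>Basis. co Y b p * D X (E b) p f) / \<rho> p
      = (\<Sum>b\<in>Basis. \<Sum>b'\<in>Basis. co X b' p * co Y b p / (\<rho> p * \<rho> p) * D (E b') (E b) p f)"
    unfolding DE by (simp add: sum_divide_distrib sum_distrib_left mult_ac)
  finally show ?thesis by (simp add: co_def[abs_def])
qed

end

section \<open>Products of manifolds\<close>

lemma second_countable_prod_topology:
  assumes "second_countable X" "second_countable Y"
  shows "second_countable (prod_topology X Y)"
proof -
  obtain A where A: "countable A" "\<And>V. V \<in> A \<Longrightarrow> openin X V"
    "\<And>U x. openin X U \<Longrightarrow> x \<in> U \<Longrightarrow> \<exists>V\<in>A. x \<in> V \<and> V \<subseteq> U"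
    using assms(1) unfolding second_countable_def by metis
  obtain B where B: "countable B" "\<And>V. V \<in> B \<Longrightarrow> openin Y V"
    "\<And>U x. openin Y U \<Longrightarrow> x \<in> U \<Longrightarrow> \<exists>V\<in>B. x \<in> V \<and> V \<subseteq> U"
    using assms(2) unfolding second_countable_def by metis
  show ?thesis
    unfolding second_countable_def
  proof (intro exI conjI allI impI)
    show "countable ((\<lambda>(U, V). U \<times> V) ` (A \<times> B))" using A(1) B(1) by blast
    show "\<forall>V\<in>(\<lambda>(U, V). U \<times> V) ` (A \<times> B). openin (prod_topology X Y) V"
      using A(2) B(2) by (auto simp: openin_prod_Times_iff)
    fix W z assume "openin (prod_topology X Y) W \<and> z \<in> W"
    then obtain U V where UV: "openin X U" "openin Y V" "fst z \<in> U" "snd z \<in> V" "U \<times> V \<subseteq> W"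
      unfolding openin_prod_topology_alt by (metis prod.collapse)
    obtain U' V' where "U' \<in> A" "fst z \<in> U'" "U' \<subseteq> U" "V' \<in> B" "snd z \<in> V'" "V' \<subseteq> V"
      using A(3)[OF UV(1,3)] B(3)[OF UV(2,4)] by blast
    then show "\<exists>V\<in>(\<lambda>(U, V). U \<times> V) ` (A \<times> B). z \<in> V \<and> V \<subseteq> W"
      using UV(5) by (intro bexI[of _ "U' \<times> V'"]) (auto simp: mem_Times_iff)
  qed
qed

lemma inv_into_map_prod:
  assumes "inj_on c U" "inj_on d V" "a \<in> c ` U" "b \<in> d ` V"
  shows "inv_into (U \<times> V) (map_prod c d) (a, b) = (inv_into U c a, inv_into V d b)"
proof -
  have "inj_on (map_prod c d) (U \<times> V)" using assms by (intro map_prod_inj_on)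
  moreover have "(inv_into U c a, inv_into V d b) \<in> U \<times> V"
    using assms by (auto intro: inv_into_into)
  ultimately show ?thesis
    using assms by (intro inv_into_f_eq) (auto simp: f_inv_into_f)
qed

locale prod_mfd = M: mfd M + N: mfd N
  for M :: "('a, 'b::euclidean_space) manifold" and N :: "('c, 'd::euclidean_space) manifold"
begin

abbreviation "P \<equiv> prod_manifold M N"

lemma mtop_P: "mtop P = prod_topology (mtop M) (mtop N)"
  by (simp add: prod_manifold_def)

lemma points_P [simp]: "points P = points M \<times> points N"
  by (simp add: mtop_P)

lemma atlas_P: "\<kappa> \<in> atlas P \<longleftrightarrow> (\<exists>U c V d. \<kappa> = (U \<times> V, map_prod c d) \<and> (U, c) \<in> atlas M \<and> (V, d) \<in> atlas N)"
  by (auto simp: prod_manifold_def)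

lemma atlas_PI: "(U, c) \<in> atlas M \<Longrightarrow> (V, d) \<in> atlas N \<Longrightarrow> (U \<times> V, map_prod c d) \<in> atlas P"
  by (auto simp: atlas_P)

lemma inv_chart:
  assumes "(U, c) \<in> atlas M" "(V, d) \<in> atlas N" "a \<in> c ` U" "b \<in> d ` V"
  shows "inv_into (U \<times> V) (map_prod c d) (a, b) = (inv_into U c a, inv_into V d b)"
  using inv_into_map_prod M.chart_inj N.chart_inj assms by metis

lemma smooth_at_prod:
  assumes "smooth_at x f" "smooth_at y g"
  shows "smooth_at (x, y) (\<lambda>z. (f (fst z), g (snd z)))"
proof -
  have "smooth_at (x, y) (f \<circ> fst)" "smooth_at (x, y) (g \<circ> snd)"
    using assms smooth_at_compose[OF smooth_at_bounded_linear[OF bounded_linear_fst], of "(x, y)" f]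
      smooth_at_compose[OF smooth_at_bounded_linear[OF bounded_linear_snd], of "(x, y)" g] by auto
  from smooth_at_Pair[OF this] show ?thesis by simp
qed

lemma smooth_manifold_P: "smooth_manifold P"
  unfolding smooth_manifold_def
proof (intro conjI)
  have ne: "points M \<noteq> {}" "points N \<noteq> {}"
    using M.smooth_mfd N.smooth_mfd by (auto simp: smooth_manifold_def)
  then show "points P \<noteq> {}" by simp
  show "Hausdorff_space (mtop P)" "second_countable (mtop P)"
    using M.smooth_mfd N.smooth_mfd
    by (auto simp: mtop_P smooth_manifold_def Hausdorff_space_prod_topology intro: second_countable_prod_topology)
  have "\<exists>(W, e)\<in>atlas P. z \<in> W" if z: "z \<in> points P" for z
  proof -
    have zM: "fst z \<in> points M" and zN: "snd z \<in> points N" using z by auto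
    obtain U c where "(U, c) \<in> atlas M" "fst z \<in> U" using zM by (rule M.chart_at)
    moreover obtain V d where "(V, d) \<in> atlas N" "snd z \<in> V" using zN by (rule N.chart_at)
    ultimately show ?thesis by (intro bexI[OF _ atlas_PI]) (auto simp: mem_Times_iff)
  qed
  moreover have "W \<subseteq> points P" if "(W, e) \<in> atlas P" for W e
    using that M.chart_subset N.chart_subset by (fastforce simp: atlas_P)
  ultimately show "(\<Union>(W, e)\<in>atlas P. W) = points P" by fastforce
  show "\<forall>(W, e)\<in>atlas P. is_chart (mtop P) W e"
  proof safe
    fix W e assume "(W, e) \<in> atlas P"
    then obtain U c V d where W: "W = U \<times> V" "e = map_prod c d" and
      Uc: "(U, c) \<in> atlas M" and Vd: "(V, d) \<in> atlas N" by (auto simp: atlas_P)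
    have im: "e ` W = c ` U \<times> d ` V" unfolding W by (rule map_prod_surj_on) auto
    obtain c' d' where "homeomorphic_maps (subtopology (mtop M) U) (top_of_set (c ` U)) c c'"
      "homeomorphic_maps (subtopology (mtop N) V) (top_of_set (d ` V)) d d'"
      using M.chart_homeo[OF Uc] N.chart_homeo[OF Vd] unfolding homeomorphic_map_maps by auto
    then have "homeomorphic_maps (prod_topology (subtopology (mtop M) U) (subtopology (mtop N) V))
        (prod_topology (top_of_set (c ` U)) (top_of_set (d ` V))) (\<lambda>(x, y). (c x, d y)) (\<lambda>(x, y). (c' x, d' y))"
      unfolding homeomorphic_maps_prod by blast
    then have "homeomorphic_map (subtopology (mtop P) W) (top_of_set (e ` W)) e"
      unfolding im homeomorphic_map_maps by (auto simp: W mtop_P subtopology_Times map_prod_def)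
    then show "is_chart (mtop P) W e"
      unfolding is_chart_def im using M.chart_open[OF Uc] N.chart_open[OF Vd]
        M.chart_image_open[OF Uc] N.chart_image_open[OF Vd]
      by (auto simp: W mtop_P openin_prod_Times_iff open_Times)
  qed
  show "\<forall>(W, e)\<in>atlas P. \<forall>(W', e')\<in>atlas P. smooth_on (e ` (W \<inter> W')) (e' \<circ> inv_into W e)"
  proof safe
    fix W e W' e' assume "(W, e) \<in> atlas P" "(W', e') \<in> atlas P"
    then obtain U c V d U' c' V' d' where W: "W = U \<times> V" "e = map_prod c d" "W' = U' \<times> V'" "e' = map_prod c' d'" and
      ch: "(U, c) \<in> atlas M" "(V, d) \<in> atlas N" "(U', c') \<in> atlas M" "(V', d') \<in> atlas N"
      unfolding atlas_P by auto
    have im: "e ` (W \<inter> W') = c ` (U \<inter> U') \<times> d ` (V \<inter> V')"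
      unfolding W Times_Int_Times by (rule map_prod_surj_on) auto
    have op: "open (c ` (U \<inter> U'))" "open (d ` (V \<inter> V'))"
      using ch by (auto intro: M.chart_image_openin N.chart_image_openin M.chart_open N.chart_open)
    show "smooth_on (e ` (W \<inter> W')) (e' \<circ> inv_into W e)"
      unfolding im smooth_on_iff_smooth_at[OF open_Times[OF op]]
    proof safe
      fix x y assume "x \<in> U" "x \<in> U'" "y \<in> V" "y \<in> V'"
      then have x: "c x \<in> c ` (U \<inter> U')" and y: "d y \<in> d ` (V \<inter> V')" by auto
      have "smooth_at (c x) (c' \<circ> inv_into U c)" "smooth_at (d y) (d' \<circ> inv_into V d)"
        using M.chart_transition[OF ch(1,3)] N.chart_transition[OF ch(2,4)] x y op
        by (auto simp: smooth_on_iff_smooth_at)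
      note S = smooth_at_prod[OF this]
      have "eventually (\<lambda>z. z \<in> c ` (U \<inter> U') \<times> d ` (V \<inter> V')) (nhds (c x, d y))"
        using op x y by (intro eventually_nhds_in_open open_Times) auto
      then have "eventually (\<lambda>z. ((c' \<circ> inv_into U c) (fst z), (d' \<circ> inv_into V d) (snd z)) = (e' \<circ> inv_into W e) z)
          (nhds (c x, d y))"
        by eventually_elim (auto simp: W inv_chart[OF ch(1,2)])
      then show "smooth_at (c x, d y) (e' \<circ> inv_into W e)" by (rule smooth_at_cong[OF _ S])
    qed
  qed
qed

end

sublocale prod_mfd \<subseteq> P: mfd "prod_manifold M N"
  by unfold_locales (rule smooth_manifold_P)

sublocale prod_mfd \<subseteq> PM: mfd2 "prod_manifold M N" M by unfold_locales
sublocale prod_mfd \<subseteq> PN: mfd2 "prod_manifold M N" N by unfold_locales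
sublocale prod_mfd \<subseteq> NM: mfd2 N M by unfold_locales

context prod_mfd
begin

section \<open>Projections and slices of the product\<close>

lemma eventually_nhdsin_fst: "z \<in> points P \<Longrightarrow> eventually Q (nhdsin (mtop M) (fst z)) \<Longrightarrow> eventually (\<lambda>x. Q (fst x)) (nhdsin (mtop P) z)"
proof -
  assume z: "z \<in> points P" and "eventually Q (nhdsin (mtop M) (fst z))"
  then obtain W where "openin (mtop M) W" "fst z \<in> W" "\<And>x. x \<in> W \<Longrightarrow> Q x"
    by (auto simp: eventually_nhdsin)
  then show ?thesis
    using z unfolding eventually_nhdsin
    by (intro disjI2 exI[of _ "W \<times> points N"]) (auto simp: mtop_P openin_prod_Times_iff)
qed

lemma eventually_nhdsin_snd: "z \<in> points P \<Longrightarrow> eventually Q (nhdsin (mtop N) (snd z)) \<Longrightarrow> eventually (\<lambda>x. Q (snd x)) (nhdsin (mtop P) z)"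
proof -
  assume z: "z \<in> points P" and "eventually Q (nhdsin (mtop N) (snd z))"
  then obtain W where "openin (mtop N) W" "snd z \<in> W" "\<And>x. x \<in> W \<Longrightarrow> Q x"
    by (auto simp: eventually_nhdsin)
  then show ?thesis
    using z unfolding eventually_nhdsin
    by (intro disjI2 exI[of _ "points M \<times> W"]) (auto simp: mtop_P openin_prod_Times_iff)
qed

lemma eventually_nhdsin_slice:
  assumes "(p, q) \<in> points P" "eventually Q (nhdsin (mtop P) (p, q))"
  shows "eventually (\<lambda>x. Q (x, q)) (nhdsin (mtop M) p)" "eventually (\<lambda>y. Q (p, y)) (nhdsin (mtop N) q)"
proof -
  obtain W where W: "openin (mtop P) W" "(p, q) \<in> W" "\<And>x. x \<in> W \<Longrightarrow> Q x"
    using assms by (auto simp: eventually_nhdsin)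
  obtain A B where AB: "openin (mtop M) A" "openin (mtop N) B" "p \<in> A" "q \<in> B" "A \<times> B \<subseteq> W"
    using W(1)[unfolded mtop_P openin_prod_topology_alt, rule_format, OF W(2)] by auto
  have "eventually (\<lambda>x. x \<in> A) (nhdsin (mtop M) p)" "eventually (\<lambda>y. y \<in> B) (nhdsin (mtop N) q)"
    using AB by (auto intro: eventually_nhdsin_openin)
  then show "eventually (\<lambda>x. Q (x, q)) (nhdsin (mtop M) p)" "eventually (\<lambda>y. Q (p, y)) (nhdsin (mtop N) q)"
    using AB W by (auto elim!: eventually_mono)
qed

lemma charts_at:
  assumes "(p, q) \<in> points P"
  obtains U c V d where "(U, c) \<in> atlas M" "p \<in> U" "(V, d) \<in> atlas N" "q \<in> V"
    "(U \<times> V, map_prod c d) \<in> atlas P" "(p, q) \<in> U \<times> V"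
proof -
  have p: "p \<in> points M" and q: "q \<in> points N" using assms by auto
  obtain U c where "(U, c) \<in> atlas M" "p \<in> U" using p by (rule M.chart_at)
  moreover obtain V d where "(V, d) \<in> atlas N" "q \<in> V" using q by (rule N.chart_at)
  ultimately show thesis using that atlas_PI by blast
qed

lemma smooth_map_at_fst:
  assumes "z \<in> points P"
  shows "smooth_map_at P M fst z"
  unfolding smooth_map_at_def filterlim_iff
proof (intro conjI allI impI ballI eventually_nhdsin_fst assms)
  obtain p q where z: "z = (p, q)" by (cases z)
  obtain U c V d where ch: "(U, c) \<in> atlas M" "p \<in> U" "(V, d) \<in> atlas N" "q \<in> V"
    "(U \<times> V, map_prod c d) \<in> atlas P" "(p, q) \<in> U \<times> V"
    using assms unfolding z by (rule charts_at)
  fix f assume f: "f \<in> smooth_near M (fst z)"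
  have "smooth_at (c p, d q) ((f \<circ> inv_into U c) \<circ> fst)"
    using f ch unfolding z by (intro smooth_at_compose smooth_at_bounded_linear[OF bounded_linear_fst]) (simp add: M.smooth_near_iff)
  moreover have "eventually (\<lambda>x. x \<in> c ` U \<times> d ` V) (nhds (c p, d q))"
    using ch M.chart_image_open N.chart_image_open by (intro eventually_nhds_in_open open_Times) auto
  then have "eventually (\<lambda>x. ((f \<circ> inv_into U c) \<circ> fst) x = ((\<lambda>x. f (fst x)) \<circ> inv_into (U \<times> V) (map_prod c d)) x) (nhds (c p, d q))"
    by eventually_elim (auto simp: inv_chart[OF ch(1,3)])
  ultimately have "smooth_at (c p, d q) ((\<lambda>x. f (fst x)) \<circ> inv_into (U \<times> V) (map_prod c d))"
    by (rule smooth_at_cong[rotated])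
  then show "(\<lambda>x. f (fst x)) \<in> smooth_near P z"
    unfolding z P.smooth_near_iff[OF ch(5,6)] by simp
qed

lemma smooth_map_at_snd:
  assumes "z \<in> points P"
  shows "smooth_map_at P N snd z"
  unfolding smooth_map_at_def filterlim_iff
proof (intro conjI allI impI ballI eventually_nhdsin_snd assms)
  obtain p q where z: "z = (p, q)" by (cases z)
  obtain U c V d where ch: "(U, c) \<in> atlas M" "p \<in> U" "(V, d) \<in> atlas N" "q \<in> V"
    "(U \<times> V, map_prod c d) \<in> atlas P" "(p, q) \<in> U \<times> V"
    using assms unfolding z by (rule charts_at)
  fix f assume f: "f \<in> smooth_near N (snd z)"
  have "smooth_at (c p, d q) ((f \<circ> inv_into V d) \<circ> snd)"
    using f ch unfolding z by (intro smooth_at_compose smooth_at_bounded_linear[OF bounded_linear_snd]) (simp add: N.smooth_near_iff)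
  moreover have "eventually (\<lambda>x. x \<in> c ` U \<times> d ` V) (nhds (c p, d q))"
    using ch M.chart_image_open N.chart_image_open by (intro eventually_nhds_in_open open_Times) auto
  then have "eventually (\<lambda>x. ((f \<circ> inv_into V d) \<circ> snd) x = ((\<lambda>x. f (snd x)) \<circ> inv_into (U \<times> V) (map_prod c d)) x) (nhds (c p, d q))"
    by eventually_elim (auto simp: inv_chart[OF ch(1,3)])
  ultimately have "smooth_at (c p, d q) ((\<lambda>x. f (snd x)) \<circ> inv_into (U \<times> V) (map_prod c d))"
    by (rule smooth_at_cong[rotated])
  then show "(\<lambda>x. f (snd x)) \<in> smooth_near P z"
    unfolding z P.smooth_near_iff[OF ch(5,6)] by simp
qed

lemma slice_rep:
  assumes "(U, c) \<in> atlas M" "(V, d) \<in> atlas N" "p \<in> U" "q \<in> V"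
  shows "eventually (\<lambda>s. (F \<circ> inv_into (U \<times> V) (map_prod c d)) (s, d q) = ((\<lambda>x. F (x, q)) \<circ> inv_into U c) s) (nhds (c p))"
    and "eventually (\<lambda>s. (F \<circ> inv_into (U \<times> V) (map_prod c d)) (c p, s) = ((\<lambda>y. F (p, y)) \<circ> inv_into V d) s) (nhds (d q))"
proof -
  have "eventually (\<lambda>s. s \<in> c ` U) (nhds (c p))" "eventually (\<lambda>s. s \<in> d ` V) (nhds (d q))"
    using assms M.chart_image_open N.chart_image_open by (auto intro!: eventually_nhds_in_open)
  moreover have "inv_into U c (c p) = p" "inv_into V d (d q) = q"
    using assms M.chart_inj N.chart_inj by auto
  ultimately show "eventually (\<lambda>s. (F \<circ> inv_into (U \<times> V) (map_prod c d)) (s, d q) = ((\<lambda>x. F (x, q)) \<circ> inv_into U c) s) (nhds (c p))"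
    and "eventually (\<lambda>s. (F \<circ> inv_into (U \<times> V) (map_prod c d)) (c p, s) = ((\<lambda>y. F (p, y)) \<circ> inv_into V d) s) (nhds (d q))"
    using assms by (auto elim!: eventually_mono simp: inv_chart[OF assms(1,2)])
qed

lemma smooth_near_slice:
  assumes "F \<in> smooth_near P (p, q)"
  shows "(\<lambda>x. F (x, q)) \<in> smooth_near M p" "(\<lambda>y. F (p, y)) \<in> smooth_near N q"
proof -
  have "(p, q) \<in> points P" by (rule P.smooth_near_points[OF assms])
  then obtain U c V d where ch: "(U, c) \<in> atlas M" "p \<in> U" "(V, d) \<in> atlas N" "q \<in> V"
    "(U \<times> V, map_prod c d) \<in> atlas P" "(p, q) \<in> U \<times> V"
    by (rule charts_at)
  let ?G = "F \<circ> inv_into (U \<times> V) (map_prod c d)"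
  have G: "smooth_at (c p, d q) ?G"
    using assms unfolding P.smooth_near_iff[OF ch(5,6)] by simp
  have "smooth_at (c p) (?G \<circ> (\<lambda>s. (s, d q)))" "smooth_at (d q) (?G \<circ> (\<lambda>s. (c p, s)))"
    using G by (intro smooth_at_compose smooth_at_Pair smooth_at_const smooth_at_bounded_linear[OF bounded_linear_ident]; simp)+
  then show "(\<lambda>x. F (x, q)) \<in> smooth_near M p" "(\<lambda>y. F (p, y)) \<in> smooth_near N q"
    unfolding M.smooth_near_iff[OF ch(1,2)] N.smooth_near_iff[OF ch(3,4)]
    using slice_rep[OF ch(1,3,2,4), of F] by (auto simp: o_def elim!: smooth_at_cong[rotated])
qed

text \<open>Both directions matter: \<open>tan_fst\<close> of a tangent vector must vanish on every
  function that is not smooth near \<open>p\<close>, as the encoding of tangent vectors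
  requires.\<close>

lemma smooth_near_fst_iff:
  assumes "(p, q) \<in> points P"
  shows "f \<circ> fst \<in> smooth_near P (p, q) \<longleftrightarrow> f \<in> smooth_near M p"
  using smooth_near_slice(1)[of "f \<circ> fst" p q] PM.smooth_near_along[OF smooth_map_at_fst[OF assms], of f]
  by (auto simp: o_def)

lemma smooth_near_snd_iff:
  assumes "(p, q) \<in> points P"
  shows "f \<circ> snd \<in> smooth_near P (p, q) \<longleftrightarrow> f \<in> smooth_near N q"
  using smooth_near_slice(2)[of "f \<circ> snd" p q] PN.smooth_near_along[OF smooth_map_at_snd[OF assms], of f]
  by (auto simp: o_def)

text \<open>The derivative in direction \<open>(a, b)\<close> is the sum of the two partial
  derivatives, and freezing one variable of the product representative gives the representative of
  the slice.\<close>

lemma coord_vec_prod: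
  assumes "(U, c) \<in> atlas M" "p \<in> U" "(V, d) \<in> atlas N" "q \<in> V"
  shows "coord_vec P (U \<times> V, map_prod c d) (p, q) (a, b) =
    tan_pair M N (p, q) (coord_vec M (U, c) p a) (coord_vec N (V, d) q b)"
proof
  fix F :: "'a \<times> 'c \<Rightarrow> real"
  let ?G = "F \<circ> inv_into (U \<times> V) (map_prod c d)"
  show "coord_vec P (U \<times> V, map_prod c d) (p, q) (a, b) F =
    tan_pair M N (p, q) (coord_vec M (U, c) p a) (coord_vec N (V, d) q b) F"
  proof (cases "F \<in> smooth_near P (p, q)")
    case True
    have "smooth_at (c p, d q) ?G"
      using True P.smooth_near_iff[OF atlas_PI[OF assms(1,3)], of "(p, q)"] assms by simp
    then have G: "(?G has_derivative frechet_derivative ?G (at (c p, d q))) (at (c p, d q))"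
      using smooth_at_differentiable frechet_derivative_works by blast
    let ?G' = "frechet_derivative ?G (at (c p, d q))"
    have "((\<lambda>s. (s, d q)) has_derivative (\<lambda>v. (v, 0))) (at (c p))" "((\<lambda>s. (c p, s)) has_derivative (\<lambda>v. (0, v))) (at (d q))"
      by (auto intro!: derivative_eq_intros)
    from diff_chain_at[OF this(1) G] diff_chain_at[OF this(2) G]
    have "?G' (a, 0) = frechet_derivative (?G \<circ> (\<lambda>s. (s, d q))) (at (c p)) a"
      "?G' (0, b) = frechet_derivative (?G \<circ> (\<lambda>s. (c p, s))) (at (d q)) b"
      by (auto dest!: frechet_derivative_at fun_cong simp: o_def)
    moreover have "?G' (a, b) = ?G' (a, 0) + ?G' (0, b)"
      using linear_add[OF has_derivative_linear[OF G], of "(a, 0)" "(0, b)"] by simp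
    moreover have "frechet_derivative (?G \<circ> (\<lambda>s. (s, d q))) (at (c p)) = frechet_derivative ((\<lambda>x. F (x, q)) \<circ> inv_into U c) (at (c p))"
      "frechet_derivative (?G \<circ> (\<lambda>s. (c p, s))) (at (d q)) = frechet_derivative ((\<lambda>y. F (p, y)) \<circ> inv_into V d) (at (d q))"
      using slice_rep[OF assms(1,3,2,4), of F] by (auto intro!: frechet_derivative_cong_ev)
    ultimately show ?thesis
      using True smooth_near_slice[OF True]
      by (simp add: tan_pair_def P.coord_vec_apply M.coord_vec_apply N.coord_vec_apply)
  qed (simp add: tan_pair_def P.coord_vec_not_smooth)
qed

section \<open>Tangent spaces and vector fields of the product\<close>

lemma tan_pair_tangent:
  assumes "u \<in> tangent_space M (fst z)" "v \<in> tangent_space N (snd z)"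
  shows "tan_pair M N z u v \<in> tangent_space P z"
proof -
  obtain p q where z: "z = (p, q)" by (cases z)
  have "(p, q) \<in> points P" using assms M.tangent_points N.tangent_points by (auto simp: z)
  then obtain U c V d where ch: "(U, c) \<in> atlas M" "p \<in> U" "(V, d) \<in> atlas N" "q \<in> V"
    "(U \<times> V, map_prod c d) \<in> atlas P" "(p, q) \<in> U \<times> V"
    by (rule charts_at)
  obtain a where a: "u = coord_vec M (U, c) p a" using assms(1) ch(1,2) unfolding z by (auto elim: M.tangentE)
  obtain b where b: "v = coord_vec N (V, d) q b" using assms(2) ch(3,4) unfolding z by (auto elim: N.tangentE)
  show ?thesis
    unfolding z a b coord_vec_prod[OF ch(1-4), symmetric] by (rule P.coord_vec_tangent[OF ch(5,6)])
qed

text \<open>A function pulled back from \<open>M\<close> is constant in the second variable, and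
  \<open>v\<close> vanishes on constants.\<close>

lemma tan_fst_pair:
  assumes "u \<in> tangent_space M (fst z)" "v \<in> tangent_space N (snd z)"
  shows "tan_fst (tan_pair M N z u v) = u"
proof
  fix f
  have z: "(fst z, snd z) \<in> points P" using M.tangent_points[OF assms(1)] N.tangent_points[OF assms(2)] by (simp add: mem_Times_iff)
  show "tan_fst (tan_pair M N z u v) f = u f"
    using smooth_near_fst_iff[OF z, of f] M.tangent_not_smooth[OF assms(1)] N.tangent_const[OF assms(2)]
    by (auto simp: tan_fst_def tan_pair_def)
qed

lemma tan_snd_pair:
  assumes "u \<in> tangent_space M (fst z)" "v \<in> tangent_space N (snd z)"
  shows "tan_snd (tan_pair M N z u v) = v"
proof
  fix f
  have z: "(fst z, snd z) \<in> points P" using M.tangent_points[OF assms(1)] N.tangent_points[OF assms(2)] by (simp add: mem_Times_iff)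
  show "tan_snd (tan_pair M N z u v) f = v f"
    using smooth_near_snd_iff[OF z, of f] N.tangent_not_smooth[OF assms(2)] M.tangent_const[OF assms(1)]
    by (auto simp: tan_snd_def tan_pair_def)
qed

lemma tangent_P_cases:
  assumes "w \<in> tangent_space P z"
  obtains u v where "u \<in> tangent_space M (fst z)" "v \<in> tangent_space N (snd z)" "w = tan_pair M N z u v"
proof -
  obtain p q where z: "z = (p, q)" by (cases z)
  have "(p, q) \<in> points P" using P.tangent_points[OF assms] by (simp add: z)
  then obtain U c V d where ch: "(U, c) \<in> atlas M" "p \<in> U" "(V, d) \<in> atlas N" "q \<in> V"
    "(U \<times> V, map_prod c d) \<in> atlas P" "(p, q) \<in> U \<times> V"
    by (rule charts_at)
  obtain ab where "w = coord_vec P (U \<times> V, map_prod c d) (p, q) ab"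
    using assms ch(5,6) unfolding z by (rule P.tangentE)
  then show thesis
    using that[of "coord_vec M (U, c) p (fst ab)" "coord_vec N (V, d) q (snd ab)"]
      M.coord_vec_tangent[OF ch(1,2)] N.coord_vec_tangent[OF ch(3,4)]
    by (simp add: z coord_vec_prod[OF ch(1-4), symmetric])
qed

lemma tan_fst_tangent: "w \<in> tangent_space P z \<Longrightarrow> tan_fst w \<in> tangent_space M (fst z)"
  by (elim tangent_P_cases) (simp add: tan_fst_pair)

lemma tan_snd_tangent: "w \<in> tangent_space P z \<Longrightarrow> tan_snd w \<in> tangent_space N (snd z)"
  by (elim tangent_P_cases) (simp add: tan_snd_pair)

lemma tan_pair_fst_snd: "w \<in> tangent_space P z \<Longrightarrow> tan_pair M N z (tan_fst w) (tan_snd w) = w"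
  by (elim tangent_P_cases) (simp add: tan_snd_pair tan_fst_pair)

lemma tangent_P_apply:
  assumes "w \<in> tangent_space P (p, q)" "F \<in> smooth_near P (p, q)"
  shows "w F = tan_fst w (\<lambda>x. F (x, q)) + tan_snd w (\<lambda>y. F (p, y))"
proof -
  have "w F = tan_pair M N (p, q) (tan_fst w) (tan_snd w) F" by (simp add: tan_pair_fst_snd[OF assms(1)])
  then show ?thesis using assms(2) by (simp add: tan_pair_def)
qed

lemma tan_fst_lincomb: "tan_fst (\<lambda>f. a * u f + b * v f) = (\<lambda>f. a * tan_fst u f + b * tan_fst v f)"
  by (simp add: tan_fst_def)

lemma smooth_along_tan_fst:
  assumes "smooth_field P z X" "z \<in> points P"
  shows "smooth_along P M fst z (\<lambda>x. tan_fst (X x))"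
  unfolding smooth_along_def
proof
  show "eventually (\<lambda>x. tan_fst (X x) \<in> tangent_space M (fst x)) (nhdsin (mtop P) z)"
    using assms(1)[unfolded smooth_along_def, THEN conjunct1] by eventually_elim (rule tan_fst_tangent)
  show "\<forall>f\<in>smooth_near M (fst z). (\<lambda>x. tan_fst (X x) f) \<in> smooth_near P z"
    using smooth_alongD[OF assms(1)] PM.smooth_near_along[OF smooth_map_at_fst[OF assms(2)]]
    by (simp add: tan_fst_def o_def)
qed

lemma smooth_along_slice:
  assumes "smooth_along P M fst (p, q) X" "(p, q) \<in> points P"
  shows "smooth_field M p (\<lambda>x. X (x, q))" "smooth_along N M (\<lambda>_. p) q (\<lambda>y. X (p, y))"
  using assms(1) eventually_nhdsin_slice[OF assms(2) assms(1)[unfolded smooth_along_def, THEN conjunct1]]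
  by (auto simp: smooth_along_def intro: smooth_near_slice)

text \<open>A coordinate function of a product chart is a sum of one coordinate from each factor,
  and each component of the pair vanishes on the summand that is constant for it.\<close>

lemma smooth_field_tan_pairI:
  assumes z: "z \<in> points P" and X: "smooth_along P M fst z X" and Y: "smooth_along P N snd z Y"
  shows "smooth_field P z (\<lambda>x. tan_pair M N x (X x) (Y x))"
proof -
  obtain p q where zpq: "z = (p, q)" by (cases z)
  obtain U c V d where ch: "(U, c) \<in> atlas M" "p \<in> U" "(V, d) \<in> atlas N" "q \<in> V"
    "(U \<times> V, map_prod c d) \<in> atlas P" "(p, q) \<in> U \<times> V"
    using z unfolding zpq by (rule charts_at)
  have T: "eventually (\<lambda>x. X x \<in> tangent_space M (fst x) \<and> Y x \<in> tangent_space N (snd x)) (nhdsin (mtop P) z)"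
    using X Y by (simp add: smooth_along_def eventually_conj_iff)
  have zin: "z \<in> U \<times> V" using ch(6) zpq by simp
  show ?thesis
  proof (rule P.self.smooth_alongI[OF smooth_map_at_id z ch(5) zin])
    show "eventually (\<lambda>x. tan_pair M N x (X x) (Y x) \<in> tangent_space P x) (nhdsin (mtop P) z)"
      using T by eventually_elim (auto intro: tan_pair_tangent)
    fix b :: "'b \<times> 'd"
    have "(\<lambda>x. X x (\<lambda>q. c q \<bullet> fst b) + Y x (\<lambda>q. d q \<bullet> snd b)) \<in> smooth_near P z"
      using ch(2,4) by (intro P.smooth_near_add smooth_alongD[OF X] smooth_alongD[OF Y]
          M.smooth_near_coord[OF ch(1)] N.smooth_near_coord[OF ch(3)]) (auto simp: zpq)
    moreover have "eventually (\<lambda>x. X x (\<lambda>q. c q \<bullet> fst b) + Y x (\<lambda>q. d q \<bullet> snd b)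
        = tan_pair M N x (X x) (Y x) (\<lambda>q. map_prod c d q \<bullet> b)) (nhdsin (mtop P) z)"
      using T P.eventually_chart[OF ch(5) zin]
    proof eventually_elim
      case (elim x)
      have XT: "X x \<in> tangent_space M (fst x)" and YT: "Y x \<in> tangent_space N (snd x)" using elim by auto
      have sm: "(\<lambda>q. map_prod c d q \<bullet> b) \<in> smooth_near P x"
        by (rule P.smooth_near_coord[OF ch(5) elim(2)])
      have m: "fst x \<in> U" "snd x \<in> V" using elim(2) by auto
      have "X x (\<lambda>q. c q \<bullet> fst b + d (snd x) \<bullet> snd b) = X x (\<lambda>q. c q \<bullet> fst b)"
        using M.tangent_add[OF XT M.smooth_near_coord[OF ch(1) m(1)] M.smooth_near_const[OF M.tangent_points[OF XT]]]
        by (simp add: M.tangent_const[OF XT])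
      moreover have "Y x (\<lambda>q. c (fst x) \<bullet> fst b + d q \<bullet> snd b) = Y x (\<lambda>q. d q \<bullet> snd b)"
        using N.tangent_add[OF YT N.smooth_near_const[OF N.tangent_points[OF YT]] N.smooth_near_coord[OF ch(3) m(2)]]
        by (simp add: N.tangent_const[OF YT])
      ultimately show ?case
        using sm by (simp add: tan_pair_def inner_prod_def)
    qed
    ultimately show "(\<lambda>x. tan_pair M N x (X x) (Y x) (\<lambda>q. map_prod c d q \<bullet> b)) \<in> smooth_near P z"
      by (rule P.smooth_near_cong[rotated])
  qed
qed

text \<open>Freezing the curve point yields global fields of \<open>M\<close>, the only arguments to
  which a connection of \<open>M\<close> can be applied.\<close>

lemma slice_vector_fields:
  assumes "X \<in> vector_fields P" "q \<in> points N"
  shows "(\<lambda>p. tan_fst (X (p, q))) \<in> vector_fields M"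
proof (rule M.vector_fieldsI)
  show "tan_fst (X (p, q)) = (\<lambda>f. 0)" if "p \<notin> points M" for p
    using P.vector_fields_outside[OF assms(1), of "(p, q)"] that by (simp add: tan_fst_def)
  fix p assume "p \<in> points M"
  then have z: "(p, q) \<in> points P" using assms(2) by simp
  show "smooth_field M p (\<lambda>p. tan_fst (X (p, q)))"
    by (rule smooth_along_slice(1)[OF smooth_along_tan_fst[OF P.vector_fields_smooth[OF assms(1) z] z] z])
qed

end

section \<open>Products with a one-dimensional manifold carrying a nowhere vanishing field\<close>

locale curve_prod = prod_mfd M N
  for M :: "('a, 'b::euclidean_space) manifold" and N :: "('c, real) manifold" +
  fixes T :: "'c \<Rightarrow> 'c tvec"
  assumes T_field: "T \<in> vector_fields N"
    and T_nonzero: "q \<in> points N \<Longrightarrow> T q \<noteq> (\<lambda>f. 0)"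
begin

lemma T_tangent: "q \<in> points N \<Longrightarrow> T q \<in> tangent_space N q"
  by (rule N.vector_fields_tangent[OF T_field])

text \<open>In a chart of a one-dimensional manifold every vector is its only component times the
  coordinate vector, written as \<open>1\<close> in the model space. The component of the nonzero
  vector \<open>T q\<close> is thus invertible, and the coefficient of \<open>v\<close> is the
  quotient of components.\<close>

lemma T_chart:
  assumes "(V, d) \<in> atlas N" "q \<in> V"
  shows "T q (\<lambda>y. d y \<bullet> 1) \<noteq> 0" "v \<in> tangent_space N q \<Longrightarrow> v = (\<lambda>f. v (\<lambda>y. d y \<bullet> 1) / T q (\<lambda>y. d y \<bullet> 1) * T q f)"
proof -
  have q: "q \<in> points N" by (rule N.chart_point[OF assms])
  have *: "v f = v (\<lambda>y. d y \<bullet> 1) * coord_vec N (V, d) q 1 f" if v: "v \<in> tangent_space N q" for v f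
    unfolding N.tangent_expand[OF v assms, of f] by simp
  show nz: "T q (\<lambda>y. d y \<bullet> 1) \<noteq> 0"
  proof
    assume "T q (\<lambda>y. d y \<bullet> 1) = 0"
    then have "T q f = 0" for f unfolding *[OF T_tangent[OF q], of f] by simp
    then show False using T_nonzero[OF q] by blast
  qed
  assume v: "v \<in> tangent_space N q"
  have "v f = v (\<lambda>y. d y \<bullet> 1) / T q (\<lambda>y. d y \<bullet> 1) * T q f" for f
    unfolding *[OF v, of f] *[OF T_tangent[OF q], of f] using nz by simp
  then show "v = (\<lambda>f. v (\<lambda>y. d y \<bullet> 1) / T q (\<lambda>y. d y \<bullet> 1) * T q f)" by blast
qed

text \<open>Resolves the definite description: some function has nonzero derivative along
  \<open>T\<close>, which fixes the coefficient.\<close>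

lemma curve_coeff_eqI:
  assumes "snd z \<in> points N" "tan_snd w = (\<lambda>f. h * T (snd z) f)"
  shows "curve_coeff T z w = h"
  unfolding curve_coeff_def
proof (rule the_equality)
  fix h' assume h': "tan_snd w = (\<lambda>f. h' * T (snd z) f)"
  obtain f where "T (snd z) f \<noteq> 0" using T_nonzero[OF assms(1)] by auto
  then show "h' = h" using fun_cong[OF h', of f] fun_cong[OF assms(2), of f] by simp
qed (rule assms(2))

lemma tan_snd_eq:
  assumes "w \<in> tangent_space P z"
  shows "tan_snd w = (\<lambda>f. curve_coeff T z w * T (snd z) f)"
proof -
  have v: "tan_snd w \<in> tangent_space N (snd z)" by (rule tan_snd_tangent[OF assms])
  note q = N.tangent_points[OF v]
  obtain V d where "(V, d) \<in> atlas N" "snd z \<in> V" using q by (rule N.chart_at)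
  from T_chart(2)[OF this v] obtain h where h: "tan_snd w = (\<lambda>f. h * T (snd z) f)" by blast
  with curve_coeff_eqI[OF q h] show ?thesis by simp
qed

lemma tangent_apply:
  assumes "w \<in> tangent_space P (p, q)" "F \<in> smooth_near P (p, q)"
  shows "w F = tan_fst w (\<lambda>x. F (x, q)) + curve_coeff T (p, q) w * T q (\<lambda>y. F (p, y))"
  using tangent_P_apply[OF assms] by (simp add: tan_snd_eq[OF assms(1)])

lemma curve_coeff_linear:
  assumes "z \<in> points P"
  shows "linear_at P z (curve_coeff T z)"
  unfolding linear_at_def
proof (intro ballI allI)
  fix u v a b assume u: "u \<in> tangent_space P z" and v: "v \<in> tangent_space P z"
  have "tan_snd (\<lambda>f. a * u f + b * v f) = (\<lambda>f. a * tan_snd u f + b * tan_snd v f)"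
    by (simp add: tan_snd_def)
  also have "\<dots> = (\<lambda>f. (a * curve_coeff T z u + b * curve_coeff T z v) * T (snd z) f)"
    by (simp add: tan_snd_eq[OF u] tan_snd_eq[OF v] distrib_right mult.assoc)
  finally show "curve_coeff T z (\<lambda>f. a * u f + b * v f) = a * curve_coeff T z u + b * curve_coeff T z v"
    using assms by (intro curve_coeff_eqI) auto
qed

text \<open>Near \<open>z\<close> the coefficient is a quotient of components in a chart of
  \<open>N\<close>, whose denominator is nonzero by \<open>T_chart\<close>.\<close>

lemma curve_coeff_smooth:
  assumes X: "smooth_field P z X" and z: "z \<in> points P"
  shows "(\<lambda>x. curve_coeff T x (X x)) \<in> smooth_near P z"
proof -
  have q: "snd z \<in> points N" using z by auto
  then obtain V d where Vd: "(V, d) \<in> atlas N" "snd z \<in> V" by (rule N.chart_at)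
  have 1: "(\<lambda>x. X x (\<lambda>y. d (snd y) \<bullet> 1)) \<in> smooth_near P z"
    by (intro smooth_alongD[OF X] PN.smooth_near_along[OF smooth_map_at_snd[OF z] N.smooth_near_coord[OF Vd]])
  have 2: "(\<lambda>x. T (snd x) (\<lambda>y. d y \<bullet> 1)) \<in> smooth_near P z"
    by (intro PN.smooth_near_along[OF smooth_map_at_snd[OF z]] N.vector_fields_apply_smooth[OF T_field] N.smooth_near_coord[OF Vd])
  have "(\<lambda>x. X x (\<lambda>y. d (snd y) \<bullet> 1) * inverse (T (snd x) (\<lambda>y. d y \<bullet> 1))) \<in> smooth_near P z"
    using T_chart(1)[OF Vd] by (intro P.smooth_near_mult P.smooth_near_inverse 1 2)
  moreover have "eventually (\<lambda>x. snd x \<in> V) (nhdsin (mtop P) z)"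
    by (rule PN.eventually_along[OF smooth_map_at_snd[OF z] N.eventually_chart[OF Vd]])
  then have "eventually (\<lambda>x. X x (\<lambda>y. d (snd y) \<bullet> 1) * inverse (T (snd x) (\<lambda>y. d y \<bullet> 1)) = curve_coeff T x (X x)) (nhdsin (mtop P) z)"
    using X[unfolded smooth_along_def, THEN conjunct1]
  proof eventually_elim
    case (elim x)
    then show ?case
      using fun_cong[OF tan_snd_eq[OF elim(2)], of "\<lambda>y. d y \<bullet> 1"] T_chart(1)[OF Vd(1) elim(1)]
      by (simp add: tan_snd_def o_def field_simps)
  qed
  ultimately show ?thesis by (rule P.smooth_near_cong[rotated])
qed

end

lemma (in mfd) tangent_eqI:
  assumes "u \<in> tangent_space M p" "v \<in> tangent_space M p" "\<And>f. f \<in> smooth_near M p \<Longrightarrow> u f = v f"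
  shows "u = v"
proof
  fix f show "u f = v f"
    using assms(3) tangent_not_smooth[OF assms(1)] tangent_not_smooth[OF assms(2)]
    by (cases "f \<in> smooth_near M p") auto
qed

section \<open>The almost contact metric structure\<close>

locale hermitian_curve_prod = curve_prod M N T
  for M :: "('a, 'b::euclidean_space) manifold" and N :: "('c, real) manifold" and T :: "'c \<Rightarrow> 'c tvec" +
  fixes J :: "'a \<Rightarrow> 'a tvec \<Rightarrow> 'a tvec" and g :: "'a \<Rightarrow> 'a tvec \<Rightarrow> 'a tvec \<Rightarrow> real"
    and \<omega> :: "'a \<Rightarrow> 'a tvec \<Rightarrow> real" and \<alpha> :: real
  assumes herm: "almost_hermitian M J g" and om: "one_form M \<omega>"
begin

abbreviation "\<phi> \<equiv> bar_phi M N J \<omega> T \<alpha>"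
abbreviation "\<xi> \<equiv> bar_xi M N T"
abbreviation "\<eta> \<equiv> bar_eta \<omega> T \<alpha>"
abbreviation "G \<equiv> bar_g g \<omega> T \<alpha>"

lemma J_endo: "endo_field M J" and g_riemannian: "riemannian_metric M g"
  and JJ: "u \<in> tangent_space M p \<Longrightarrow> J p (J p u) = (\<lambda>f. - u f)"
  and g_JJ: "u \<in> tangent_space M p \<Longrightarrow> v \<in> tangent_space M p \<Longrightarrow> g p (J p u) (J p v) = g p u v"
  using herm M.tangent_points unfolding almost_hermitian_def by blast+

lemma J_tangent: "u \<in> tangent_space M p \<Longrightarrow> J p u \<in> tangent_space M p"
  and J_linear: "p \<in> points M \<Longrightarrow> linear_at M p (\<lambda>u. J p u f)"
  using J_endo M.tangent_points unfolding endo_field_def by blast+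

lemma J_lincomb:
  assumes "u \<in> tangent_space M p" "v \<in> tangent_space M p"
  shows "J p (\<lambda>f. a * u f + b * v f) = (\<lambda>f. a * J p u f + b * J p v f)"
  using linear_at_lincomb[OF J_linear[OF M.tangent_points[OF assms(1)]] assms] by blast

lemma g_linear: "u \<in> tangent_space M p \<Longrightarrow> linear_at M p (g p u)"
  and g_sym: "u \<in> tangent_space M p \<Longrightarrow> v \<in> tangent_space M p \<Longrightarrow> g p u v = g p v u"
  and g_pos: "u \<in> tangent_space M p \<Longrightarrow> u \<noteq> (\<lambda>f. 0) \<Longrightarrow> g p u u > 0"
  using g_riemannian M.tangent_points unfolding riemannian_metric_def by blast+

lemma g_linear': "v \<in> tangent_space M p \<Longrightarrow> linear_at M p (\<lambda>u. g p u v)"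
  using g_linear[of v p] g_sym[of _ p v] M.tangent_lincomb[of _ p] unfolding linear_at_def by simp

text \<open>An isometry whose square is \<open>-1\<close> is skew-adjoint.\<close>

lemma g_J:
  assumes "u \<in> tangent_space M p" "v \<in> tangent_space M p"
  shows "g p (J p u) v = - g p u (J p v)"
proof -
  have "g p u (J p v) = g p (J p u) (\<lambda>f. - v f)"
    using g_JJ[OF assms(1) J_tangent[OF assms(2)]] JJ[OF assms(2)] by simp
  then show ?thesis
    using M.linear_at_uminus[OF g_linear[OF J_tangent[OF assms(1)]] assms(2)] by simp
qed

lemma \<omega>_linear: "p \<in> points M \<Longrightarrow> linear_at M p (\<omega> p)"
  using om unfolding one_form_def by blast

lemma \<eta>_linear:
  assumes z: "z \<in> points P"
  shows "linear_at P z (\<eta> z)"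
  unfolding linear_at_def
proof (intro ballI allI)
  fix u v a b assume u: "u \<in> tangent_space P z" and v: "v \<in> tangent_space P z"
  have p: "fst z \<in> points M" using z by auto
  show "\<eta> z (\<lambda>f. a * u f + b * v f) = a * \<eta> z u + b * \<eta> z v"
    using linear_at_lincomb[OF \<omega>_linear[OF p] tan_fst_tangent[OF u] tan_fst_tangent[OF v], of a b]
      linear_at_lincomb[OF curve_coeff_linear[OF z] u v, of a b]
    by (simp add: bar_eta_def tan_fst_lincomb algebra_simps)
qed

lemma \<eta>_smooth:
  assumes X: "smooth_field P z X" and z: "z \<in> points P"
  shows "(\<lambda>x. \<eta> x (X x)) \<in> smooth_near P z"
proof -
  have "fst z \<in> points M" using z by auto
  then have "(\<lambda>x. \<omega> (fst x) (tan_fst (X x))) \<in> smooth_near P z"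
    by (rule PM.one_form_along[OF om smooth_map_at_fst[OF z] z _ smooth_along_tan_fst[OF X z]])
  then show ?thesis
    unfolding bar_eta_def by (intro P.smooth_near_add P.smooth_near_cmult curve_coeff_smooth X z)
qed

text \<open>The coefficient of \<open>T\<close> is the one for which \<open>\<eta>\<close> takes the value \<open>r\<close>.\<close>

definition comb :: "'a \<times> 'c \<Rightarrow> 'a tvec \<Rightarrow> real \<Rightarrow> ('a \<times> 'c) tvec" where
  "comb z u r = tan_pair M N z u (\<lambda>f. (r - \<alpha> * \<omega> (fst z) u) * T (snd z) f)"

lemma
  assumes "u \<in> tangent_space M (fst z)" "z \<in> points P"
  shows comb_tangent: "comb z u r \<in> tangent_space P z"
    and tan_fst_comb: "tan_fst (comb z u r) = u"
    and \<eta>_comb: "\<eta> z (comb z u r) = r"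
proof -
  have q: "snd z \<in> points N" using assms(2) by auto
  then have t: "(\<lambda>f. (r - \<alpha> * \<omega> (fst z) u) * T (snd z) f) \<in> tangent_space N (snd z)"
    by (intro N.tangent_scale T_tangent)
  show "comb z u r \<in> tangent_space P z" unfolding comb_def using assms(1) t by (rule tan_pair_tangent)
  show 1: "tan_fst (comb z u r) = u" unfolding comb_def using assms(1) t by (rule tan_fst_pair)
  have "curve_coeff T z (comb z u r) = r - \<alpha> * \<omega> (fst z) u"
    using q by (rule curve_coeff_eqI) (simp add: comb_def tan_snd_pair[OF assms(1) t])
  then show "\<eta> z (comb z u r) = r" by (simp add: bar_eta_def 1)
qed

lemma comb_eta:
  assumes "w \<in> tangent_space P z"
  shows "comb z (tan_fst w) (\<eta> z w) = w"
  using tan_pair_fst_snd[OF assms] by (simp add: comb_def bar_eta_def tan_snd_eq[OF assms])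

text \<open>\<open>comb\<close> reassembles a vector from these two data. All later identities
  between tangent vectors of the product are checked on the projection and on \<eta>
  separately.\<close>

lemma tangent_ext:
  "w \<in> tangent_space P z \<Longrightarrow> w' \<in> tangent_space P z \<Longrightarrow> tan_fst w = tan_fst w' \<Longrightarrow> \<eta> z w = \<eta> z w' \<Longrightarrow> w = w'"
  using comb_eta by metis

lemma comb_lincomb:
  assumes "u \<in> tangent_space M (fst z)" "v \<in> tangent_space M (fst z)" "z \<in> points P"
  shows "comb z (\<lambda>f. a * u f + b * v f) (a * r + b * s) = (\<lambda>f. a * comb z u r f + b * comb z v s f)"
proof (rule tangent_ext)
  note t = comb_tangent[OF assms(1,3)] comb_tangent[OF assms(2,3)]
  have l: "(\<lambda>f. a * u f + b * v f) \<in> tangent_space M (fst z)" by (intro M.tangent_lincomb assms)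
  show "comb z (\<lambda>f. a * u f + b * v f) (a * r + b * s) \<in> tangent_space P z" by (rule comb_tangent[OF l assms(3)])
  show "(\<lambda>f. a * comb z u r f + b * comb z v s f) \<in> tangent_space P z" by (intro P.tangent_lincomb t)
  show "tan_fst (comb z (\<lambda>f. a * u f + b * v f) (a * r + b * s)) = tan_fst (\<lambda>f. a * comb z u r f + b * comb z v s f)"
    by (simp only: tan_fst_lincomb tan_fst_comb[OF assms(1,3)] tan_fst_comb[OF assms(2,3)] tan_fst_comb[OF l assms(3)])
  show "\<eta> z (comb z (\<lambda>f. a * u f + b * v f) (a * r + b * s)) = \<eta> z (\<lambda>f. a * comb z u r f + b * comb z v s f)"
    by (simp only: linear_at_lincomb[OF \<eta>_linear[OF assms(3)] t] \<eta>_comb[OF assms(1,3)] \<eta>_comb[OF assms(2,3)] \<eta>_comb[OF l assms(3)])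
qed

lemma T_along:
  assumes "z \<in> points P"
  shows "smooth_along P N snd z (\<lambda>x. T (snd x))"
  unfolding smooth_along_def
proof
  show "eventually (\<lambda>x. T (snd x) \<in> tangent_space N (snd x)) (nhdsin (mtop P) z)"
    using P.eventually_points by eventually_elim (auto intro: T_tangent)
  show "\<forall>f\<in>smooth_near N (snd z). (\<lambda>x. T (snd x) f) \<in> smooth_near P z"
    using PN.smooth_near_along[OF smooth_map_at_snd[OF assms] N.vector_fields_apply_smooth[OF T_field]] by blast
qed

lemma comb_smooth:
  assumes z: "z \<in> points P" and U: "smooth_along P M fst z U" and r: "r \<in> smooth_near P z"
  shows "smooth_field P z (\<lambda>x. comb x (U x) (r x))"
  unfolding comb_def
proof (rule smooth_field_tan_pairI[OF z U PN.smooth_along_scale[OF _ T_along[OF z]]])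
  have "fst z \<in> points M" using z by auto
  then show "(\<lambda>x. r x - \<alpha> * \<omega> (fst x) (U x)) \<in> smooth_near P z"
    by (intro P.smooth_near_diff P.smooth_near_cmult r PM.one_form_along[OF om smooth_map_at_fst[OF z] z _ U])
qed

text \<open>The coefficient of \<open>T\<close> in the definition of \<phi> is exactly the one that
  makes the image horizontal, that is, annihilated by \<eta>.\<close>

lemma \<phi>_eq: "\<phi> z w = comb z (J (fst z) (tan_fst w)) 0"
  by (simp add: bar_phi_def comb_def)

lemma \<xi>_eq: "z \<in> points P \<Longrightarrow> \<xi> z = comb z (\<lambda>f. 0) 1"
  using M.linear_at_zero[OF \<omega>_linear] by (auto simp: bar_xi_def comb_def)

lemma
  assumes "w \<in> tangent_space P z"
  shows \<phi>_tangent: "\<phi> z w \<in> tangent_space P z"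
    and tan_fst_\<phi>: "tan_fst (\<phi> z w) = J (fst z) (tan_fst w)"
    and \<eta>_\<phi>: "\<eta> z (\<phi> z w) = 0"
  using P.tangent_points[OF assms] J_tangent[OF tan_fst_tangent[OF assms]]
  by (auto simp: \<phi>_eq intro!: comb_tangent tan_fst_comb \<eta>_comb)

lemma
  assumes "z \<in> points P"
  shows \<xi>_tangent: "\<xi> z \<in> tangent_space P z"
    and tan_fst_\<xi>: "tan_fst (\<xi> z) = (\<lambda>f. 0)"
    and \<eta>_\<xi>: "\<eta> z (\<xi> z) = 1"
proof -
  have "(\<lambda>f. 0) \<in> tangent_space M (fst z)" using assms by (intro M.tangent_zero) auto
  then show "\<xi> z \<in> tangent_space P z" "tan_fst (\<xi> z) = (\<lambda>f. 0)" "\<eta> z (\<xi> z) = 1"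
    using assms by (auto simp only: \<xi>_eq intro!: comb_tangent tan_fst_comb \<eta>_comb)
qed

section \<open>Smoothness of the structure tensors and the almost contact metric axioms\<close>

lemma tan_fst_zero: "tan_fst (\<lambda>f. 0) = (\<lambda>f. 0)"
  by (simp add: tan_fst_def)

lemma \<phi>_endo: "endo_field P \<phi>"
proof (rule P.endo_fieldI)
  show "linear_at P z (\<lambda>u. \<phi> z u f)" if z: "z \<in> points P" for z f
    unfolding linear_at_def
  proof (intro ballI allI)
    fix u v a b assume u: "u \<in> tangent_space P z" and v: "v \<in> tangent_space P z"
    note uv = tan_fst_tangent[OF u] tan_fst_tangent[OF v]
    have "\<phi> z (\<lambda>f. a * u f + b * v f) = comb z (\<lambda>f. a * J (fst z) (tan_fst u) f + b * J (fst z) (tan_fst v) f) (a * 0 + b * 0)"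
      by (simp add: \<phi>_eq tan_fst_lincomb J_lincomb[OF uv])
    also have "\<dots> = (\<lambda>f. a * \<phi> z u f + b * \<phi> z v f)"
      unfolding \<phi>_eq by (rule comb_lincomb[OF uv[THEN J_tangent] z])
    finally show "\<phi> z (\<lambda>f. a * u f + b * v f) f = a * \<phi> z u f + b * \<phi> z v f" by simp
  qed
  show "smooth_field P z (\<lambda>x. \<phi> x (X x))" if z: "z \<in> points P" and X: "smooth_field P z X" for z X
  proof -
    have p: "fst z \<in> points M" using z by auto
    show ?thesis
      unfolding \<phi>_eq
      by (rule comb_smooth[OF z PM.endo_field_along[OF J_endo smooth_map_at_fst[OF z] z p smooth_along_tan_fst[OF X z]]
            P.smooth_near_const[OF z]])
  qed
qed (rule \<phi>_tangent)

lemma \<xi>_field: "\<xi> \<in> vector_fields P"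
proof (rule P.vector_fieldsI)
  show "\<xi> z = (\<lambda>f. 0)" if "z \<notin> points P" for z using that by (simp add: bar_xi_def)
  fix z assume z: "z \<in> points P"
  have p: "fst z \<in> points M" using z by auto
  have "eventually (\<lambda>x. (\<lambda>f. 0) \<in> tangent_space M (fst x)) (nhdsin (mtop P) z)"
    using P.eventually_points by eventually_elim (auto intro: M.tangent_zero)
  then have "smooth_along P M fst z (\<lambda>x f. 0)"
    using z by (simp only: smooth_along_def) (auto intro: P.smooth_near_const)
  then have S: "smooth_field P z (\<lambda>x. comb x (\<lambda>f. 0) 1)"
    by (rule comb_smooth[OF z _ P.smooth_near_const[OF z]])
  have "eventually (\<lambda>x. comb x (\<lambda>f. 0) 1 = \<xi> x) (nhdsin (mtop P) z)"
    using P.eventually_points by eventually_elim (rule \<xi>_eq[symmetric])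
  then show "smooth_field P z \<xi>" using S by (rule P.self.smooth_along_cong)
qed

lemma G_eq: "G z w w' = g (fst z) (tan_fst w) (tan_fst w') + \<eta> z w * \<eta> z w'"
  by (simp add: bar_g_def)

lemma G_linear:
  assumes u: "u \<in> tangent_space P z"
  shows "linear_at P z (G z u)"
  unfolding linear_at_def
proof (intro ballI allI)
  fix v w a b assume v: "v \<in> tangent_space P z" and w: "w \<in> tangent_space P z"
  show "G z u (\<lambda>f. a * v f + b * w f) = a * G z u v + b * G z u w"
    using linear_at_lincomb[OF g_linear[OF tan_fst_tangent[OF u]] tan_fst_tangent[OF v] tan_fst_tangent[OF w], of a b]
      linear_at_lincomb[OF \<eta>_linear[OF P.tangent_points[OF u]] v w, of a b]
    by (simp add: G_eq tan_fst_lincomb algebra_simps)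
qed

lemma G_riemannian: "riemannian_metric P G"
proof (rule P.riemannian_metricI)
  show "G z u v = G z v u" if "u \<in> tangent_space P z" "v \<in> tangent_space P z" for z u v
    using g_sym[OF tan_fst_tangent[OF that(1)] tan_fst_tangent[OF that(2)]] by (simp add: G_eq)
  show "G z u u > 0" if z: "z \<in> points P" and u: "u \<in> tangent_space P z" and ne: "u \<noteq> (\<lambda>f. 0)" for z u
  proof (cases "tan_fst u = (\<lambda>f. 0)")
    case True
    \<comment> \<open>A nonzero vector with zero projection is detected by \<eta>, since the two
      together determine it.\<close>
    have "\<eta> z u \<noteq> 0"
    proof
      assume "\<eta> z u = 0"
      then have "u = (\<lambda>f. 0)"
        using True by (intro tangent_ext[OF u P.tangent_zero[OF z]])
          (auto simp: tan_fst_zero P.linear_at_zero[OF \<eta>_linear[OF z] z])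
      then show False using ne by blast
    qed
    moreover have "fst z \<in> points M" using z by auto
    then have "g (fst z) (\<lambda>f. 0) (\<lambda>f. 0) = 0"
      by (simp add: M.linear_at_zero[OF g_linear[OF M.tangent_zero]])
    ultimately show ?thesis
      by (simp add: G_eq True flip: power2_eq_square)
  next
    case False
    then show ?thesis
      using g_pos[OF tan_fst_tangent[OF u]] by (auto simp: G_eq intro: add_pos_nonneg)
  qed
  show "(\<lambda>x. G x (X x) (Y x)) \<in> smooth_near P z"
    if z: "z \<in> points P" and X: "smooth_field P z X" and Y: "smooth_field P z Y" for z X Y
  proof -
    have p: "fst z \<in> points M" using z by auto
    show ?thesis
      unfolding G_eq
      by (intro P.smooth_near_add P.smooth_near_mult \<eta>_smooth[OF X z] \<eta>_smooth[OF Y z]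
          PM.riemannian_metric_along[OF g_riemannian smooth_map_at_fst[OF z] z p smooth_along_tan_fst[OF X z]
            smooth_along_tan_fst[OF Y z]])
  qed
qed (rule G_linear)

text \<open>On projections the axioms are those of \<open>J\<close> and \<open>g\<close>, and on
  \<eta> they are immediate, whatever the value of \<alpha>. Hence only the covariant derivative
  condition can single out \<alpha> = 1.\<close>

lemma almost_contact_metric_P:
  assumes "even DIM('b)"
  shows "almost_contact_metric P \<phi> \<xi> \<eta> G"
  unfolding almost_contact_metric_def
proof (intro conjI ballI)
  show "smooth_manifold P" by (rule smooth_manifold_P)
  show "odd DIM('b \<times> real)" using assms by simp
  show "endo_field P \<phi>" by (rule \<phi>_endo)
  show "\<xi> \<in> vector_fields P" by (rule \<xi>_field)
  show "one_form P \<eta>" by (intro P.one_formI \<eta>_linear \<eta>_smooth)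
  show "riemannian_metric P G" by (rule G_riemannian)
  fix z assume z: "z \<in> points P"
  show "\<eta> z (\<xi> z) = 1" using z by (rule \<eta>_\<xi>)
  fix u assume u: "u \<in> tangent_space P z"
  show "\<phi> z (\<phi> z u) = (\<lambda>f. - u f + \<eta> z u * \<xi> z f)"
  proof (rule tangent_ext)
    have R: "(\<lambda>f. - u f + \<eta> z u * \<xi> z f) = (\<lambda>f. (-1) * u f + \<eta> z u * \<xi> z f)" by simp
    show "\<phi> z (\<phi> z u) \<in> tangent_space P z" by (intro \<phi>_tangent u)
    show "(\<lambda>f. - u f + \<eta> z u * \<xi> z f) \<in> tangent_space P z"
      unfolding R by (intro P.tangent_lincomb u \<xi>_tangent z)
    show "tan_fst (\<phi> z (\<phi> z u)) = tan_fst (\<lambda>f. - u f + \<eta> z u * \<xi> z f)"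
      unfolding R tan_fst_lincomb
      by (simp add: tan_fst_\<phi>[OF \<phi>_tangent[OF u]] tan_fst_\<phi>[OF u] JJ[OF tan_fst_tangent[OF u]] tan_fst_\<xi>[OF z])
    show "\<eta> z (\<phi> z (\<phi> z u)) = \<eta> z (\<lambda>f. - u f + \<eta> z u * \<xi> z f)"
      unfolding R linear_at_lincomb[OF \<eta>_linear[OF z] u \<xi>_tangent[OF z]]
      by (simp add: \<eta>_\<phi>[OF \<phi>_tangent[OF u]] \<eta>_\<phi>[OF u] \<eta>_\<xi>[OF z])
  qed
  fix v assume v: "v \<in> tangent_space P z"
  show "G z (\<phi> z u) (\<phi> z v) = G z u v - \<eta> z u * \<eta> z v"
    using u v by (simp add: G_eq tan_fst_\<phi> \<eta>_\<phi> g_JJ tan_fst_tangent del: points_P)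
qed

section \<open>Lie brackets on the product and the exterior derivative of the contact form\<close>

abbreviation slice :: "('a \<times> 'c \<Rightarrow> ('a \<times> 'c) tvec) \<Rightarrow> 'c \<Rightarrow> 'a \<Rightarrow> 'a tvec" where
  "slice X q \<equiv> \<lambda>p. tan_fst (X (p, q))"

text \<open>The base point \<open>p\<close> stays fixed, so this is an ordinary derivative in the
  tangent space at \<open>p\<close>.\<close>

definition dT :: "('a \<times> 'c \<Rightarrow> ('a \<times> 'c) tvec) \<Rightarrow> 'a \<Rightarrow> 'c \<Rightarrow> 'a tvec" where
  "dT Y p q = (\<lambda>f. T q (\<lambda>y. tan_fst (Y (p, y)) f))"

lemma along_fst: "X \<in> vector_fields P \<Longrightarrow> z \<in> points P \<Longrightarrow> smooth_along P M fst z (\<lambda>x. tan_fst (X x))"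
  by (intro smooth_along_tan_fst P.vector_fields_smooth)

lemma along_curve:
  "X \<in> vector_fields P \<Longrightarrow> (p, q) \<in> points P \<Longrightarrow> smooth_along N M (\<lambda>_. p) q (\<lambda>y. tan_fst (X (p, y)))"
  by (rule smooth_along_slice(2)[OF along_fst])

lemma dT_tangent:
  assumes "Y \<in> vector_fields P" "(p, q) \<in> points P"
  shows "dT Y p q \<in> tangent_space M p"
  unfolding dT_def using assms
  by (intro NM.derivative_at_fixed_point(1)[OF T_tangent along_curve]) auto

lemma dT_linear:
  assumes "Y \<in> vector_fields P" "(p, q) \<in> points P" "linear_at M p L"
  shows "T q (\<lambda>y. L (tan_fst (Y (p, y)))) = L (dT Y p q)"
  unfolding dT_def using assms
  by (intro NM.derivative_at_fixed_point(2)[OF T_tangent along_curve, THEN conjunct2]) auto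

lemma apply_tan_fst:
  assumes X: "X \<in> vector_fields P" and Y: "Y \<in> vector_fields P" and z: "(p, q) \<in> points P" and f: "f \<in> smooth_near M p"
  shows "X (p, q) (\<lambda>z. tan_fst (Y z) f) = slice X q p (\<lambda>x. slice Y q x f) + curve_coeff T (p, q) (X (p, q)) * dT Y p q f"
  unfolding dT_def using f
  by (intro tangent_apply[OF P.vector_fields_tangent[OF X z]] smooth_alongD[OF along_fst[OF Y z]]) simp

text \<open>Evaluated on \<open>f \<circ> fst\<close>, each iterated derivative splits into a
  derivative within the slice and one along the curve. The slice parts combine to the bracket on
  \<open>M\<close>, the others to the \<open>dT\<close> terms.\<close>

lemma lie_bracket_fst:
  assumes X: "X \<in> vector_fields P" and Y: "Y \<in> vector_fields P" and z: "(p, q) \<in> points P"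
  shows "tan_fst (lie_bracket P X Y (p, q)) = (\<lambda>f. lie_bracket M (slice X q) (slice Y q) p f
    + (curve_coeff T (p, q) (X (p, q)) * dT Y p q f + (- curve_coeff T (p, q) (Y (p, q))) * dT X p q f))"
proof (rule M.tangent_eqI)
  have pq: "p \<in> points M" "q \<in> points N" using z by auto
  show "tan_fst (lie_bracket P X Y (p, q)) \<in> tangent_space M p"
    using tan_fst_tangent[OF P.lie_bracket_tangent[OF X Y z]] by simp
  show "(\<lambda>f. lie_bracket M (slice X q) (slice Y q) p f
    + (curve_coeff T (p, q) (X (p, q)) * dT Y p q f + (- curve_coeff T (p, q) (Y (p, q))) * dT X p q f)) \<in> tangent_space M p"
    by (intro M.tangent_plus M.lie_bracket_tangent M.tangent_lincomb dT_tangent X Y z pq slice_vector_fields)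
  fix f assume f: "f \<in> smooth_near M p"
  have "f \<circ> fst \<in> smooth_near P (p, q)" using f smooth_near_fst_iff[OF z] by blast
  then have "tan_fst (lie_bracket P X Y (p, q)) f
      = X (p, q) (\<lambda>z. tan_fst (Y z) f) - Y (p, q) (\<lambda>z. tan_fst (X z) f)"
    using z by (simp add: tan_fst_def lie_bracket_def)
  then show "tan_fst (lie_bracket P X Y (p, q)) f = lie_bracket M (slice X q) (slice Y q) p f
    + (curve_coeff T (p, q) (X (p, q)) * dT Y p q f + (- curve_coeff T (p, q) (Y (p, q))) * dT X p q f)"
    using f pq by (simp add: apply_tan_fst[OF X Y z f] apply_tan_fst[OF Y X z f] lie_bracket_def)
qed

lemma curve_coeff_field:
  "X \<in> vector_fields P \<Longrightarrow> z \<in> points P \<Longrightarrow> (\<lambda>x. curve_coeff T x (X x)) \<in> smooth_near P z"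
  by (intro curve_coeff_smooth P.vector_fields_smooth)

text \<open>This is the closedness of the form \<open>curve_coeff T\<close>. In \<open>E\<close>,
  the terms differentiating twice along \<open>T\<close> carry the product of the two curve
  coefficients and cancel by symmetry.\<close>

lemma lie_bracket_snd:
  assumes X: "X \<in> vector_fields P" and Y: "Y \<in> vector_fields P" and z: "z \<in> points P"
  shows "curve_coeff T z (lie_bracket P X Y z) = X z (\<lambda>x. curve_coeff T x (Y x)) - Y z (\<lambda>x. curve_coeff T x (X x))"
proof (rule curve_coeff_eqI)
  show q: "snd z \<in> points N" using z by auto
  have E: "Z z (\<lambda>x. W x (f \<circ> snd)) = Z z (\<lambda>x. curve_coeff T x (W x)) * T (snd z) f
      + curve_coeff T z (W z) * (curve_coeff T z (Z z) * T (snd z) (\<lambda>y. T y f))"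
    if Z: "Z \<in> vector_fields P" and W: "W \<in> vector_fields P" and f: "f \<in> smooth_near N (snd z)" for Z W f
  proof -
    note Zz = P.vector_fields_tangent[OF Z z]
    have "eventually (\<lambda>x. W x (f \<circ> snd) = curve_coeff T x (W x) * T (snd x) f) (nhdsin (mtop P) z)"
      using P.eventually_points
    proof eventually_elim
      case (elim x)
      from fun_cong[OF tan_snd_eq[OF P.vector_fields_tangent[OF W elim]], of f] show ?case
        by (simp add: tan_snd_def)
    qed
    then have "Z z (\<lambda>x. W x (f \<circ> snd)) = Z z (\<lambda>x. curve_coeff T x (W x) * T (snd x) f)"
      by (rule P.tangent_cong[OF Zz])
    also have "\<dots> = Z z (\<lambda>x. curve_coeff T x (W x)) * T (snd z) f
        + curve_coeff T z (W z) * Z z (\<lambda>x. T (snd x) f)"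
      by (rule P.tangent_mult[OF Zz curve_coeff_field[OF W z] smooth_alongD[OF T_along[OF z] f]])
    also have "Z z (\<lambda>x. T (snd x) f) = tan_snd (Z z) (\<lambda>y. T y f)"
      by (simp add: tan_snd_def o_def)
    also have "\<dots> = curve_coeff T z (Z z) * T (snd z) (\<lambda>y. T y f)"
      by (simp add: tan_snd_eq[OF Zz])
    finally show ?thesis .
  qed
  have 1: "tan_snd (lie_bracket P X Y z) \<in> tangent_space N (snd z)"
    by (rule tan_snd_tangent[OF P.lie_bracket_tangent[OF X Y z]])
  show "tan_snd (lie_bracket P X Y z)
     = (\<lambda>f. (X z (\<lambda>x. curve_coeff T x (Y x)) - Y z (\<lambda>x. curve_coeff T x (X x))) * T (snd z) f)"
  proof (rule N.tangent_eqI[OF 1 N.tangent_scale[OF T_tangent[OF q]]])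
    fix f assume f: "f \<in> smooth_near N (snd z)"
    have "f \<circ> snd \<in> smooth_near P z"
      using smooth_near_snd_iff[of "fst z" "snd z" f] z f by simp
    then show "tan_snd (lie_bracket P X Y z) f
        = (X z (\<lambda>x. curve_coeff T x (Y x)) - Y z (\<lambda>x. curve_coeff T x (X x))) * T (snd z) f"
      using z E[OF X Y f] E[OF Y X f] by (simp add: tan_snd_def lie_bracket_def left_diff_distrib)
  qed
qed

lemma apply_\<omega>:
  assumes X: "X \<in> vector_fields P" and Y: "Y \<in> vector_fields P" and z: "(p, q) \<in> points P"
  shows "X (p, q) (\<lambda>z. \<omega> (fst z) (tan_fst (Y z)))
    = slice X q p (\<lambda>x. \<omega> x (slice Y q x)) + curve_coeff T (p, q) (X (p, q)) * \<omega> p (dT Y p q)"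
    and "(\<lambda>z. \<omega> (fst z) (tan_fst (Y z))) \<in> smooth_near P (p, q)"
proof -
  have p: "p \<in> points M" using z by auto
  show S: "(\<lambda>z. \<omega> (fst z) (tan_fst (Y z))) \<in> smooth_near P (p, q)"
    using p by (intro PM.one_form_along[OF om smooth_map_at_fst[OF z] z _ along_fst[OF Y z]]) simp
  from tangent_apply[OF P.vector_fields_tangent[OF X z] S]
  show "X (p, q) (\<lambda>z. \<omega> (fst z) (tan_fst (Y z)))
    = slice X q p (\<lambda>x. \<omega> x (slice Y q x)) + curve_coeff T (p, q) (X (p, q)) * \<omega> p (dT Y p q)"
    by (simp add: dT_linear[OF Y z \<omega>_linear[OF p]])
qed

text \<open>The left side is twice the exterior derivative of \<eta>. By
  \<open>lie_bracket_snd\<close> the curve coefficients contribute nothing, and the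
  \<open>dT\<close> terms of the derivatives cancel those of the bracket. What remains is \<alpha>
  times the exterior derivative of \<omega> on the slice.\<close>

lemma ext_deriv_\<eta>:
  assumes d\<omega>: "\<And>X Y p. X \<in> vector_fields M \<Longrightarrow> Y \<in> vector_fields M \<Longrightarrow> p \<in> points M \<Longrightarrow>
      ext_deriv M \<omega> X Y p = fundamental_form J g X Y p"
    and X: "X \<in> vector_fields P" and Y: "Y \<in> vector_fields P" and z: "z \<in> points P"
  shows "X z (\<lambda>x. \<eta> x (Y x)) - Y z (\<lambda>x. \<eta> x (X x)) - \<eta> z (lie_bracket P X Y z)
    = 2 * \<alpha> * g (fst z) (tan_fst (X z)) (J (fst z) (tan_fst (Y z)))"
proof -
  obtain p q where zpq: "z = (p, q)" by (cases z)
  have pq: "p \<in> points M" "q \<in> points N" using z by (auto simp: zpq)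
  note z' = z[unfolded zpq]
  have E: "Z (p, q) (\<lambda>x. \<eta> x (W x)) = \<alpha> * (slice Z q p (\<lambda>x. \<omega> x (slice W q x))
      + curve_coeff T (p, q) (Z (p, q)) * \<omega> p (dT W p q)) + Z (p, q) (\<lambda>x. curve_coeff T x (W x))"
    if Z: "Z \<in> vector_fields P" and W: "W \<in> vector_fields P" for Z W
    unfolding bar_eta_def
    using P.tangent_add[OF P.vector_fields_tangent[OF Z z'] P.smooth_near_cmult[OF apply_\<omega>(2)[OF Z W z']] curve_coeff_field[OF W z']]
      P.tangent_cmult[OF P.vector_fields_tangent[OF Z z'] apply_\<omega>(2)[OF Z W z']]
    by (simp add: apply_\<omega>(1)[OF Z W z'])
  have L: "lie_bracket M (slice X q) (slice Y q) p \<in> tangent_space M p"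
    by (intro M.lie_bracket_tangent slice_vector_fields X Y pq)
  have "\<omega> p (tan_fst (lie_bracket P X Y (p, q))) = \<omega> p (lie_bracket M (slice X q) (slice Y q) p)
    + (curve_coeff T (p, q) (X (p, q)) * \<omega> p (dT Y p q) - curve_coeff T (p, q) (Y (p, q)) * \<omega> p (dT X p q))"
    unfolding lie_bracket_fst[OF X Y z']
    by (simp only: M.linear_at_add[OF \<omega>_linear[OF pq(1)] L M.tangent_lincomb[OF dT_tangent[OF Y z'] dT_tangent[OF X z']]]
        linear_at_lincomb[OF \<omega>_linear[OF pq(1)] dT_tangent[OF Y z'] dT_tangent[OF X z']])
  then have B: "\<eta> (p, q) (lie_bracket P X Y (p, q)) = \<alpha> * (\<omega> p (lie_bracket M (slice X q) (slice Y q) p)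
    + (curve_coeff T (p, q) (X (p, q)) * \<omega> p (dT Y p q) - curve_coeff T (p, q) (Y (p, q)) * \<omega> p (dT X p q)))
    + (X (p, q) (\<lambda>x. curve_coeff T x (Y x)) - Y (p, q) (\<lambda>x. curve_coeff T x (X x)))"
    by (simp add: bar_eta_def lie_bracket_snd[OF X Y z'])
  \<comment> \<open>The factor 2 undoes the division in \<open>ext_deriv\<close>.\<close>
  have "slice X q p (\<lambda>x. \<omega> x (slice Y q x)) - slice Y q p (\<lambda>x. \<omega> x (slice X q x))
      - \<omega> p (lie_bracket M (slice X q) (slice Y q) p) = 2 * g p (slice X q p) (J p (slice Y q p))"
    using d\<omega>[OF slice_vector_fields[OF X pq(2)] slice_vector_fields[OF Y pq(2)] pq(1)]
    unfolding ext_deriv_def fundamental_form_def by (simp add: divide_eq_eq mult.commute)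
  then have "\<alpha> * (slice X q p (\<lambda>x. \<omega> x (slice Y q x)) - slice Y q p (\<lambda>x. \<omega> x (slice X q x))
      - \<omega> p (lie_bracket M (slice X q) (slice Y q) p)) = 2 * \<alpha> * g p (slice X q p) (J p (slice Y q p))"
    by simp
  then show ?thesis
    unfolding zpq E[OF X Y] E[OF Y X] B fst_conv by (simp add: algebra_simps)
qed

end

text \<open>The product rule for a bilinear form on one fixed tangent space. Expanding the second
  argument in the coordinate basis leaves products of functions, whose factors
  \<open>B (V x) (?e b)\<close> are linear in \<open>V x\<close> and covered by
  \<open>derivative_at_fixed_point\<close>.\<close>

lemma (in mfd2) bilinear_derivative:
  assumes t: "t \<in> tangent_space P y"
    and V: "smooth_along P M (\<lambda>_. p) y V" and W: "smooth_along P M (\<lambda>_. p) y W"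
    and B1: "\<And>u. u \<in> tangent_space M p \<Longrightarrow> linear_at M p (B u)"
    and B2: "\<And>v. v \<in> tangent_space M p \<Longrightarrow> linear_at M p (\<lambda>u. B u v)"
  shows "t (\<lambda>x. B (V x) (W x)) = B (\<lambda>f. t (\<lambda>x. V x f)) (W y) + B (V y) (\<lambda>f. t (\<lambda>x. W x f))"
proof -
  have y: "y \<in> points P" using t by (rule P.tangent_points)
  have evV: "eventually (\<lambda>x. V x \<in> tangent_space M p) (nhdsin (mtop P) y)"
    and evW: "eventually (\<lambda>x. W x \<in> tangent_space M p) (nhdsin (mtop P) y)"
    using V W by (auto simp: smooth_along_def)
  have Vy: "V y \<in> tangent_space M p" and Wy: "W y \<in> tangent_space M p"
    using eventually_nhdsin_self[OF evV y] eventually_nhdsin_self[OF evW y] .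
  obtain U c where Uc: "(U, c) \<in> atlas M" "p \<in> U" using M.tangent_points[OF Vy] by (rule M.chart_at)
  note DV = derivative_at_fixed_point[OF t V] and DW = derivative_at_fixed_point[OF t W]
  let ?e = "\<lambda>b. coord_vec M (U, c) p b"
  have e: "?e b \<in> tangent_space M p" for b by (rule M.coord_vec_tangent[OF Uc])
  have SW: "(\<lambda>x. W x (\<lambda>q. c q \<bullet> b)) \<in> smooth_near P y" for b
    by (rule smooth_alongD[OF W M.smooth_near_coord[OF Uc]])
  have SV: "(\<lambda>x. B (V x) (?e b)) \<in> smooth_near P y"
    and TV: "t (\<lambda>x. B (V x) (?e b)) = B (\<lambda>f. t (\<lambda>x. V x f)) (?e b)" for b
    using DV(2)[OF B2[OF e]] by auto
  have "eventually (\<lambda>x. B (V x) (W x) = (\<Sum>b\<in>Basis. W x (\<lambda>q. c q \<bullet> b) * B (V x) (?e b))) (nhdsin (mtop P) y)"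
    using evV evW by eventually_elim (rule M.linear_at_expand[OF B1 _ Uc])
  then have "t (\<lambda>x. B (V x) (W x)) = t (\<lambda>x. \<Sum>b\<in>Basis. W x (\<lambda>q. c q \<bullet> b) * B (V x) (?e b))"
    by (rule P.tangent_cong[OF t])
  also have "\<dots> = (\<Sum>b\<in>Basis. t (\<lambda>x. W x (\<lambda>q. c q \<bullet> b) * B (V x) (?e b)))"
    by (rule P.tangent_sum[OF t P.smooth_near_mult[OF SW SV]])
  also have "\<dots> = (\<Sum>b\<in>Basis. t (\<lambda>x. W x (\<lambda>q. c q \<bullet> b)) * B (V y) (?e b))
      + (\<Sum>b\<in>Basis. W y (\<lambda>q. c q \<bullet> b) * B (\<lambda>f. t (\<lambda>x. V x f)) (?e b))"
    by (simp only: P.tangent_mult[OF t SW SV] TV sum.distrib)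
  also have "\<dots> = B (V y) (\<lambda>f. t (\<lambda>x. W x f)) + B (\<lambda>f. t (\<lambda>x. V x f)) (W y)"
    using M.linear_at_expand[OF B1[OF DV(1)] Wy Uc] M.linear_at_expand[OF B1[OF Vy] DW(1) Uc] by (simp only:)
  also have "\<dots> = B (\<lambda>f. t (\<lambda>x. V x f)) (W y) + B (V y) (\<lambda>f. t (\<lambda>x. W x f))"
    by (rule add.commute)
  finally show ?thesis .
qed

section \<open>The Levi-Civita connection of the product\<close>

locale kaehler_curve_prod = hermitian_curve_prod M N T J g \<omega> \<alpha>
  for M :: "('a, 'b::euclidean_space) manifold" and N :: "('c, real) manifold" and T :: "'c \<Rightarrow> 'c tvec"
    and J :: "'a \<Rightarrow> 'a tvec \<Rightarrow> 'a tvec" and g :: "'a \<Rightarrow> 'a tvec \<Rightarrow> 'a tvec \<Rightarrow> real"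
    and \<omega> :: "'a \<Rightarrow> 'a tvec \<Rightarrow> real" and \<alpha> :: real +
  fixes D :: "('a \<Rightarrow> 'a tvec) \<Rightarrow> ('a \<Rightarrow> 'a tvec) \<Rightarrow> 'a \<Rightarrow> 'a tvec"
  assumes lc: "levi_civita M g D"
    and parallel: "X \<in> vector_fields M \<Longrightarrow> Y \<in> vector_fields M \<Longrightarrow> p \<in> points M \<Longrightarrow>
      cov_deriv_endo M D J X Y p = (\<lambda>f. 0)"
begin

section \<open>The connection of the base and its pull-back to the product\<close>

lemma D_conn: "affine_connection M D"
  using lc unfolding levi_civita_def by (rule conjunct1)

lemma D_torsion:
  assumes "X \<in> vector_fields M" "Y \<in> vector_fields M"
  shows "D X Y p f - D Y X p f = lie_bracket M X Y p f"
proof -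
  have "(\<lambda>p f. D X Y p f - D Y X p f) = lie_bracket M X Y"
    using lc[unfolded levi_civita_def, THEN conjunct2, THEN conjunct1] assms by simp
  from fun_cong[OF fun_cong[OF this]] show ?thesis .
qed

lemma D_metric:
  assumes "X \<in> vector_fields M" "Y \<in> vector_fields M" "Z \<in> vector_fields M" "p \<in> points M"
  shows "X p (\<lambda>q. g q (Y q) (Z q)) = g p (D X Y p) (Z p) + g p (Y p) (D X Z p)"
  using lc[unfolded levi_civita_def, THEN conjunct2, THEN conjunct2] assms by simp

lemma D_field: "X \<in> vector_fields M \<Longrightarrow> Y \<in> vector_fields M \<Longrightarrow> D X Y \<in> vector_fields M"
  by (rule M.connection_vector_fields[OF D_conn])

text \<open>The pull-back of \<open>D\<close> along the projection, applied in direction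
  \<open>X\<close> to the base component of \<open>Y\<close> as a section of the pulled-back tangent
  bundle.\<close>

definition hor :: "('a \<times> 'c \<Rightarrow> ('a \<times> 'c) tvec) \<Rightarrow> ('a \<times> 'c \<Rightarrow> ('a \<times> 'c) tvec) \<Rightarrow> 'a \<times> 'c \<Rightarrow> 'a tvec" where
  "hor X Y z = (\<lambda>f. D (slice X (snd z)) (slice Y (snd z)) (fst z) f
     + curve_coeff T z (X z) * dT Y (fst z) (snd z) f)"

lemma hor_tangent:
  assumes "X \<in> vector_fields P" "Y \<in> vector_fields P" "z \<in> points P"
  shows "hor X Y z \<in> tangent_space M (fst z)"
proof -
  have "fst z \<in> points M" "snd z \<in> points N" "(fst z, snd z) \<in> points P" using assms(3) by auto
  then show ?thesis
    unfolding hor_def using assms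
    by (intro M.tangent_plus M.tangent_scale dT_tangent M.vector_fields_tangent D_field slice_vector_fields)
qed

text \<open>The definition gives smoothness within each slice only. In
  \<open>connection_local\<close> the fields \<open>E b\<close> do not depend on the curve point, so
  the terms \<open>D (E b') (E b)\<close> are fixed smooth fields of \<open>M\<close>. All other
  ingredients are smooth on the product.\<close>

lemma hor_smooth:
  assumes X: "X \<in> vector_fields P" and Y: "Y \<in> vector_fields P" and z: "z \<in> points P"
  shows "smooth_along P M fst z (hor X Y)"
  unfolding smooth_along_def
proof
  show "eventually (\<lambda>z. hor X Y z \<in> tangent_space M (fst z)) (nhdsin (mtop P) z)"
    using P.eventually_points by eventually_elim (rule hor_tangent[OF X Y])
  show "\<forall>f\<in>smooth_near M (fst z). (\<lambda>z. hor X Y z f) \<in> smooth_near P z"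
  proof
    fix f assume f: "f \<in> smooth_near M (fst z)"
    have "fst z \<in> points M" using z by auto
    then obtain U c where Uc: "(U, c) \<in> atlas M" "fst z \<in> U" by (rule M.chart_at)
    obtain \<rho> where \<rho>: "bump_on M U \<rho>" "\<rho> (fst z) > 0" using Uc by (rule M.bump_exists)
    have \<rho>smooth: "\<rho> \<in> smooth_near M p" if "p \<in> U" for p
      using \<rho>(1) that unfolding bump_on_def by blast
    define E where "E b = (\<lambda>q f. \<rho> q * coord_vec M (U, c) q b f)" for b
    have E: "E b \<in> vector_fields M" for b
      unfolding E_def by (rule M.bump_coord_field[OF \<rho>(1) Uc(1)])
    define co where "co Z b z = tan_fst (Z z) (\<lambda>q. c q \<bullet> b)" for Z :: "'a \<times> 'c \<Rightarrow> ('a \<times> 'c) tvec" and b z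
    have co: "co Z b \<in> smooth_near P x" if "Z \<in> vector_fields P" "x \<in> points P" "fst x \<in> U" for Z b x
      unfolding co_def[abs_def]
      by (rule smooth_alongD[OF along_fst[OF that(1,2)] M.smooth_near_coord[OF Uc(1) that(3)]])
    \<comment> \<open>This is the formula of \<open>connection_local\<close> with the full
      derivative \<open>X x (co Y b)\<close> in place of the derivative within the slice. The
      difference is exactly the \<open>dT\<close> term of \<open>hor\<close>.\<close>
    define R where "R x = (\<Sum>b\<in>Basis. X x (co Y b) * coord_vec M (U, c) (fst x) b f)
        - tan_fst (X x) \<rho> * inverse (\<rho> (fst x)) * tan_fst (Y x) f
        + (\<Sum>b\<in>Basis. \<Sum>b'\<in>Basis. co X b' x * co Y b x * (inverse (\<rho> (fst x)) * inverse (\<rho> (fst x))) * D (E b') (E b) (fst x) f)" for x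
    note comp = PM.smooth_near_along[OF smooth_map_at_fst[OF z]]
    have "R \<in> smooth_near P z"
      unfolding R_def[abs_def]
    proof (intro P.smooth_near_add P.smooth_near_diff P.smooth_near_sum P.smooth_near_mult z
        P.vector_fields_apply_smooth[OF X co[OF Y z Uc(2)]] comp[OF M.coord_vec_smooth(1)[OF Uc f]]
        smooth_alongD[OF along_fst[OF X z] \<rho>smooth[OF Uc(2)]] smooth_alongD[OF along_fst[OF Y z] f]
        co[OF X z Uc(2)] co[OF Y z Uc(2)] comp[OF M.vector_fields_apply_smooth[OF D_field[OF E E] f]])
      show "(\<lambda>x. inverse (\<rho> (fst x))) \<in> smooth_near P z"
        using \<rho>(2) by (intro P.smooth_near_inverse comp[OF \<rho>smooth[OF Uc(2)]]) simp
      then show "(\<lambda>x. inverse (\<rho> (fst x))) \<in> smooth_near P z" .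
      then show "(\<lambda>x. inverse (\<rho> (fst x))) \<in> smooth_near P z" .
    qed
    moreover have "eventually (\<lambda>x. fst x \<in> U \<and> \<rho> (fst x) \<noteq> 0) (nhdsin (mtop P) z)"
      using M.eventually_chart[OF Uc] M.eventually_nonzero[OF \<rho>smooth[OF Uc(2)]] \<rho>(2)
      by (intro PM.eventually_along[OF smooth_map_at_fst[OF z]]) (auto simp: eventually_conj_iff)
    then have "eventually (\<lambda>x. R x = hor X Y x f) (nhdsin (mtop P) z)"
      using P.eventually_points
    proof eventually_elim
      case (elim x)
      obtain p q where x: "x = (p, q)" by (cases x)
      have pU: "p \<in> U" and \<rho>p: "\<rho> p \<noteq> 0" and q: "q \<in> points N" and x': "(p, q) \<in> points P"
        using elim by (auto simp: x)
      note Xx = P.vector_fields_tangent[OF X x']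
      have coY: "X (p, q) (co Y b) = slice X q p (\<lambda>x. co Y b (x, q)) + curve_coeff T (p, q) (X (p, q)) * T q (\<lambda>y. co Y b (p, y))" for b
        by (rule tangent_apply[OF Xx co[OF Y x']]) (simp add: pU)
      have 1: "dT Y p q f = (\<Sum>b\<in>Basis. T q (\<lambda>y. co Y b (p, y)) * coord_vec M (U, c) p b f)"
        using M.tangent_expand[OF dT_tangent[OF Y x'] Uc(1) pU, of f]
        unfolding co_def by (simp only: dT_def)
      have 2: "D (slice X q) (slice Y q) p f = (\<Sum>b\<in>Basis. slice X q p (\<lambda>x. co Y b (x, q)) * coord_vec M (U, c) p b f)
        - slice X q p \<rho> / \<rho> p * slice Y q p f
        + (\<Sum>b\<in>Basis. \<Sum>b'\<in>Basis. co X b' (p, q) * co Y b (p, q) / (\<rho> p * \<rho> p) * D (E b') (E b) p f)"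
        unfolding co_def E_def
        by (rule M.connection_local[OF D_conn slice_vector_fields[OF X q] slice_vector_fields[OF Y q] Uc(1) pU \<rho>(1) \<rho>p])
      show ?case
        unfolding x R_def hor_def fst_conv snd_conv coY 1 2
        by (simp add: distrib_right sum.distrib sum_distrib_left divide_inverse mult.assoc)
    qed
    ultimately show "(\<lambda>z. hor X Y z f) \<in> smooth_near P z"
      by (rule P.smooth_near_cong[rotated])
  qed
qed

lemma slice_scale_smooth:
  assumes "msmooth_on P (points P) h" "q \<in> points N"
  shows "msmooth_on M (points M) (\<lambda>p. h (p, q))"
  using assms unfolding P.msmooth_on_iff[OF openin_topspace] M.msmooth_on_iff[OF openin_topspace]
  by (auto intro: smooth_near_slice)

lemma hor_add_left:
  assumes X: "X \<in> vector_fields P" and Y: "Y \<in> vector_fields P" and Z: "Z \<in> vector_fields P" and z: "z \<in> points P"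
  shows "hor (\<lambda>p f. X p f + Y p f) Z z = (\<lambda>f. 1 * hor X Z z f + 1 * hor Y Z z f)"
proof -
  have q: "snd z \<in> points N" using z by auto
  have "slice (\<lambda>p f. X p f + Y p f) (snd z) = (\<lambda>p f. slice X (snd z) p f + slice Y (snd z) p f)"
    by (simp add: tan_fst_def)
  moreover have "curve_coeff T z (\<lambda>f. X z f + Y z f) = curve_coeff T z (X z) + curve_coeff T z (Y z)"
    by (rule P.linear_at_add[OF curve_coeff_linear[OF z] P.vector_fields_tangent[OF X z] P.vector_fields_tangent[OF Y z]])
  ultimately show ?thesis
    by (simp add: hor_def M.connection_plus(1)[OF D_conn slice_vector_fields[OF X q] slice_vector_fields[OF Y q] slice_vector_fields[OF Z q]]
        distrib_right add_ac)
qed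

lemma hor_add_right:
  assumes X: "X \<in> vector_fields P" and Y: "Y \<in> vector_fields P" and Z: "Z \<in> vector_fields P" and z: "z \<in> points P"
  shows "hor X (\<lambda>p f. Y p f + Z p f) z = (\<lambda>f. 1 * hor X Y z f + 1 * hor X Z z f)"
proof (rule M.tangent_eqI)
  have q: "snd z \<in> points N" and p: "fst z \<in> points M" and z': "(fst z, snd z) \<in> points P" using z by auto
  show "hor X (\<lambda>p f. Y p f + Z p f) z \<in> tangent_space M (fst z)"
    by (intro hor_tangent X P.vector_fields_plus Y Z z)
  show "(\<lambda>f. 1 * hor X Y z f + 1 * hor X Z z f) \<in> tangent_space M (fst z)"
    by (intro M.tangent_lincomb hor_tangent X Y Z z)
  fix f assume f: "f \<in> smooth_near M (fst z)"
  have S: "slice (\<lambda>p f. Y p f + Z p f) q = (\<lambda>p f. slice Y q p f + slice Z q p f)" for q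
    by (simp add: tan_fst_def)
  have "dT (\<lambda>p f. Y p f + Z p f) (fst z) (snd z) f = dT Y (fst z) (snd z) f + dT Z (fst z) (snd z) f"
    unfolding dT_def
    using N.tangent_add[OF T_tangent[OF q] smooth_alongD[OF along_curve[OF Y z'] f] smooth_alongD[OF along_curve[OF Z z'] f]]
    by (simp add: tan_fst_def)
  then show "hor X (\<lambda>p f. Y p f + Z p f) z f = 1 * hor X Y z f + 1 * hor X Z z f"
    by (simp add: hor_def S M.connection_plus(2)[OF D_conn slice_vector_fields[OF X q] slice_vector_fields[OF Y q] slice_vector_fields[OF Z q]]
        distrib_left add_ac)
qed

lemma hor_scale_left:
  assumes X: "X \<in> vector_fields P" and Y: "Y \<in> vector_fields P" and h: "msmooth_on P (points P) h" and z: "z \<in> points P"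
  shows "hor (\<lambda>p f. h p * X p f) Y z = (\<lambda>f. h z * hor X Y z f)"
proof -
  have q: "snd z \<in> points N" using z by auto
  have "slice (\<lambda>p f. h p * X p f) (snd z) = (\<lambda>p f. h (p, snd z) * slice X (snd z) p f)"
    by (simp add: tan_fst_def)
  moreover have "curve_coeff T z (\<lambda>f. h z * X z f) = h z * curve_coeff T z (X z)"
    by (rule P.linear_at_scale[OF curve_coeff_linear[OF z] P.vector_fields_tangent[OF X z]])
  ultimately show ?thesis
    by (simp add: hor_def M.connection_scale(1)[OF D_conn slice_vector_fields[OF X q] slice_vector_fields[OF Y q] slice_scale_smooth[OF h q]]
        distrib_left mult.assoc)
qed

lemma hor_scale_right:
  assumes X: "X \<in> vector_fields P" and Y: "Y \<in> vector_fields P" and h: "msmooth_on P (points P) h" and z: "z \<in> points P"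
  shows "hor X (\<lambda>p f. h p * Y p f) z = (\<lambda>f. X z h * tan_fst (Y z) f + h z * hor X Y z f)"
proof (rule M.tangent_eqI)
  have q: "snd z \<in> points N" and p: "fst z \<in> points M" and z': "(fst z, snd z) \<in> points P" using z by auto
  note Yz = P.vector_fields_tangent[OF Y z] and Xz = P.vector_fields_tangent[OF X z']
  show "hor X (\<lambda>p f. h p * Y p f) z \<in> tangent_space M (fst z)"
    by (intro hor_tangent X P.vector_fields_scale Y h z)
  show "(\<lambda>f. X z h * tan_fst (Y z) f + h z * hor X Y z f) \<in> tangent_space M (fst z)"
    by (intro M.tangent_lincomb hor_tangent X Y z tan_fst_tangent Yz)
  fix f assume f: "f \<in> smooth_near M (fst z)"
  have hs: "h \<in> smooth_near P (fst z, snd z)"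
    using h z' unfolding P.msmooth_on_iff[OF openin_topspace] by blast
  have S: "slice (\<lambda>p f. h p * Y p f) q = (\<lambda>p f. h (p, q) * slice Y q p f)" for q
    by (simp add: tan_fst_def)
  have "dT (\<lambda>p f. h p * Y p f) (fst z) (snd z) f
      = T (snd z) (\<lambda>y. h (fst z, y)) * tan_fst (Y z) f + h z * dT Y (fst z) (snd z) f"
    unfolding dT_def
    using N.tangent_mult[OF T_tangent[OF q] smooth_near_slice(2)[OF hs] smooth_alongD[OF along_curve[OF Y z'] f]]
    by (simp add: tan_fst_def)
  moreover have "X z h = slice X (snd z) (fst z) (\<lambda>x. h (x, snd z)) + curve_coeff T z (X z) * T (snd z) (\<lambda>y. h (fst z, y))"
    using tangent_apply[OF Xz hs] by simp
  ultimately show "hor X (\<lambda>p f. h p * Y p f) z f = X z h * tan_fst (Y z) f + h z * hor X Y z f"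
    by (simp add: hor_def S M.connection_scale(2)[OF D_conn slice_vector_fields[OF X q] slice_vector_fields[OF Y q] slice_scale_smooth[OF h q]]
        algebra_simps)
qed

lemma hor_torsion:
  assumes X: "X \<in> vector_fields P" and Y: "Y \<in> vector_fields P" and z: "z \<in> points P"
  shows "hor X Y z f - hor Y X z f = tan_fst (lie_bracket P X Y z) f"
proof -
  have q: "snd z \<in> points N" and z': "(fst z, snd z) \<in> points P" using z by auto
  show ?thesis
    using fun_cong[OF lie_bracket_fst[OF X Y z'], of f]
      D_torsion[OF slice_vector_fields[OF X q] slice_vector_fields[OF Y q], of "fst z" f]
    by (simp add: hor_def)
qed

text \<open>Along a slice this is metric compatibility of \<open>D\<close>. Along the curve the
  inner product belongs to a fixed base point, and the bilinear product rule applies.\<close>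

lemma hor_metric:
  assumes X: "X \<in> vector_fields P" and Y: "Y \<in> vector_fields P" and Z: "Z \<in> vector_fields P" and z: "z \<in> points P"
  shows "X z (\<lambda>x. g (fst x) (tan_fst (Y x)) (tan_fst (Z x)))
     = g (fst z) (hor X Y z) (tan_fst (Z z)) + g (fst z) (tan_fst (Y z)) (hor X Z z)"
    and "(\<lambda>x. g (fst x) (tan_fst (Y x)) (tan_fst (Z x))) \<in> smooth_near P z"
proof -
  obtain p q where zpq: "z = (p, q)" by (cases z)
  have p: "p \<in> points M" and q: "q \<in> points N" and z': "(p, q) \<in> points P" using z by (auto simp: zpq)
  have S: "(\<lambda>x. g (fst x) (tan_fst (Y x)) (tan_fst (Z x))) \<in> smooth_near P (p, q)"
    using p by (intro PM.riemannian_metric_along[OF g_riemannian smooth_map_at_fst[OF z'] z' _ along_fst[OF Y z'] along_fst[OF Z z']]) simp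
  then show "(\<lambda>x. g (fst x) (tan_fst (Y x)) (tan_fst (Z x))) \<in> smooth_near P z" by (simp add: zpq)
  note sl = slice_vector_fields[OF _ q]
  have V: "slice W q p \<in> tangent_space M p" if "W \<in> vector_fields P" for W
    by (rule M.vector_fields_tangent[OF sl[OF that] p])
  have Dt: "D (slice X q) (slice W q) p \<in> tangent_space M p" if "W \<in> vector_fields P" for W
    by (rule M.vector_fields_tangent[OF D_field[OF sl[OF X] sl[OF that]] p])
  note dt = dT_tangent[OF _ z']
  have 1: "T q (\<lambda>y. g p (tan_fst (Y (p, y))) (tan_fst (Z (p, y)))) = g p (dT Y p q) (slice Z q p) + g p (slice Y q p) (dT Z p q)"
    unfolding dT_def by (rule NM.bilinear_derivative[OF T_tangent[OF q] along_curve[OF Y z'] along_curve[OF Z z'] g_linear g_linear'])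
  have 2: "slice X q p (\<lambda>x. g x (slice Y q x) (slice Z q x))
      = g p (D (slice X q) (slice Y q) p) (slice Z q p) + g p (slice Y q p) (D (slice X q) (slice Z q) p)"
    by (rule D_metric[OF sl[OF X] sl[OF Y] sl[OF Z] p])
  have 3: "g p (hor X Y (p, q)) (slice Z q p) = g p (D (slice X q) (slice Y q) p) (slice Z q p)
      + curve_coeff T (p, q) (X (p, q)) * g p (dT Y p q) (slice Z q p)"
    using linear_at_lincomb[OF g_linear'[OF V[OF Z]] Dt[OF Y] dt[OF Y], of 1 "curve_coeff T (p, q) (X (p, q))"]
    by (simp add: hor_def)
  have 4: "g p (slice Y q p) (hor X Z (p, q)) = g p (slice Y q p) (D (slice X q) (slice Z q) p)
      + curve_coeff T (p, q) (X (p, q)) * g p (slice Y q p) (dT Z p q)"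
    using linear_at_lincomb[OF g_linear[OF V[OF Y]] Dt[OF Z] dt[OF Z], of 1 "curve_coeff T (p, q) (X (p, q))"]
    by (simp add: hor_def)
  show "X z (\<lambda>x. g (fst x) (tan_fst (Y x)) (tan_fst (Z x)))
     = g (fst z) (hor X Y z) (tan_fst (Z z)) + g (fst z) (tan_fst (Y z)) (hor X Z z)"
    using tangent_apply[OF P.vector_fields_tangent[OF X z'] S]
    unfolding zpq fst_conv 3 4 1 2 by (simp add: 1 2 algebra_simps)
qed

text \<open>On slices \<open>J\<close> commutes with \<open>D\<close> because it is parallel. Along
  the curve \<open>J\<close> at the fixed base point is one linear map, which commutes with
  \<open>dT\<close>.\<close>

lemma hor_\<phi>:
  assumes X: "X \<in> vector_fields P" and Y: "Y \<in> vector_fields P" and z: "z \<in> points P"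
  shows "hor X (apply_endo P \<phi> Y) z = J (fst z) (hor X Y z)"
proof -
  obtain p q where zpq: "z = (p, q)" by (cases z)
  have p: "p \<in> points M" and q: "q \<in> points N" and z': "(p, q) \<in> points P" using z by (auto simp: zpq)
  note sl = slice_vector_fields[OF _ q]
  note Dt = M.vector_fields_tangent[OF D_field[OF sl[OF X] sl[OF Y]] p]
  have fst_eq: "tan_fst (apply_endo P \<phi> Y x) = J (fst x) (tan_fst (Y x))" if "x \<in> points P" for x
    using that tan_fst_\<phi>[OF P.vector_fields_tangent[OF Y that]] by (simp add: apply_endo_def)
  have "slice (apply_endo P \<phi> Y) q = apply_endo M J (slice Y q)"
  proof
    fix x
    show "slice (apply_endo P \<phi> Y) q x = apply_endo M J (slice Y q) x"
    proof (cases "x \<in> points M")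
      case True
      then show ?thesis using fst_eq[of "(x, q)"] q by (simp add: apply_endo_def)
    next
      case False
      then show ?thesis by (simp add: apply_endo_def tan_fst_zero)
    qed
  qed
  moreover have "D (slice X q) (apply_endo M J (slice Y q)) p f = J p (D (slice X q) (slice Y q) p) f" for f
    using fun_cong[OF parallel[OF sl[OF X] sl[OF Y] p], of f] by (simp add: cov_deriv_endo_def)
  moreover have "dT (apply_endo P \<phi> Y) p q f = J p (dT Y p q) f" for f
  proof -
    have "eventually (\<lambda>y. tan_fst (apply_endo P \<phi> Y (p, y)) f = J p (tan_fst (Y (p, y))) f) (nhdsin (mtop N) q)"
      using N.eventually_points by eventually_elim (use p fst_eq in auto)
    then have "dT (apply_endo P \<phi> Y) p q f = T q (\<lambda>y. J p (tan_fst (Y (p, y))) f)"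
      unfolding dT_def by (rule N.tangent_cong[OF T_tangent[OF q]])
    also have "\<dots> = J p (dT Y p q) f"
      by (rule dT_linear[OF Y z' J_linear[OF p]])
    finally show ?thesis .
  qed
  ultimately have "hor X (apply_endo P \<phi> Y) z = (\<lambda>f. 1 * J p (D (slice X q) (slice Y q) p) f + curve_coeff T (p, q) (X (p, q)) * J p (dT Y p q) f)"
    by (simp add: hor_def zpq)
  also have "\<dots> = J (fst z) (hor X Y z)"
    unfolding J_lincomb[OF Dt dT_tangent[OF Y z'], symmetric] by (simp add: hor_def zpq)
  finally show ?thesis .
qed

end

context hermitian_curve_prod
begin

section \<open>Necessity of \<alpha> = 1\<close>

lemma \<eta>_field: "Y \<in> vector_fields P \<Longrightarrow> z \<in> points P \<Longrightarrow> (\<lambda>x. \<eta> x (Y x)) \<in> smooth_near P z"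
  by (intro \<eta>_smooth P.vector_fields_smooth)

text \<open>The form \<eta> is the metric dual of \<xi>, so derivatives of \<eta> can be computed by
  metric compatibility.\<close>

lemma G_\<xi>:
  assumes w: "w \<in> tangent_space P z"
  shows "G z (\<xi> z) w = \<eta> z w" "G z w (\<xi> z) = \<eta> z w"
proof -
  have z: "z \<in> points P" by (rule P.tangent_points[OF w])
  have p: "fst z \<in> points M" using z by auto
  note u = tan_fst_tangent[OF w]
  have "g (fst z) (\<lambda>f. 0) (tan_fst w) = 0" "g (fst z) (tan_fst w) (\<lambda>f. 0) = 0"
    using M.linear_at_zero[OF g_linear'[OF u] p] M.linear_at_zero[OF g_linear[OF u] p] .
  then show "G z (\<xi> z) w = \<eta> z w" "G z w (\<xi> z) = \<eta> z w"
    unfolding G_eq tan_fst_\<xi>[OF z] \<eta>_\<xi>[OF z] by auto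
qed

lemma g_skew:
  assumes "u \<in> tangent_space M p" "v \<in> tangent_space M p"
  shows "g p v (J p u) = - g p u (J p v)"
  using g_J[OF assms] g_sym[OF J_tangent[OF assms(1)] assms(2)] by simp

text \<open>The counterpart of \<open>ext_deriv_\<eta>\<close> without \<alpha>. Differentiating
  \<eta>(W) as the inner product of \<xi> and \<open>W\<close> produces the derivative of \<xi>,
  which \<open>D\<xi>\<close> determines. Antisymmetrizing doubles the skew term, and
  torsion-freeness identifies the rest with \<eta> of the bracket.\<close>

lemma sasakian_ext_deriv_\<eta>:
  assumes S: "sasakian_manifold P \<phi> \<xi> \<eta> G"
    and X: "X \<in> vector_fields P" and Y: "Y \<in> vector_fields P" and z: "z \<in> points P"
  shows "X z (\<lambda>x. \<eta> x (Y x)) - Y z (\<lambda>x. \<eta> x (X x)) - \<eta> z (lie_bracket P X Y z)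
    = 2 * g (fst z) (tan_fst (X z)) (J (fst z) (tan_fst (Y z)))"
proof -
  obtain D where lc: "levi_civita P G D" and sas: "\<And>X Y z. X \<in> vector_fields P \<Longrightarrow> Y \<in> vector_fields P \<Longrightarrow> z \<in> points P \<Longrightarrow>
      cov_deriv_endo P D \<phi> X Y z = (\<lambda>f. G z (X z) (Y z) * \<xi> z f - \<eta> z (Y z) * X z f)"
    using S unfolding sasakian_manifold_def by blast
  have conn: "affine_connection P D"
    using lc unfolding levi_civita_def by (rule conjunct1)
  have metric: "Z z (\<lambda>q. G q (V q) (W q)) = G z (D Z V z) (W z) + G z (V z) (D Z W z)"
    if "Z \<in> vector_fields P" "V \<in> vector_fields P" "W \<in> vector_fields P" for Z V W
    using lc[unfolded levi_civita_def, THEN conjunct2, THEN conjunct2] that z by blast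
  have p: "fst z \<in> points M" using z by auto
  note t = P.vector_fields_tangent[OF _ z]
  note Dt = t[OF P.connection_vector_fields[OF conn]]
  have "apply_endo P \<phi> \<xi> = (\<lambda>x f. 0)"
  proof
    fix x show "apply_endo P \<phi> \<xi> x = (\<lambda>f. 0)"
    proof (cases "x \<in> points P")
      case True
      have px: "fst x \<in> points M" using True by auto
      note \<xi>x = \<xi>_tangent[OF True]
      have "tan_fst (\<phi> x (\<xi> x)) = (\<lambda>f. 0)"
        unfolding tan_fst_\<phi>[OF \<xi>x] tan_fst_\<xi>[OF True]
        using M.linear_at_zero[OF J_linear[OF px] px] by blast
      then have "\<phi> x (\<xi> x) = (\<lambda>f. 0)"
        by (intro tangent_ext[OF \<phi>_tangent[OF \<xi>x] P.tangent_zero[OF True]])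
          (simp_all only: tan_fst_zero \<eta>_\<phi>[OF \<xi>x] P.linear_at_zero[OF \<eta>_linear[OF True] True])
      then show ?thesis using True by (simp add: apply_endo_def)
    next
      case False
      then show ?thesis by (simp only: apply_endo_def if_False)
    qed
  qed
  then have D0: "D Z (apply_endo P \<phi> \<xi>) = (\<lambda>x f. 0)" if "Z \<in> vector_fields P" for Z
    using P.connection_zero(2)[OF conn that] by simp
  have D\<xi>: "tan_fst (D Z \<xi> z) = (\<lambda>f. - J (fst z) (tan_fst (Z z)) f)" "\<eta> z (D Z \<xi> z) = 0"
    if Z: "Z \<in> vector_fields P" for Z
  proof -
    note w = Dt[OF Z \<xi>_field]
    \<comment> \<open>The Sasakian equation for the field \<xi>, where \<phi> \<xi> = 0 removes the
      first term of the covariant derivative of \<phi>. Projecting and applying \<open>J\<close>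
      once more then isolates the horizontal part of \<open>D Z \<xi>\<close>.\<close>
    have "\<phi> z (D Z \<xi> z) f = 1 * Z z f + (- G z (Z z) (\<xi> z)) * \<xi> z f" for f
      using fun_cong[OF sas[OF Z \<xi>_field z], of f] \<eta>_\<xi>[OF z] by (simp add: cov_deriv_endo_def D0[OF Z])
    then have "\<phi> z (D Z \<xi> z) = (\<lambda>f. 1 * Z z f + (- G z (Z z) (\<xi> z)) * \<xi> z f)" by blast
    then have "tan_fst (\<phi> z (D Z \<xi> z)) = (\<lambda>f. 1 * tan_fst (Z z) f + (- G z (Z z) (\<xi> z)) * tan_fst (\<xi> z) f)"
      by (simp only: tan_fst_lincomb)
    then have "J (fst z) (tan_fst (D Z \<xi> z)) = tan_fst (Z z)"
      by (simp add: tan_fst_\<phi>[OF w] tan_fst_\<xi>[OF z])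
    then have "(\<lambda>f. - tan_fst (D Z \<xi> z) f) = J (fst z) (tan_fst (Z z))"
      using JJ[OF tan_fst_tangent[OF w]] by simp
    then have "- tan_fst (D Z \<xi> z) f = J (fst z) (tan_fst (Z z)) f" for f by (rule fun_cong)
    then have "tan_fst (D Z \<xi> z) f = - J (fst z) (tan_fst (Z z)) f" for f by (metis minus_minus)
    then show "tan_fst (D Z \<xi> z) = (\<lambda>f. - J (fst z) (tan_fst (Z z)) f)" by blast
    \<comment> \<open>The field \<xi> has constant length, so its covariant derivatives are
      orthogonal to it. This supplies the component that \<phi> does not see.\<close>
    have "eventually (\<lambda>x. G x (\<xi> x) (\<xi> x) = 1) (nhdsin (mtop P) z)"
      using P.eventually_points by eventually_elim (simp only: G_\<xi>(1)[OF \<xi>_tangent] \<eta>_\<xi>)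
    then have "Z z (\<lambda>x. G x (\<xi> x) (\<xi> x)) = Z z (\<lambda>x. 1)"
      by (rule P.tangent_cong[OF t[OF Z]])
    then have "2 * \<eta> z (D Z \<xi> z) = 0"
      using metric[OF Z \<xi>_field \<xi>_field] P.tangent_const[OF t[OF Z]] by (simp add: G_\<xi>[OF w])
    then show "\<eta> z (D Z \<xi> z) = 0" by simp
  qed
  have E: "Z z (\<lambda>x. \<eta> x (W x)) = g (fst z) (tan_fst (Z z)) (J (fst z) (tan_fst (W z))) + \<eta> z (D Z W z)"
    if Z: "Z \<in> vector_fields P" and W: "W \<in> vector_fields P" for Z W
  proof -
    note Z1 = tan_fst_tangent[OF t[OF Z]] and W1 = tan_fst_tangent[OF t[OF W]]
    have "eventually (\<lambda>x. \<eta> x (W x) = G x (\<xi> x) (W x)) (nhdsin (mtop P) z)"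
      using P.eventually_points by eventually_elim (simp only: G_\<xi>(1)[OF P.vector_fields_tangent[OF W]])
    then have "Z z (\<lambda>x. \<eta> x (W x)) = Z z (\<lambda>x. G x (\<xi> x) (W x))"
      by (rule P.tangent_cong[OF t[OF Z]])
    also have "\<dots> = G z (D Z \<xi> z) (W z) + \<eta> z (D Z W z)"
      by (simp only: metric[OF Z \<xi>_field W] G_\<xi>(1)[OF Dt[OF Z W]])
    also have "G z (D Z \<xi> z) (W z) = g (fst z) (tan_fst (Z z)) (J (fst z) (tan_fst (W z)))"
      unfolding G_eq D\<xi>[OF Z] M.linear_at_uminus[OF g_linear'[OF W1] J_tangent[OF Z1]] g_J[OF Z1 W1] by simp
    finally show ?thesis .
  qed
  have "(\<lambda>p f. D X Y p f - D Y X p f) = lie_bracket P X Y"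
    using lc[unfolded levi_civita_def, THEN conjunct2, THEN conjunct1] X Y by simp
  then have "lie_bracket P X Y z = (\<lambda>f. D X Y z f - D Y X z f)" by (rule fun_cong[OF sym])
  then have "\<eta> z (lie_bracket P X Y z) = \<eta> z (D X Y z) - \<eta> z (D Y X z)"
    using P.linear_at_sub[OF \<eta>_linear[OF z] Dt[OF X Y] Dt[OF Y X]] by simp
  then show ?thesis
    using g_skew[OF tan_fst_tangent[OF t[OF X]] tan_fst_tangent[OF t[OF Y]]]
    by (simp add: E[OF X Y] E[OF Y X])
qed

text \<open>The horizontal lift, characterized by \<eta> = 0. It provides test fields on the product
  with prescribed projection.\<close>

lemma lift_field:
  assumes W: "W \<in> vector_fields M"
  shows "(\<lambda>z. if z \<in> points P then comb z (W (fst z)) 0 else (\<lambda>f. 0)) \<in> vector_fields P" (is "?L \<in> _")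
proof (rule P.vector_fieldsI)
  fix z assume z: "z \<in> points P"
  have p: "fst z \<in> points M" using z by auto
  have "eventually (\<lambda>x. W (fst x) \<in> tangent_space M (fst x)) (nhdsin (mtop P) z)"
    using P.eventually_points by eventually_elim (auto intro: M.vector_fields_tangent[OF W])
  then have "smooth_along P M fst z (\<lambda>x. W (fst x))"
    unfolding smooth_along_def
    using PM.smooth_near_along[OF smooth_map_at_fst[OF z] M.vector_fields_apply_smooth[OF W]] by blast
  then have S: "smooth_field P z (\<lambda>x. comb x (W (fst x)) 0)"
    by (rule comb_smooth[OF z _ P.smooth_near_const[OF z]])
  have "eventually (\<lambda>x. comb x (W (fst x)) 0 = ?L x) (nhdsin (mtop P) z)"
    using P.eventually_points by eventually_elim (simp only: if_True)
  then show "smooth_field P z ?L" using S by (rule P.self.smooth_along_cong)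
qed (simp only: if_False)

text \<open>With two expressions for the exterior derivative of \<eta> at hand, fields with nonzero
  fundamental form at one point suffice. For a bumped coordinate field \<open>Y\<close> that does
  not vanish at \<open>p\<close>, the pair \<open>J Y\<close>, \<open>Y\<close> gives the squared
  length of \<open>J Y\<close>, which is positive; the lifts of both fields carry it to the
  product.\<close>

lemma sasakian_imp_eq_1:
  assumes d\<omega>: "\<And>X Y p. X \<in> vector_fields M \<Longrightarrow> Y \<in> vector_fields M \<Longrightarrow> p \<in> points M \<Longrightarrow>
      ext_deriv M \<omega> X Y p = fundamental_form J g X Y p"
    and S: "sasakian_manifold P \<phi> \<xi> \<eta> G"
  shows "\<alpha> = 1"
proof -
  obtain p q where p: "p \<in> points M" and q: "q \<in> points N"
    using M.smooth_mfd N.smooth_mfd unfolding smooth_manifold_def by blast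
  have z: "(p, q) \<in> points P" using p q by simp
  obtain U c where Uc: "(U, c) \<in> atlas M" "p \<in> U" using p by (rule M.chart_at)
  obtain \<rho> where \<rho>: "bump_on M U \<rho>" "\<rho> p > 0" using Uc by (rule M.bump_exists)
  obtain b :: 'b where b: "b \<in> Basis" using nonempty_Basis by blast
  define Y where "Y = (\<lambda>q f. \<rho> q * coord_vec M (U, c) q b f)"
  have Y: "Y \<in> vector_fields M" unfolding Y_def by (rule M.bump_coord_field[OF \<rho>(1) Uc(1)])
  have "Y p (\<lambda>q. c q \<bullet> b) \<noteq> 0"
    using \<rho>(2) b by (simp add: Y_def M.coord_vec_coord[OF Uc] inner_same_Basis)
  then have ne: "Y p \<noteq> (\<lambda>f. 0)" by auto
  have X: "apply_endo M J Y \<in> vector_fields M" by (rule M.apply_endo_vector_fields[OF J_endo Y])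
  note Yp = M.vector_fields_tangent[OF Y p]
  define lift where "lift W z = (if z \<in> points P then comb z (W (fst z)) 0 else (\<lambda>f. 0))" for W z
  have lift: "lift W \<in> vector_fields P" if "W \<in> vector_fields M" for W
    unfolding lift_def[abs_def] by (rule lift_field[OF that])
  have fst_lift: "tan_fst (lift W (p, q)) = W p" if "W \<in> vector_fields M" for W
    using tan_fst_comb[of "W p" "(p, q)"] M.vector_fields_tangent[OF that p] z by (simp add: lift_def)
  have JY: "apply_endo M J Y p = J p (Y p)" using p by (simp add: apply_endo_def)
  have "2 * \<alpha> * g (fst (p, q)) (tan_fst (lift (apply_endo M J Y) (p, q))) (J (fst (p, q)) (tan_fst (lift Y (p, q))))
      = 2 * g (fst (p, q)) (tan_fst (lift (apply_endo M J Y) (p, q))) (J (fst (p, q)) (tan_fst (lift Y (p, q))))"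
    unfolding sasakian_ext_deriv_\<eta>[OF S lift[OF X] lift[OF Y] z, symmetric]
    by (rule ext_deriv_\<eta>[OF d\<omega> lift[OF X] lift[OF Y] z, symmetric])
  then have "2 * \<alpha> * g p (J p (Y p)) (J p (Y p)) = 2 * g p (J p (Y p)) (J p (Y p))"
    unfolding fst_lift[OF X] fst_lift[OF Y] JY fst_conv .
  moreover have "g p (J p (Y p)) (J p (Y p)) > 0"
    using g_JJ[OF Yp Yp] g_pos[OF Yp ne] by simp
  ultimately show ?thesis by simp
qed

end

section \<open>Sufficiency of \<alpha> = 1\<close>

context kaehler_curve_prod
begin

text \<open>The formula is forced by torsion-freeness and metric compatibility: \<open>(M, g)\<close> is the base of a
  Riemannian submersion with fibres tangent to \<open>\<xi>\<close>, and \<open>\<xi>\<close> has covariant derivative \<open>-\<phi>\<close>.\<close>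

definition nabla :: "('a \<times> 'c \<Rightarrow> ('a \<times> 'c) tvec) \<Rightarrow> ('a \<times> 'c \<Rightarrow> ('a \<times> 'c) tvec) \<Rightarrow> 'a \<times> 'c \<Rightarrow> ('a \<times> 'c) tvec" where
  "nabla X Y z = (if z \<in> points P then comb z
      (\<lambda>f. hor X Y z f - (\<eta> z (X z) * J (fst z) (tan_fst (Y z)) f + \<eta> z (Y z) * J (fst z) (tan_fst (X z)) f))
      (X z (\<lambda>x. \<eta> x (Y x)) + g (fst z) (tan_fst (Y z)) (J (fst z) (tan_fst (X z)))) else (\<lambda>f. 0))"

lemma
  assumes X: "X \<in> vector_fields P" and Y: "Y \<in> vector_fields P" and z: "z \<in> points P"
  shows nabla_tangent: "nabla X Y z \<in> tangent_space P z"
    and tan_fst_nabla: "tan_fst (nabla X Y z) = (\<lambda>f. hor X Y z f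
      - (\<eta> z (X z) * J (fst z) (tan_fst (Y z)) f + \<eta> z (Y z) * J (fst z) (tan_fst (X z)) f))"
    and \<eta>_nabla: "\<eta> z (nabla X Y z)
      = X z (\<lambda>x. \<eta> x (Y x)) + g (fst z) (tan_fst (Y z)) (J (fst z) (tan_fst (X z)))"
proof -
  have "(\<lambda>f. hor X Y z f - (\<eta> z (X z) * J (fst z) (tan_fst (Y z)) f + \<eta> z (Y z) * J (fst z) (tan_fst (X z)) f))
      \<in> tangent_space M (fst z)"
    by (intro M.tangent_sub M.tangent_lincomb hor_tangent X Y z J_tangent tan_fst_tangent P.vector_fields_tangent[OF _ z])
  note comb_tangent[OF this z] tan_fst_comb[OF this z] \<eta>_comb[OF this z]
  then show "nabla X Y z \<in> tangent_space P z"
    "tan_fst (nabla X Y z) = (\<lambda>f. hor X Y z f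
      - (\<eta> z (X z) * J (fst z) (tan_fst (Y z)) f + \<eta> z (Y z) * J (fst z) (tan_fst (X z)) f))"
    "\<eta> z (nabla X Y z) = X z (\<lambda>x. \<eta> x (Y x)) + g (fst z) (tan_fst (Y z)) (J (fst z) (tan_fst (X z)))"
    by (simp_all only: nabla_def z if_True)
qed

lemma nabla_outside: "z \<notin> points P \<Longrightarrow> nabla X Y z = (\<lambda>f. 0)"
  by (simp only: nabla_def if_False)

lemma nabla_field:
  assumes X: "X \<in> vector_fields P" and Y: "Y \<in> vector_fields P"
  shows "nabla X Y \<in> vector_fields P"
proof (rule P.vector_fieldsI)
  fix z assume z: "z \<in> points P"
  have p: "fst z \<in> points M" using z by auto
  note sX = along_fst[OF X z] and sY = along_fst[OF Y z]
  note \<pi> = smooth_map_at_fst[OF z]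
  have J: "smooth_along P M fst z (\<lambda>x. J (fst x) (tan_fst (Z x)))" if "Z \<in> vector_fields P" for Z
    by (rule PM.endo_field_along[OF J_endo \<pi> z p along_fst[OF that z]])
  have S: "smooth_field P z (\<lambda>z. comb z
      (\<lambda>f. hor X Y z f - (\<eta> z (X z) * J (fst z) (tan_fst (Y z)) f + \<eta> z (Y z) * J (fst z) (tan_fst (X z)) f))
      (X z (\<lambda>x. \<eta> x (Y x)) + g (fst z) (tan_fst (Y z)) (J (fst z) (tan_fst (X z)))))"
  proof (rule comb_smooth[OF z])
    show "smooth_along P M fst z (\<lambda>z f. hor X Y z f
        - (\<eta> z (X z) * J (fst z) (tan_fst (Y z)) f + \<eta> z (Y z) * J (fst z) (tan_fst (X z)) f))"
      by (rule PM.smooth_along_diff[OF hor_smooth[OF X Y z] PM.smooth_along_plus[OF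
            PM.smooth_along_scale[OF \<eta>_field[OF X z] J[OF Y]] PM.smooth_along_scale[OF \<eta>_field[OF Y z] J[OF X]]] z])
    show "(\<lambda>z. X z (\<lambda>x. \<eta> x (Y x)) + g (fst z) (tan_fst (Y z)) (J (fst z) (tan_fst (X z)))) \<in> smooth_near P z"
      by (rule P.smooth_near_add[OF P.vector_fields_apply_smooth[OF X \<eta>_field[OF Y z]]
            PM.riemannian_metric_along[OF g_riemannian \<pi> z p sY J[OF X]]])
  qed
  have "eventually (\<lambda>z. comb z
      (\<lambda>f. hor X Y z f - (\<eta> z (X z) * J (fst z) (tan_fst (Y z)) f + \<eta> z (Y z) * J (fst z) (tan_fst (X z)) f))
      (X z (\<lambda>x. \<eta> x (Y x)) + g (fst z) (tan_fst (Y z)) (J (fst z) (tan_fst (X z)))) = nabla X Y z) (nhdsin (mtop P) z)"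
    using P.eventually_points by eventually_elim (simp only: nabla_def if_True)
  then show "smooth_field P z (nabla X Y)" using S by (rule P.self.smooth_along_cong)
qed (rule nabla_outside)

lemma J_add: "u \<in> tangent_space M p \<Longrightarrow> v \<in> tangent_space M p \<Longrightarrow> J p (\<lambda>f. u f + v f) f = J p u f + J p v f"
  using J_lincomb[of u p v 1 1] by simp

lemma J_scale: "u \<in> tangent_space M p \<Longrightarrow> J p (\<lambda>f. a * u f) f = a * J p u f"
  using J_lincomb[of u p u a 0] by simp

lemma J_sub: "u \<in> tangent_space M p \<Longrightarrow> v \<in> tangent_space M p \<Longrightarrow> J p (\<lambda>f. u f - v f) = (\<lambda>f. J p u f - J p v f)"
  using J_lincomb[of u p v 1 "-1"] by simp

lemma tan_fst_add: "tan_fst (\<lambda>f. u f + v f) = (\<lambda>f. tan_fst u f + tan_fst v f)"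
  and tan_fst_scale: "tan_fst (\<lambda>f. a * u f) = (\<lambda>f. a * tan_fst u f)"
  and tan_fst_sub: "tan_fst (\<lambda>f. u f - v f) = (\<lambda>f. tan_fst u f - tan_fst v f)"
  by (simp_all add: tan_fst_def)

lemma nabla_add_left:
  assumes X: "X \<in> vector_fields P" and Y: "Y \<in> vector_fields P" and Z: "Z \<in> vector_fields P"
  shows "nabla (\<lambda>p f. X p f + Y p f) Z = (\<lambda>p f. nabla X Z p f + nabla Y Z p f)"
proof
  fix z
  show "nabla (\<lambda>p f. X p f + Y p f) Z z = (\<lambda>f. nabla X Z z f + nabla Y Z z f)"
  proof (cases "z \<in> points P")
    case z: True
    note XY = P.vector_fields_plus[OF X Y]
    note t = P.vector_fields_tangent[OF _ z]
    note t1 = tan_fst_tangent[OF t]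
    note n = nabla_tangent[OF X Z z] nabla_tangent[OF Y Z z]
    show ?thesis
    proof (rule tangent_ext[OF nabla_tangent[OF XY Z z] P.tangent_plus[OF n]])
      show "tan_fst (nabla (\<lambda>p f. X p f + Y p f) Z z) = tan_fst (\<lambda>f. nabla X Z z f + nabla Y Z z f)"
        unfolding tan_fst_add tan_fst_nabla[OF XY Z z] tan_fst_nabla[OF X Z z] tan_fst_nabla[OF Y Z z]
          hor_add_left[OF X Y Z z] P.linear_at_add[OF \<eta>_linear[OF z] t[OF X] t[OF Y]] J_add[OF t1[OF X] t1[OF Y]]
        by (simp add: algebra_simps)
      have J: "J (fst z) (\<lambda>f. tan_fst (X z) f + tan_fst (Y z) f) = (\<lambda>f. J (fst z) (tan_fst (X z)) f + J (fst z) (tan_fst (Y z)) f)"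
        using J_add[OF t1[OF X] t1[OF Y]] by blast
      show "\<eta> z (nabla (\<lambda>p f. X p f + Y p f) Z z) = \<eta> z (\<lambda>f. nabla X Z z f + nabla Y Z z f)"
        unfolding P.linear_at_add[OF \<eta>_linear[OF z] n] \<eta>_nabla[OF XY Z z] \<eta>_nabla[OF X Z z] \<eta>_nabla[OF Y Z z]
          tan_fst_add J M.linear_at_add[OF g_linear[OF t1[OF Z]] J_tangent[OF t1[OF X]] J_tangent[OF t1[OF Y]]]
        by (simp add: algebra_simps)
    qed
  next
    case False
    then show ?thesis by (simp only: nabla_outside[OF False] add_0)
  qed
qed

lemma nabla_add_right:
  assumes X: "X \<in> vector_fields P" and Y: "Y \<in> vector_fields P" and Z: "Z \<in> vector_fields P"
  shows "nabla X (\<lambda>p f. Y p f + Z p f) = (\<lambda>p f. nabla X Y p f + nabla X Z p f)"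
proof
  fix z
  show "nabla X (\<lambda>p f. Y p f + Z p f) z = (\<lambda>f. nabla X Y z f + nabla X Z z f)"
  proof (cases "z \<in> points P")
    case z: True
    note YZ = P.vector_fields_plus[OF Y Z]
    note t = P.vector_fields_tangent[OF _ z]
    note t1 = tan_fst_tangent[OF t]
    note n = nabla_tangent[OF X Y z] nabla_tangent[OF X Z z]
    have "eventually (\<lambda>x. \<eta> x (\<lambda>f. Y x f + Z x f) = \<eta> x (Y x) + \<eta> x (Z x)) (nhdsin (mtop P) z)"
      using P.eventually_points
      by eventually_elim (rule P.linear_at_add[OF \<eta>_linear P.vector_fields_tangent[OF Y] P.vector_fields_tangent[OF Z]])
    then have X\<eta>: "X z (\<lambda>x. \<eta> x (\<lambda>f. Y x f + Z x f)) = X z (\<lambda>x. \<eta> x (Y x)) + X z (\<lambda>x. \<eta> x (Z x))"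
      unfolding P.tangent_add[OF t[OF X] \<eta>_field[OF Y z] \<eta>_field[OF Z z], symmetric]
      by (rule P.tangent_cong[OF t[OF X]])
    show ?thesis
    proof (rule tangent_ext[OF nabla_tangent[OF X YZ z] P.tangent_plus[OF n]])
      show "tan_fst (nabla X (\<lambda>p f. Y p f + Z p f) z) = tan_fst (\<lambda>f. nabla X Y z f + nabla X Z z f)"
        unfolding tan_fst_add tan_fst_nabla[OF X YZ z] tan_fst_nabla[OF X Y z] tan_fst_nabla[OF X Z z]
          hor_add_right[OF X Y Z z] P.linear_at_add[OF \<eta>_linear[OF z] t[OF Y] t[OF Z]] J_add[OF t1[OF Y] t1[OF Z]]
        by (simp add: algebra_simps)
      show "\<eta> z (nabla X (\<lambda>p f. Y p f + Z p f) z) = \<eta> z (\<lambda>f. nabla X Y z f + nabla X Z z f)"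
        unfolding P.linear_at_add[OF \<eta>_linear[OF z] n] \<eta>_nabla[OF X YZ z] \<eta>_nabla[OF X Y z] \<eta>_nabla[OF X Z z]
          tan_fst_add X\<eta> M.linear_at_add[OF g_linear'[OF J_tangent[OF t1[OF X]]] t1[OF Y] t1[OF Z]]
        by (simp add: algebra_simps)
    qed
  next
    case False
    then show ?thesis by (simp only: nabla_outside[OF False] add_0)
  qed
qed

lemma nabla_scale_left:
  assumes X: "X \<in> vector_fields P" and Y: "Y \<in> vector_fields P" and h: "msmooth_on P (points P) h"
  shows "nabla (\<lambda>p f. h p * X p f) Y = (\<lambda>p f. h p * nabla X Y p f)"
proof
  fix z
  show "nabla (\<lambda>p f. h p * X p f) Y z = (\<lambda>f. h z * nabla X Y z f)"
  proof (cases "z \<in> points P")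
    case z: True
    note hX = P.vector_fields_scale[OF X h]
    note t = P.vector_fields_tangent[OF _ z]
    note t1 = tan_fst_tangent[OF t]
    note n = nabla_tangent[OF X Y z]
    show ?thesis
    proof (rule tangent_ext[OF nabla_tangent[OF hX Y z] P.tangent_scale[OF n]])
      show "tan_fst (nabla (\<lambda>p f. h p * X p f) Y z) = tan_fst (\<lambda>f. h z * nabla X Y z f)"
        unfolding tan_fst_scale tan_fst_nabla[OF hX Y z] tan_fst_nabla[OF X Y z]
          hor_scale_left[OF X Y h z] P.linear_at_scale[OF \<eta>_linear[OF z] t[OF X]] J_scale[OF t1[OF X]]
        by (simp add: algebra_simps)
      have J: "J (fst z) (\<lambda>f. h z * tan_fst (X z) f) = (\<lambda>f. h z * J (fst z) (tan_fst (X z)) f)"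
        using J_scale[OF t1[OF X]] by blast
      show "\<eta> z (nabla (\<lambda>p f. h p * X p f) Y z) = \<eta> z (\<lambda>f. h z * nabla X Y z f)"
        unfolding P.linear_at_scale[OF \<eta>_linear[OF z] n] \<eta>_nabla[OF hX Y z] \<eta>_nabla[OF X Y z]
          tan_fst_scale J M.linear_at_scale[OF g_linear[OF t1[OF Y]] J_tangent[OF t1[OF X]]]
        by (simp add: algebra_simps)
    qed
  next
    case False
    then show ?thesis by (simp only: nabla_outside[OF False] mult_zero_right)
  qed
qed

lemma nabla_scale_right:
  assumes X: "X \<in> vector_fields P" and Y: "Y \<in> vector_fields P" and h: "msmooth_on P (points P) h"
  shows "nabla X (\<lambda>p f. h p * Y p f) = (\<lambda>p f. X p h * Y p f + h p * nabla X Y p f)"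
proof
  fix z
  show "nabla X (\<lambda>p f. h p * Y p f) z = (\<lambda>f. X z h * Y z f + h z * nabla X Y z f)"
  proof (cases "z \<in> points P")
    case z: True
    note hY = P.vector_fields_scale[OF Y h]
    note t = P.vector_fields_tangent[OF _ z]
    note t1 = tan_fst_tangent[OF t]
    note n = nabla_tangent[OF X Y z]
    have hs: "h \<in> smooth_near P z"
      using h z unfolding P.msmooth_on_iff[OF openin_topspace] by blast
    have "eventually (\<lambda>x. \<eta> x (\<lambda>f. h x * Y x f) = h x * \<eta> x (Y x)) (nhdsin (mtop P) z)"
      using P.eventually_points
      by eventually_elim (rule P.linear_at_scale[OF \<eta>_linear P.vector_fields_tangent[OF Y]])
    then have X\<eta>: "X z (\<lambda>x. \<eta> x (\<lambda>f. h x * Y x f)) = X z h * \<eta> z (Y z) + h z * X z (\<lambda>x. \<eta> x (Y x))"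
      unfolding P.tangent_mult[OF t[OF X] hs \<eta>_field[OF Y z], symmetric]
      by (rule P.tangent_cong[OF t[OF X]])
    show ?thesis
    proof (rule tangent_ext[OF nabla_tangent[OF X hY z] P.tangent_lincomb[OF t[OF Y] n]])
      show "tan_fst (nabla X (\<lambda>p f. h p * Y p f) z) = tan_fst (\<lambda>f. X z h * Y z f + h z * nabla X Y z f)"
        unfolding tan_fst_lincomb tan_fst_scale tan_fst_nabla[OF X hY z] tan_fst_nabla[OF X Y z]
          hor_scale_right[OF X Y h z] P.linear_at_scale[OF \<eta>_linear[OF z] t[OF Y]] J_scale[OF t1[OF Y]]
        by (simp add: algebra_simps)
      show "\<eta> z (nabla X (\<lambda>p f. h p * Y p f) z) = \<eta> z (\<lambda>f. X z h * Y z f + h z * nabla X Y z f)"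
        unfolding linear_at_lincomb[OF \<eta>_linear[OF z] t[OF Y] n] \<eta>_nabla[OF X hY z] \<eta>_nabla[OF X Y z]
          tan_fst_scale X\<eta> M.linear_at_scale[OF g_linear'[OF J_tangent[OF t1[OF X]]] t1[OF Y]]
        by (simp add: algebra_simps)
    qed
  next
    case False
    then show ?thesis by (simp only: nabla_outside[OF False] P.vector_fields_outside[OF Y False] mult_zero_right add_0)
  qed
qed

lemma nabla_connection: "affine_connection P nabla"
  unfolding affine_connection_def
  by (intro conjI ballI allI impI nabla_field nabla_add_left nabla_add_right nabla_scale_left nabla_scale_right)

text \<open>Beyond \<open>hor_metric\<close>, the terms with \<eta>(X) cancel because
  \<open>J\<close> is skew-adjoint. The horizontal corrections with \<eta>(Y) and \<eta>(Z) cancel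
  against the vertical terms \<open>g (Z, J X)\<close> and \<open>g (Y, J X)\<close> of the other
  derivative.\<close>

lemma nabla_metric:
  assumes X: "X \<in> vector_fields P" and Y: "Y \<in> vector_fields P" and Z: "Z \<in> vector_fields P" and z: "z \<in> points P"
  shows "X z (\<lambda>x. G x (Y x) (Z x)) = G z (nabla X Y z) (Z z) + G z (Y z) (nabla X Z z)"
proof -
  note t = P.vector_fields_tangent[OF _ z]
  note t1 = tan_fst_tangent[OF t]
  note h = hor_tangent[OF X _ z]
  have C: "(\<lambda>f. \<eta> z (X z) * J (fst z) (tan_fst (W z)) f + \<eta> z (W z) * J (fst z) (tan_fst (X z)) f) \<in> tangent_space M (fst z)"
    if "W \<in> vector_fields P" for W
    by (intro M.tangent_lincomb J_tangent t1 X that)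
  have L: "g (fst z) (tan_fst (nabla X W z)) v = g (fst z) (hor X W z) v
      - (\<eta> z (X z) * g (fst z) (J (fst z) (tan_fst (W z))) v + \<eta> z (W z) * g (fst z) (J (fst z) (tan_fst (X z))) v)"
    if W: "W \<in> vector_fields P" and v: "v \<in> tangent_space M (fst z)" for W v
    unfolding tan_fst_nabla[OF X W z] M.linear_at_sub[OF g_linear'[OF v] h[OF W] C[OF W]]
      linear_at_lincomb[OF g_linear'[OF v] J_tangent[OF t1[OF W]] J_tangent[OF t1[OF X]]] ..
  have nt: "tan_fst (nabla X Z z) \<in> tangent_space M (fst z)"
    by (rule tan_fst_tangent[OF nabla_tangent[OF X Z z]])
  have "X z (\<lambda>x. G x (Y x) (Z x)) = X z (\<lambda>x. g (fst x) (tan_fst (Y x)) (tan_fst (Z x)))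
      + (X z (\<lambda>x. \<eta> x (Y x)) * \<eta> z (Z z) + \<eta> z (Y z) * X z (\<lambda>x. \<eta> x (Z x)))"
    unfolding G_eq
    using P.tangent_add[OF t[OF X] hor_metric(2)[OF X Y Z z] P.smooth_near_mult[OF \<eta>_field[OF Y z] \<eta>_field[OF Z z]]]
      P.tangent_mult[OF t[OF X] \<eta>_field[OF Y z] \<eta>_field[OF Z z]] by simp
  also have "X z (\<lambda>x. g (fst x) (tan_fst (Y x)) (tan_fst (Z x)))
      = g (fst z) (hor X Y z) (tan_fst (Z z)) + g (fst z) (hor X Z z) (tan_fst (Y z))"
    using hor_metric(1)[OF X Y Z z] g_sym[OF t1[OF Y] h[OF Z]] by simp
  finally have 1: "X z (\<lambda>x. G x (Y x) (Z x)) = g (fst z) (hor X Y z) (tan_fst (Z z)) + g (fst z) (hor X Z z) (tan_fst (Y z))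
      + (X z (\<lambda>x. \<eta> x (Y x)) * \<eta> z (Z z) + \<eta> z (Y z) * X z (\<lambda>x. \<eta> x (Z x)))" .
  have 2: "g (fst z) (J (fst z) (tan_fst (Z z))) (tan_fst (Y z)) = - g (fst z) (J (fst z) (tan_fst (Y z))) (tan_fst (Z z))"
    using g_J[OF t1[OF Z] t1[OF Y]] g_sym[OF t1[OF Z] J_tangent[OF t1[OF Y]]] by simp
  have 3: "g (fst z) (tan_fst (W z)) (J (fst z) (tan_fst (X z))) = g (fst z) (J (fst z) (tan_fst (X z))) (tan_fst (W z))"
    if "W \<in> vector_fields P" for W
    by (rule g_sym[OF t1[OF that] J_tangent[OF t1[OF X]]])
  show ?thesis
    unfolding 1 unfolding G_eq g_sym[OF t1[OF Y] nt] L[OF Y t1[OF Z]] L[OF Z t1[OF Y]]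
      \<eta>_nabla[OF X Y z] \<eta>_nabla[OF X Z z] 2 3[OF Y] 3[OF Z]
    by (simp add: algebra_simps)
qed

text \<open>By \<open>hor_\<phi>\<close> the pulled-back derivatives cancel. Since the square of
  \<open>J\<close> is \<open>-1\<close>, \<phi> turns the corrections into \<eta>(X) Y + \<eta>(Y)
  X; the first summand also arises from the derivative of \<phi> Y, so -\<eta>(Y) X remains on the
  base. Under \<eta> both sides equal the base inner product of \<open>X\<close> and
  \<open>Y\<close>, because \<eta>(\<phi> Y) = 0 and \<open>J\<close> is an isometry.\<close>

lemma nabla_sasakian:
  assumes X: "X \<in> vector_fields P" and Y: "Y \<in> vector_fields P" and z: "z \<in> points P"
  shows "cov_deriv_endo P nabla \<phi> X Y z = (\<lambda>f. G z (X z) (Y z) * \<xi> z f - \<eta> z (Y z) * X z f)"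
proof -
  note \<phi>Y = P.apply_endo_vector_fields[OF \<phi>_endo Y]
  note t = P.vector_fields_tangent[OF _ z]
  note t1 = tan_fst_tangent[OF t]
  note n = nabla_tangent[OF X Y z] and n' = nabla_tangent[OF X \<phi>Y z]
  have \<phi>Yz: "apply_endo P \<phi> Y x = \<phi> x (Y x)" if "x \<in> points P" for x
    using that by (simp only: apply_endo_def if_True)
  have h: "hor X Y z \<in> tangent_space M (fst z)" by (rule hor_tangent[OF X Y z])
  have C: "(\<lambda>f. \<eta> z (X z) * J (fst z) (tan_fst (Y z)) f + \<eta> z (Y z) * J (fst z) (tan_fst (X z)) f) \<in> tangent_space M (fst z)"
    by (intro M.tangent_lincomb J_tangent t1 X Y)
  have JC: "J (fst z) (\<lambda>f. hor X Y z f - (\<eta> z (X z) * J (fst z) (tan_fst (Y z)) f + \<eta> z (Y z) * J (fst z) (tan_fst (X z)) f)) f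
      = J (fst z) (hor X Y z) f + (\<eta> z (X z) * tan_fst (Y z) f + \<eta> z (Y z) * tan_fst (X z) f)" for f
  proof -
    have "J (fst z) (\<lambda>f. hor X Y z f - (\<eta> z (X z) * J (fst z) (tan_fst (Y z)) f + \<eta> z (Y z) * J (fst z) (tan_fst (X z)) f))
      = (\<lambda>f. J (fst z) (hor X Y z) f
          - (\<eta> z (X z) * J (fst z) (J (fst z) (tan_fst (Y z))) f + \<eta> z (Y z) * J (fst z) (J (fst z) (tan_fst (X z))) f))"
      unfolding J_sub[OF h C] J_lincomb[OF J_tangent[OF t1[OF Y]] J_tangent[OF t1[OF X]]] ..
    then show ?thesis by (simp add: JJ[OF t1[OF X]] JJ[OF t1[OF Y]])
  qed
  have R: "(\<lambda>f. G z (X z) (Y z) * \<xi> z f - \<eta> z (Y z) * X z f) = (\<lambda>f. G z (X z) (Y z) * \<xi> z f + (- \<eta> z (Y z)) * X z f)"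
    by simp
  show ?thesis
    unfolding cov_deriv_endo_def
  proof (rule tangent_ext)
    show "(\<lambda>f. nabla X (apply_endo P \<phi> Y) z f - \<phi> z (nabla X Y z) f) \<in> tangent_space P z"
      by (intro P.tangent_sub n' \<phi>_tangent n)
    show "(\<lambda>f. G z (X z) (Y z) * \<xi> z f - \<eta> z (Y z) * X z f) \<in> tangent_space P z"
      unfolding R by (intro P.tangent_lincomb \<xi>_tangent z t X)
    show "tan_fst (\<lambda>f. nabla X (apply_endo P \<phi> Y) z f - \<phi> z (nabla X Y z) f)
        = tan_fst (\<lambda>f. G z (X z) (Y z) * \<xi> z f - \<eta> z (Y z) * X z f)"
      unfolding R tan_fst_lincomb unfolding tan_fst_sub tan_fst_nabla[OF X \<phi>Y z] hor_\<phi>[OF X Y z] \<phi>Yz[OF z]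
        tan_fst_\<phi>[OF t[OF Y]] \<eta>_\<phi>[OF t[OF Y]] JJ[OF t1[OF Y]] tan_fst_\<phi>[OF n] tan_fst_nabla[OF X Y z] JC tan_fst_\<xi>[OF z]
      by (simp add: algebra_simps)
    have "eventually (\<lambda>x. \<eta> x (apply_endo P \<phi> Y x) = 0) (nhdsin (mtop P) z)"
      using P.eventually_points by eventually_elim (simp only: \<phi>Yz \<eta>_\<phi>[OF P.vector_fields_tangent[OF Y]])
    then have "X z (\<lambda>x. \<eta> x (apply_endo P \<phi> Y x)) = X z (\<lambda>x. 0)"
      by (rule P.tangent_cong[OF t[OF X]])
    then have 1: "X z (\<lambda>x. \<eta> x (apply_endo P \<phi> Y x)) = 0"
      using P.tangent_const[OF t[OF X]] by simp
    show "\<eta> z (\<lambda>f. nabla X (apply_endo P \<phi> Y) z f - \<phi> z (nabla X Y z) f)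
        = \<eta> z (\<lambda>f. G z (X z) (Y z) * \<xi> z f - \<eta> z (Y z) * X z f)"
      unfolding R linear_at_lincomb[OF \<eta>_linear[OF z] \<xi>_tangent[OF z] t[OF X]]
        P.linear_at_sub[OF \<eta>_linear[OF z] n' \<phi>_tangent[OF n]] \<eta>_nabla[OF X \<phi>Y z] 1 \<phi>Yz[OF z] tan_fst_\<phi>[OF t[OF Y]]
        g_JJ[OF t1[OF Y] t1[OF X]] \<eta>_\<phi>[OF n] \<eta>_\<xi>[OF z]
      using g_sym[OF t1[OF X] t1[OF Y]] by (simp add: G_eq)
  qed
qed

text \<open>The place where \<alpha> = 1 and the condition on \<omega> enter the construction. The
  horizontal corrections are symmetric in \<open>X\<close> and \<open>Y\<close>. The vertical terms
  antisymmetrize to \<open>-2 g (X, J Y)\<close>, while \<open>ext_deriv_\<eta>\<close> calls for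
  this with the factor \<alpha>.\<close>

lemma nabla_torsion:
  assumes d\<omega>: "\<And>X Y p. X \<in> vector_fields M \<Longrightarrow> Y \<in> vector_fields M \<Longrightarrow> p \<in> points M \<Longrightarrow>
      ext_deriv M \<omega> X Y p = fundamental_form J g X Y p"
    and \<alpha>: "\<alpha> = 1" and X: "X \<in> vector_fields P" and Y: "Y \<in> vector_fields P"
  shows "(\<lambda>p f. nabla X Y p f - nabla Y X p f) = lie_bracket P X Y"
proof
  fix z
  show "(\<lambda>f. nabla X Y z f - nabla Y X z f) = lie_bracket P X Y z"
  proof (cases "z \<in> points P")
    case z: True
    note t1 = tan_fst_tangent[OF P.vector_fields_tangent[OF _ z]]
    note n = nabla_tangent[OF X Y z] nabla_tangent[OF Y X z]
    show ?thesis
    proof (rule tangent_ext[OF P.tangent_sub[OF n] P.lie_bracket_tangent[OF X Y z]])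
      show "tan_fst (\<lambda>f. nabla X Y z f - nabla Y X z f) = tan_fst (lie_bracket P X Y z)"
      proof
        fix f
        show "tan_fst (\<lambda>f. nabla X Y z f - nabla Y X z f) f = tan_fst (lie_bracket P X Y z) f"
          unfolding tan_fst_sub tan_fst_nabla[OF X Y z] tan_fst_nabla[OF Y X z] hor_torsion[OF X Y z, symmetric]
          by simp
      qed
      show "\<eta> z (\<lambda>f. nabla X Y z f - nabla Y X z f) = \<eta> z (lie_bracket P X Y z)"
        unfolding P.linear_at_sub[OF \<eta>_linear[OF z] n] \<eta>_nabla[OF X Y z] \<eta>_nabla[OF Y X z]
        using ext_deriv_\<eta>[OF d\<omega> X Y z] g_skew[OF t1[OF X] t1[OF Y]] \<alpha> by simp
    qed
  next
    case False
    then have "lie_bracket P X Y z = (\<lambda>f. 0)"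
      by (simp only: lie_bracket_def simp_thms if_False)
    then show ?thesis by (simp only: nabla_outside[OF False] diff_self)
  qed
qed

lemma sasakian_if_eq_1:
  assumes d\<omega>: "\<And>X Y p. X \<in> vector_fields M \<Longrightarrow> Y \<in> vector_fields M \<Longrightarrow> p \<in> points M \<Longrightarrow>
      ext_deriv M \<omega> X Y p = fundamental_form J g X Y p"
    and \<alpha>: "\<alpha> = 1" and dim: "even DIM('b)"
  shows "sasakian_manifold P \<phi> \<xi> \<eta> G"
  unfolding sasakian_manifold_def levi_civita_def
  by (intro conjI exI[of _ nabla] ballI almost_contact_metric_P[OF dim] nabla_connection
      nabla_torsion[OF d\<omega> \<alpha>] nabla_metric nabla_sasakian)

end

section \<open>The characterisation\<close>

text \<open>Unit length is used in this form: a nowhere vanishing field spans the tangent lines of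
  the curve, so that \<open>curve_coeff\<close> is well defined.\<close>

lemma unit_tangent_field_nonzero:
  assumes "unit_tangent_field I \<beta> T" "q \<in> \<beta> ` I"
  shows "T q \<noteq> (\<lambda>f. 0)"
proof
  assume "T q = (\<lambda>f. 0)"
  moreover have "norm (ambient_vec (T q)) = 1"
    using assms unfolding unit_tangent_field_def by blast
  ultimately show False by (simp add: ambient_vec_def)
qed

theorem theorem3p4:
  fixes M\<^sub>1 :: "('a, 'b::euclidean_space) manifold"
    and J :: "'a \<Rightarrow> 'a tvec \<Rightarrow> 'a tvec"
    and g\<^sub>1 :: "'a \<Rightarrow> 'a tvec \<Rightarrow> 'a tvec \<Rightarrow> real"
    and \<omega> :: "'a \<Rightarrow> 'a tvec \<Rightarrow> real"
    and n :: nat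
    and I :: "real set"
    and \<beta> :: "real \<Rightarrow> 'e::euclidean_space"
    and T :: "'e \<Rightarrow> 'e tvec"
    and \<alpha> :: real
    and B :: "('e, real) manifold"
  assumes "n \<ge> 1" and "DIM('b) = 2 * n"
    and "kaehler_manifold M\<^sub>1 J g\<^sub>1"
    and "one_form M\<^sub>1 \<omega>"
    and "\<forall>X\<in>vector_fields M\<^sub>1. \<forall>Y\<in>vector_fields M\<^sub>1. \<forall>p\<in>points M\<^sub>1.
           ext_deriv M\<^sub>1 \<omega> X Y p = fundamental_form J g\<^sub>1 X Y p"
    and "open_curve I \<beta>"
    and "unit_tangent_field I \<beta> T"
    and "B = submanifold_of (\<beta> ` I)"
  shows "sasakian_manifold (prod_manifold M\<^sub>1 B)
           (bar_phi M\<^sub>1 B J \<omega> T \<alpha>) (bar_xi M\<^sub>1 B T) (bar_eta \<omega> T \<alpha>) (bar_g g\<^sub>1 \<omega> T \<alpha>)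
         \<longleftrightarrow> \<alpha> = 1"
proof -
  obtain D where D: "levi_civita M\<^sub>1 g\<^sub>1 D" "\<And>X Y p. X \<in> vector_fields M\<^sub>1 \<Longrightarrow> Y \<in> vector_fields M\<^sub>1 \<Longrightarrow>
      p \<in> points M\<^sub>1 \<Longrightarrow> cov_deriv_endo M\<^sub>1 D J X Y p = (\<lambda>f. 0)"
    and ah: "almost_hermitian M\<^sub>1 J g\<^sub>1"
    using assms(3) unfolding kaehler_manifold_def by blast
  have pts: "points B = \<beta> ` I"
    unfolding assms(8) by (simp add: submanifold_of_def)
  interpret kaehler_curve_prod M\<^sub>1 B T J g\<^sub>1 \<omega> \<alpha> D
  proof unfold_locales
    show "smooth_manifold M\<^sub>1" using ah unfolding almost_hermitian_def by (rule conjunct1)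
    show "smooth_manifold B" using assms(6) unfolding open_curve_def assms(8) by blast
    show "T \<in> vector_fields B" using assms(7) unfolding unit_tangent_field_def assms(8) by blast
    show "T q \<noteq> (\<lambda>f. 0)" if "q \<in> points B" for q
      using unit_tangent_field_nonzero[OF assms(7)] that pts by blast
  qed (use ah assms(4) D in blast)+
  have d: "ext_deriv M\<^sub>1 \<omega> X Y p = fundamental_form J g\<^sub>1 X Y p"
    if "X \<in> vector_fields M\<^sub>1" "Y \<in> vector_fields M\<^sub>1" "p \<in> points M\<^sub>1" for X Y p
    using assms(5) that by blast
  show ?thesis
    using sasakian_imp_eq_1[OF d] sasakian_if_eq_1[OF d] assms(2) by auto
qed

end
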